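(* For a rectangular Young diagram \[\lambda = p \times q=(\underbrace{q,\dots,q}_{\text{$p$ times}}),\] where $p,q \in \mathbb{N}$, and for an arbitrary partition $\pi$ and parameter $\alpha>0$, \[ \mathrm{Ch}_\pi^{(\alpha)}(\lambda) = \widehat{\mathrm{Ch}}_\pi^{(\alpha)} (\lambda).\]
   Context: Jack characters: with $J^{(\alpha)}_\lambda$ the Jack symmetric function in Macdonald's $J$-normalization, write $J_\lambda^{(\alpha)}=\sum_{|\rho|=|\lambda|}\theta_{\rho}^{(\alpha)}(\lambda)\,p_{\rho}$ and set $\mathrm{Ch}_{\pi}^{(\alpha)}(\lambda)=\alpha^{-\frac{|\pi|-\ell(\pi)}{2}}\binom{|\lambda|-|\pi|+m_1(\pi)}{m_1(\pi)}\,z_\pi\,\theta^{(\alpha)}_{\pi \cup 1^{|\lambda|-|\pi|}}(\lambda)$, where $z_\pi=\pi_1\pi_2\cdots m_1(\pi)!m_2(\pi)!\cdots$ and $m_i(\pi)$ is the multiplicity of $i$ in $\pi$. Maps: a map is a triple $M=(\mathcal{B},\mathcal{W},\mathcal{E})$ of pairings of a finite set $S$. For pairings $P,P'$ of $S$, $\mathcal{L}(P,P')$ is the bipartite graph with vertices the pairs of $P$ and $P'$ and edges the elements of $S$ ($s$ joins the pairs containing it); it is a union of polygons of lengths $2\ell_1\ge2\ell_2\ge\cdots$, and $(\ell_1,\ell_2,\dots)$ is the type of $(P,P')$. Faces of $M$ are polygons of $\mathcal{L}(\mathcal{B},\mathcal{W})$ and the face-type of $M$ is the type of $(\mathcal{B},\mathcal{W})$;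 black (resp. white) vertices $V_\bullet(M)$ (resp. $V_\circ(M)$) are polygons of $\mathcal{L}(\mathcal{B},\mathcal{E})$ (resp. $\mathcal{L}(\mathcal{W},\mathcal{E})$); edges are the pairs of $\mathcal{E}$, an edge being incident to the vertices containing it. For a bipartite graph $G$, $N_G(\lambda)$ is the number of maps $F$ sending white vertices to columns of $\lambda$, black vertices to rows, edges to boxes, such that each edge is sent to a box lying in the row and column of the images of its endpoints; $N_M:=N_G$ for the underlying graph of $M$. Weight: with $\gamma=\frac{1-\alpha}{\sqrt\alpha}$, an edge $\{s_1,s_2\}$ is straight (weight $1$) if $s_1,s_2$ lie in the same face at even distance (even number of edge-sides strictly between them along the polygon), twisted (weight $\gamma$) if in the same face at odd distance, interface (weight $\tfrac12$) if in different faces. Removing an edge $E=\{s_1,s_2\}$: for each of the three pairings $P$, $P_E=P\setminus\{E\}$ if $E\in P$, otherwise replace the pairs $\{s_1,t_1\},\{s_2,t_2\}$ of $P$ by $\{t_1,t_2\}$; $M\setminus E=(\mathcal{B}_E,\mathcal{W}_E,\mathcal{E}_E)$. For a linear order (history) $E_1\prec\dots\prec E_n$ on the edges, $\operatorname{wt}_{M,\prec}$ is the product over $i$ of the weight of $E_{i+1}$ in $M\setminus\{E_1,\dots,E_i\}$, and $\operatorname{wt}_M$ is the average of $\operatorname{wt}_{M,\prec}$ over all $n!$ histories. Orientability generating series: $\widehat{\mathrm{Ch}}_\pi^{(\alpha)}(\lambda):=(-1)^{\ell(\pi)}\sum_M\left(-\frac{1}{\sqrt\alpha}\right)^{|V_\bullet(M)|}(\sqrt\alpha)^{|V_\circ(M)|}\operatorname{wt}_M\,N_M(\lambda)$,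 the sum running over maps $(\mathcal{B},\mathcal{W},\mathcal{E})$ with a fixed couple $(\mathcal{B},\mathcal{W})$ of type $\pi$ and $\mathcal{E}$ ranging over all pairings of the ground set. *)

theory Defs
  imports
    Complex_Main
    "HOL-Library.Multiset"
    "HOL-Library.FuncSet"
    "HOL-Library.Disjoint_Sets"
    "HOL-Library.Poly_Mapping"
    "HOL-Combinatorics.Multiset_Permutations"
begin

section \<open>Partitions and Young diagrams\<close>

text \<open>A partition is the multiset of its (positive) parts, so that the size is \<^const>\<open>sum_mset\<close>,
  the length is \<^const>\<open>size\<close>, and the union of two partitions is multiset addition.\<close>

definition is_partition :: "nat multiset \<Rightarrow> bool" where
  "is_partition \<pi> \<longleftrightarrow> 0 \<notin># \<pi>"

text \<open>Rows and columns are numbered from 0: \<open>part \<nu> i\<close> is the \<open>(i + 1)\<close>-st largest part.\<close>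

definition part :: "nat multiset \<Rightarrow> nat \<Rightarrow> nat" where
  "part \<nu> i = (if i < size \<nu> then rev (sorted_list_of_multiset \<nu>) ! i else 0)"

definition boxes :: "nat multiset \<Rightarrow> (nat \<times> nat) set" where
  "boxes \<nu> = {(i, j). j < part \<nu> i}"

definition rows :: "nat multiset \<Rightarrow> nat set" where
  "rows \<nu> = fst ` boxes \<nu>"

definition columns :: "nat multiset \<Rightarrow> nat set" where
  "columns \<nu> = snd ` boxes \<nu>"

definition arm :: "nat multiset \<Rightarrow> nat \<times> nat \<Rightarrow> nat" where
  "arm \<nu> s = card {j. snd s < j \<and> (fst s, j) \<in> boxes \<nu>}"

definition leg :: "nat multiset \<Rightarrow> nat \<times> nat \<Rightarrow> nat" where
  "leg \<nu> s = card {i. fst s < i \<and> (i, snd s) \<in> boxes \<nu>}"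

definition dominated :: "nat multiset \<Rightarrow> nat multiset \<Rightarrow> bool" where
  "dominated \<mu> \<nu> \<longleftrightarrow>
     sum_mset \<mu> = sum_mset \<nu> \<and> (\<forall>k. (\<Sum>i<k. part \<mu> i) \<le> (\<Sum>i<k. part \<nu> i))"

definition z_num :: "nat multiset \<Rightarrow> nat" where
  "z_num \<pi> = prod_mset \<pi> * (\<Prod>i\<in>set_mset \<pi>. fact (count \<pi> i))"

text \<open>The rectangle with \<open>p\<close> rows and \<open>q\<close> columns; the filter only matters for \<open>q = 0\<close>,
  when the diagram is empty.\<close>

definition rectangle :: "nat \<Rightarrow> nat \<Rightarrow> nat multiset" where
  "rectangle p q = {#x \<in># replicate_mset p q. 0 < x#}"


section \<open>Jack symmetric functions\<close>

text \<open>Formal power series in the variables \<open>x\<^sub>0, x\<^sub>1, \<dots>\<close>, given by their coefficients; a monomial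
  is the finitely supported function of its exponents.\<close>

type_synonym series = "(nat \<Rightarrow>\<^sub>0 nat) \<Rightarrow> real"

definition series_one :: series where
  "series_one m = (if m = 0 then 1 else 0)"

definition series_times :: "series \<Rightarrow> series \<Rightarrow> series" where
  "series_times f g m = (\<Sum>(a, b) | a + b = m. f a * g b)"

definition exponents :: "(nat \<Rightarrow>\<^sub>0 nat) \<Rightarrow> nat multiset" where
  "exponents m = image_mset (Poly_Mapping.lookup m) (mset_set (Poly_Mapping.keys m))"

definition monomial_sym :: "nat multiset \<Rightarrow> series" where
  "monomial_sym \<mu> m = (if exponents m = \<mu> then 1 else 0)"

definition power_sum :: "nat \<Rightarrow> series" where
  "power_sum k m = (if \<exists>i. m = Poly_Mapping.single i k then 1 else 0)"

definition power_sum_prod :: "nat multiset \<Rightarrow> series" where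
  "power_sum_prod \<rho> =
     foldr series_times (map power_sum (sorted_list_of_multiset \<rho>)) series_one"

definition is_power_sum_expansion :: "series \<Rightarrow> (nat multiset \<Rightarrow> real) \<Rightarrow> bool" where
  "is_power_sum_expansion f c \<longleftrightarrow>
     finite {\<rho>. c \<rho> \<noteq> 0} \<and> (\<forall>\<rho>. c \<rho> \<noteq> 0 \<longrightarrow> is_partition \<rho>) \<and>
     f = (\<lambda>m. \<Sum>\<rho> | c \<rho> \<noteq> 0. c \<rho> * power_sum_prod \<rho> m)"

text \<open>Every symmetric function has exactly one such expansion; only those are used below.\<close>

definition power_sum_coeff :: "series \<Rightarrow> nat multiset \<Rightarrow> real" where
  "power_sum_coeff f = (THE c. is_power_sum_expansion f c)"

text \<open>The bilinear form on symmetric functions for which the power sums are orthogonal and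
  \<open>p\<^sub>\<rho>\<close> has square norm \<open>\<alpha> ^ \<ell>(\<rho>) * z\<^sub>\<rho>\<close>.\<close>

definition jack_inner :: "real \<Rightarrow> series \<Rightarrow> series \<Rightarrow> real" where
  "jack_inner \<alpha> f g =
     (\<Sum>\<rho> | power_sum_coeff f \<rho> \<noteq> 0.
        \<alpha> ^ size \<rho> * real (z_num \<rho>) * power_sum_coeff f \<rho> * power_sum_coeff g \<rho>)"

definition is_jack_P_family :: "real \<Rightarrow> (nat multiset \<Rightarrow> series) \<Rightarrow> bool" where
  "is_jack_P_family \<alpha> P \<longleftrightarrow>
     (\<forall>\<nu>. is_partition \<nu> \<longrightarrow>
        (\<exists>u :: nat multiset \<Rightarrow> real. P \<nu> = (\<lambda>m. monomial_sym \<nu> m +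
           (\<Sum>\<mu> | is_partition \<mu> \<and> dominated \<mu> \<nu> \<and> \<mu> \<noteq> \<nu>. u \<mu> * monomial_sym \<mu> m)))) \<and>
     (\<forall>\<nu> \<mu>. is_partition \<nu> \<longrightarrow> is_partition \<mu> \<longrightarrow> \<nu> \<noteq> \<mu> \<longrightarrow> jack_inner \<alpha> (P \<nu>) (P \<mu>) = 0)"

text \<open>For \<open>\<alpha> > 0\<close> such a family exists and is unique on partitions.\<close>

definition jack_P :: "real \<Rightarrow> nat multiset \<Rightarrow> series" where
  "jack_P \<alpha> \<nu> = (THE f. \<exists>P. is_jack_P_family \<alpha> P \<and> f = P \<nu>)"

text \<open>The integral form of Macdonald: \<open>P\<close> scaled by the product of the lower hook lengths.\<close>

definition jack_J :: "real \<Rightarrow> nat multiset \<Rightarrow> series" where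
  "jack_J \<alpha> \<nu> =
     (\<lambda>m. (\<Prod>s\<in>boxes \<nu>. \<alpha> * real (arm \<nu> s) + real (leg \<nu> s) + 1) * jack_P \<alpha> \<nu> m)"

definition jack_theta :: "real \<Rightarrow> nat multiset \<Rightarrow> nat multiset \<Rightarrow> real" where
  "jack_theta \<alpha> \<rho> \<nu> = power_sum_coeff (jack_J \<alpha> \<nu>) \<rho>"

text \<open>When \<open>|\<nu>| < |\<pi>|\<close> there is no partition \<open>\<pi> \<union> 1\<^bsup>|\<nu>| - |\<pi>|\<^esup>\<close>, and the character is zero
  by convention.\<close>

definition jack_Ch :: "real \<Rightarrow> nat multiset \<Rightarrow> nat multiset \<Rightarrow> real" where
  "jack_Ch \<alpha> \<pi> \<nu> =
     (if sum_mset \<pi> \<le> sum_mset \<nu> then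
        \<alpha> powr (- (real (sum_mset \<pi>) - real (size \<pi>)) / 2)
        * real ((sum_mset \<nu> - sum_mset \<pi> + count \<pi> 1) choose count \<pi> 1)
        * real (z_num \<pi>)
        * jack_theta \<alpha> (\<pi> + replicate_mset (sum_mset \<nu> - sum_mset \<pi>) 1) \<nu>
      else 0)"


section \<open>Maps\<close>

definition pairing :: "'a set \<Rightarrow> 'a set set \<Rightarrow> bool" where
  "pairing S P \<longleftrightarrow> partition_on S P \<and> (\<forall>e\<in>P. card e = 2)"

text \<open>Two elements of the ground set, seen as edges of the graph \<open>\<L>(P, P')\<close>, share an end.\<close>

definition adjacent :: "'a set set \<Rightarrow> 'a set set \<Rightarrow> 'a \<Rightarrow> 'a \<Rightarrow> bool" where
  "adjacent P P' s t \<longleftrightarrow> (\<exists>e\<in>P \<union> P'. s \<in> e \<and> t \<in> e)"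

text \<open>The polygons of \<open>\<L>(P, P')\<close> are its connected components; each is represented by the set
  of its edges, a subset of the ground set \<open>\<Union>P = \<Union>P'\<close>.\<close>

definition polygons :: "'a set set \<Rightarrow> 'a set set \<Rightarrow> 'a set set" where
  "polygons P P' = \<Union>P // {(s, t). adjacent P P' s t}\<^sup>+"

definition couple_type :: "'a set set \<Rightarrow> 'a set set \<Rightarrow> nat multiset" where
  "couple_type P P' = image_mset (\<lambda>C. card C div 2) (mset_set (polygons P P'))"

text \<open>Triples \<open>(\<B>, \<W>, \<E>)\<close> of pairings of one finite set.\<close>

type_synonym 'a map_triple = "'a set set \<times> 'a set set \<times> 'a set set"

fun faces :: "'a map_triple \<Rightarrow> 'a set set" where
  "faces (B, W, E) = polygons B W"

fun black_vertices :: "'a map_triple \<Rightarrow> 'a set set" where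
  "black_vertices (B, W, E) = polygons B E"

fun white_vertices :: "'a map_triple \<Rightarrow> 'a set set" where
  "white_vertices (B, W, E) = polygons W E"

fun map_edges :: "'a map_triple \<Rightarrow> 'a set set" where
  "map_edges (B, W, E) = E"


subsection \<open>Embeddings into Young diagrams\<close>

record ('v, 'e) bipartite_graph =
  black :: "'v set"
  white :: "'v set"
  edges :: "'e set"
  incident :: "'e \<Rightarrow> 'v \<Rightarrow> bool"

definition graph_embeddings ::
  "('v, 'e) bipartite_graph \<Rightarrow> nat multiset \<Rightarrow>
     (('v \<Rightarrow> nat) \<times> ('v \<Rightarrow> nat) \<times> ('e \<Rightarrow> nat \<times> nat)) set" where
  "graph_embeddings G \<nu> =
     {(r, c, b). r \<in> black G \<rightarrow>\<^sub>E rows \<nu> \<and> c \<in> white G \<rightarrow>\<^sub>E columns \<nu> \<and> b \<in> edges G \<rightarrow>\<^sub>E boxes \<nu> \<and>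
        (\<forall>e\<in>edges G. (\<forall>v\<in>black G. incident G e v \<longrightarrow> fst (b e) = r v) \<and>
                     (\<forall>v\<in>white G. incident G e v \<longrightarrow> snd (b e) = c v))}"

definition N_graph :: "('v, 'e) bipartite_graph \<Rightarrow> nat multiset \<Rightarrow> nat" where
  "N_graph G \<nu> = card (graph_embeddings G \<nu>)"

definition underlying_graph :: "'a map_triple \<Rightarrow> ('a set, 'a set) bipartite_graph" where
  "underlying_graph M =
     \<lparr>black = black_vertices M, white = white_vertices M, edges = map_edges M,
      incident = (\<lambda>e v. e \<subseteq> v)\<rparr>"

definition N_map :: "'a map_triple \<Rightarrow> nat multiset \<Rightarrow> nat" where
  "N_map M = N_graph (underlying_graph M)"


subsection \<open>Weights\<close>

text \<open>There are \<open>k\<close> edge-sides strictly between \<open>s\<close> and \<open>t\<close> along one of the two arcs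
  of a face; the parity of \<open>k\<close> does not depend on the arc, as faces have even length.\<close>

fun face_distance :: "'a map_triple \<Rightarrow> 'a \<Rightarrow> 'a \<Rightarrow> nat \<Rightarrow> bool" where
  "face_distance (B, W, E) s t k \<longleftrightarrow>
     (\<exists>xs. length xs = k \<and> distinct (s # xs @ [t]) \<and>
           successively (adjacent B W) (s # xs @ [t]))"

definition same_face :: "'a map_triple \<Rightarrow> 'a set \<Rightarrow> bool" where
  "same_face M e \<longleftrightarrow> (\<exists>F\<in>faces M. e \<subseteq> F)"

definition straight :: "'a map_triple \<Rightarrow> 'a set \<Rightarrow> bool" where
  "straight M e \<longleftrightarrow> same_face M e \<and> (\<exists>s t k. e = {s, t} \<and> face_distance M s t k \<and> even k)"

definition twisted :: "'a map_triple \<Rightarrow> 'a set \<Rightarrow> bool" where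
  "twisted M e \<longleftrightarrow> same_face M e \<and> (\<exists>s t k. e = {s, t} \<and> face_distance M s t k \<and> odd k)"

definition gamma_par :: "real \<Rightarrow> real" where
  "gamma_par \<alpha> = (1 - \<alpha>) / sqrt \<alpha>"

text \<open>For an edge of a map, the last case is that of an interface edge.\<close>

definition edge_weight :: "real \<Rightarrow> 'a map_triple \<Rightarrow> 'a set \<Rightarrow> real" where
  "edge_weight \<alpha> M e =
     (if straight M e then 1 else if twisted M e then gamma_par \<alpha> else 1 / 2)"

text \<open>If \<open>e = {s\<^sub>1, s\<^sub>2}\<close> is not in \<open>P\<close>, the union of the two pairs \<open>{s\<^sub>1, t\<^sub>1}\<close>, \<open>{s\<^sub>2, t\<^sub>2}\<close>
  meeting \<open>e\<close>, deprived of \<open>e\<close>, is the new pair \<open>{t\<^sub>1, t\<^sub>2}\<close>.\<close>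

definition pairing_remove :: "'a set \<Rightarrow> 'a set set \<Rightarrow> 'a set set" where
  "pairing_remove e P =
     (if e \<in> P then P - {e}
      else {x \<in> P. x \<inter> e = {}} \<union> {\<Union>{x \<in> P. x \<inter> e \<noteq> {}} - e})"

fun map_remove :: "'a map_triple \<Rightarrow> 'a set \<Rightarrow> 'a map_triple" where
  "map_remove (B, W, E) e = (pairing_remove e B, pairing_remove e W, pairing_remove e E)"

text \<open>A history is the list of all edges, without repetition, in the order of removal.\<close>

fun history_weight :: "real \<Rightarrow> 'a map_triple \<Rightarrow> 'a set list \<Rightarrow> real" where
  "history_weight \<alpha> M [] = 1"
| "history_weight \<alpha> M (e # es) = edge_weight \<alpha> M e * history_weight \<alpha> (map_remove M e) es"

definition map_weight :: "real \<Rightarrow> 'a map_triple \<Rightarrow> real" where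
  "map_weight \<alpha> M =
     (\<Sum>es\<in>permutations_of_set (map_edges M). history_weight \<alpha> M es) / fact (card (map_edges M))"


subsection \<open>Orientability generating series\<close>

definition is_couple :: "'a set set \<Rightarrow> 'a set set \<Rightarrow> nat multiset \<Rightarrow> bool" where
  "is_couple B W \<pi> \<longleftrightarrow>
     (\<exists>S. finite S \<and> pairing S B \<and> pairing S W) \<and> couple_type B W = \<pi>"

text \<open>The series of index \<open>\<pi>\<close>, computed from a couple \<open>(\<B>, \<W>)\<close> of type \<open>\<pi>\<close>.\<close>

definition Ch_hat ::
  "'a set set \<Rightarrow> 'a set set \<Rightarrow> real \<Rightarrow> nat multiset \<Rightarrow> nat multiset \<Rightarrow> real" where
  "Ch_hat B W \<alpha> \<pi> \<nu> =
     (-1) ^ size \<pi> *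
     (\<Sum>E | pairing (\<Union>B) E.
        (- 1 / sqrt \<alpha>) ^ card (black_vertices (B, W, E)) *
        sqrt \<alpha> ^ card (white_vertices (B, W, E)) *
        map_weight \<alpha> (B, W, E) * real (N_map (B, W, E) \<nu>))"

end

theory Submission
  imports Defs "HOL-Computational_Algebra.Polynomial_FPS"
begin

text \<open>Both sides satisfy the same recursion, obtained from the first part of \<open>\<pi>\<close>.

  For maps, the average over histories allows one to remove first the edge that contains a given
  edge-side; according to its type it splits a face, keeps it in one piece, or joins it to another face.

  For Jack functions, let \<open>L\<close> be the Lax operator of Nazarov and Sklyanin on symmetric functions with
  an additional variable \<open>w\<close>. It is self-adjoint, and after the substitution \<open>w = x\<^sub>0\<close> it becomes a
  Dunkl operator that is triangular for the dominance order. Hence the coefficients \<open>P\<^sub>0 L\<^sup>k\<close> of \<open>w\<^sup>0\<close>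
  preserve the line orthogonal to the \<open>m\<^sub>\<mu>\<close> with \<open>\<mu> < \<nu>\<close> inside the span of the \<open>m\<^sub>\<mu>\<close> with
  \<open>\<mu> \<le> \<nu>\<close>; their joint eigenvalues determine \<open>\<nu>\<close>, so these lines are pairwise orthogonal and consist
  of the Jack functions. For the rectangle \<open>p \<times> q\<close> the top coefficients show that
  \<open>(L - \<alpha> q) (L + p)\<close> annihilates the Jack function \<open>E\<close>, and the coefficient of \<open>w\<^sup>k\<close> in this
  equation is the recursion.\<close>

text \<open>On the map side a double count is used: the sum over \<open>y\<close> of the terms in
  which \<open>{x, y}\<close> is removed first depends only on the type of the couple, hence not on
  \<open>x\<close>, so averaging over the first edge of a history amounts to fixing
  \<open>x\<close>. Another face with \<open>2 t\<close> sides then contributes \<open>t\<close>,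
  because an interface edge has weight 1/2.

  On the Jack side, projection alone gives no orthogonality for incomparable partitions, while
  \<open>jack_P\<close> is a \<open>THE\<close> over families orthogonal for all pairs; hence the
  moments and the separation of their eigenvalues. For the rectangle, the leading rearrangements
  have exponent \<open>q\<close> or 0 at \<open>x_0\<close>, and on them the Dunkl operator is
  triangular with eigenvalues \<open>\<alpha> * q\<close> and \<open>- p\<close>: these are the
  constants of the quadratic equation.

  The recursion is homogeneous, so it leaves a scalar open. The scalar comes from the same equation
  read on monomials: filling the rectangle box by box, starting from x_1 ... x_n, yields the lower
  hook product of the \<open>J\<close>-normalization factor by factor.\<close>

section \<open>The Dunkl operator and the Lax operator\<close>

text \<open>A polynomial in \<open>x\<^sub>0, \<dots>, x\<^bsub>N - 1\<^esub>\<close> is the function of its coefficients; \<open>x_shift j k\<close> is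
  multiplication by \<open>x\<^sub>j\<^sup>k\<close>, \<open>p_times N k\<close> multiplication by the power sum \<open>p\<^sub>k\<close>.\<close>

definition x_shift :: "nat \<Rightarrow> nat \<Rightarrow> ((nat \<Rightarrow> nat) \<Rightarrow> real) \<Rightarrow> (nat \<Rightarrow> nat) \<Rightarrow> real" where
  "x_shift j k G m = (if k \<le> m j then G (m(j := m j - k)) else 0)"

definition p_times :: "nat \<Rightarrow> nat \<Rightarrow> ((nat \<Rightarrow> nat) \<Rightarrow> real) \<Rightarrow> (nat \<Rightarrow> nat) \<Rightarrow> real" where
  "p_times N k G m = (\<Sum>i<N. x_shift i k G m)"

definition x_one :: "nat \<Rightarrow> (nat \<Rightarrow> nat) \<Rightarrow> real" where
  "x_one N m = (if \<forall>i<N. m i = 0 then 1 else 0)"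

text \<open>A divided difference in coefficients: the monomial with exponents \<open>(a, b)\<close>
  at \<open>x_0, x_j\<close> contributes 1 to every \<open>(a + b - d, d)\<close> with
  \<open>b < d \<le> a\<close>, and -1 to those with \<open>a < d \<le> b\<close>.\<close>

definition T_op :: "nat \<Rightarrow> ((nat \<Rightarrow> nat) \<Rightarrow> real) \<Rightarrow> (nat \<Rightarrow> nat) \<Rightarrow> real" where
  "T_op j G m = (\<Sum>c<m j. G (m(0 := m 0 + m j - c, j := c)) - G (m(0 := c, j := m 0 + m j - c)))"

definition Y_op :: "real \<Rightarrow> nat \<Rightarrow> ((nat \<Rightarrow> nat) \<Rightarrow> real) \<Rightarrow> (nat \<Rightarrow> nat) \<Rightarrow> real" where
  "Y_op \<alpha> N G m = \<alpha> * real (m 0) * G m + (\<Sum>j\<in>{1..<N}. T_op j G m)"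

text \<open>The operator is \<open>\<Sum>p\<^sub>i w\<^sup>- \<^sup>i + \<Sum>w\<^sup>i d\<^sub>i + (\<alpha> - 1) w \<partial>\<^sub>w\<close>, where \<open>d\<^sub>i\<close> is adjoint to \<open>p\<^sub>i\<close>, written in
  the coordinates \<open>f k \<rho> = \<langle>w\<^sup>k p\<^sub>\<rho>, f\<rangle>\<close>; since it is self-adjoint, the basis \<open>w\<^sup>k p\<^sub>\<rho>\<close> itself is
  transformed by the same formula.\<close>

definition lax :: "real \<Rightarrow> (nat \<Rightarrow> nat multiset \<Rightarrow> real) \<Rightarrow> nat \<Rightarrow> nat multiset \<Rightarrow> real" where
  "lax \<alpha> f k \<rho> = (\<Sum>x\<in>#\<rho>. \<alpha> * real x * f (k + x) (\<rho> - {#x#})) +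
     (\<Sum>i=1..k. f (k - i) (add_mset i \<rho>)) + (\<alpha> - 1) * real k * f k \<rho>"

lemma x_shift_commute: "x_shift i k (x_shift j l G) = x_shift j l (x_shift i k G)"
  by (rule ext) (auto simp: x_shift_def fun_upd_twist add.commute)

lemma x_shift_sum: "x_shift i k (\<lambda>m. \<Sum>a\<in>A. G a m) = (\<lambda>m. \<Sum>a\<in>A. x_shift i k (G a) m)"
  by (rule ext) (simp add: x_shift_def)

lemma p_times_sum: "p_times N k (\<lambda>m. \<Sum>a\<in>A. G a m) = (\<lambda>m. \<Sum>a\<in>A. p_times N k (G a) m)"
  by (rule ext) (simp add: p_times_def x_shift_sum sum.swap[of _ A])

lemma p_times_x_shift: "p_times N k (x_shift j l G) = x_shift j l (p_times N k G)"
  by (rule ext) (simp add: p_times_def[abs_def] x_shift_sum x_shift_commute[of _ k])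

lemma p_times_commute: "p_times N k (p_times N l G) = p_times N l (p_times N k G)"
proof -
  have "p_times N k (p_times N l G) = (\<lambda>m. \<Sum>i<N. p_times N k (x_shift i l G) m)"
    by (subst p_times_def[of N l, abs_def]) (simp add: p_times_sum)
  also have "\<dots> = p_times N l (p_times N k G)"
    by (simp add: p_times_x_shift p_times_def[of N l, abs_def])
  finally show ?thesis .
qed

lemma T_op_sum: "T_op j (\<lambda>m. \<Sum>a\<in>A. G a m) m = (\<Sum>a\<in>A. T_op j (G a) m)"
  unfolding T_op_def by (subst sum.swap) (simp add: sum_subtractf)

lemma Y_op_sum: "Y_op \<alpha> N (\<lambda>m. \<Sum>a\<in>A. G a m) m = (\<Sum>a\<in>A. Y_op \<alpha> N (G a) m)"
  unfolding Y_op_def by (simp add: T_op_sum sum.distrib sum_distrib_left sum.swap[of _ A])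

lemma T_op_scale: "T_op j (\<lambda>m. c * G m) m = c * T_op j G m"
  unfolding T_op_def by (simp add: sum_distrib_left right_diff_distrib)

lemma Y_op_scale: "Y_op \<alpha> N (\<lambda>m. c * G m) m = c * Y_op \<alpha> N G m"
  unfolding Y_op_def by (simp add: T_op_scale sum_distrib_left algebra_simps)

lemma x_shift_scale: "x_shift j k (\<lambda>m. c * G m) m = c * x_shift j k G m"
  by (simp add: x_shift_def)

lemma p_times_scale: "p_times N k (\<lambda>m. c * G m) m = c * p_times N k G m"
  by (simp add: p_times_def x_shift_scale sum_distrib_left)

lemma x_shift_add: "x_shift j k (\<lambda>m. G m + H m) m = x_shift j k G m + x_shift j k H m"
  by (simp add: x_shift_def)

lemma p_times_add: "p_times N k (\<lambda>m. G m + H m) m = p_times N k G m + p_times N k H m"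
  by (simp add: p_times_def x_shift_add sum.distrib)

lemma T_op_x_shift_other:
  assumes "i \<noteq> 0" "i \<noteq> j"
  shows "T_op j (x_shift i k G) m = x_shift i k (T_op j G) m"
proof -
  have "m(0 := x, j := y, i := z) = m(i := z, 0 := x, j := y)" for x y z
    using assms by (auto simp: fun_eq_iff)
  then show ?thesis
    using assms by (auto simp: T_op_def x_shift_def cong: if_cong)
qed

lemma sum_antisymmetric_zero:
  fixes h :: "nat \<Rightarrow> real"
  assumes "\<And>c. a \<le> c \<Longrightarrow> c \<le> b \<Longrightarrow> h (a + b - c) = - h c"
  shows "(\<Sum>c=a..b. h c) = 0"
proof -
  have "(\<Sum>c=a..b. h c) = (\<Sum>c=a..b. h (a + b - c))"
    by (rule sum.reindex_bij_witness[of _ "\<lambda>c. a + b - c" "\<lambda>c. a + b - c"]) auto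
  also have "\<dots> = - (\<Sum>c=a..b. h c)"
    using assms by (simp add: sum_negf)
  finally show ?thesis by simp
qed

text \<open>\<open>T_op j\<close> is \<open>f \<mapsto> x\<^sub>j (f - s f) / (x\<^sub>0 - x\<^sub>j)\<close>, where \<open>s\<close> exchanges \<open>x\<^sub>0\<close> and \<open>x\<^sub>j\<close>,
  so it commutes with multiplication by \<open>x\<^sub>0\<^sup>k + x\<^sub>j\<^sup>k\<close>.\<close>

lemma T_op_x_shift_pair:
  assumes j: "j \<noteq> 0" and k: "k > 0"
  shows "T_op j (\<lambda>m. x_shift 0 k G m + x_shift j k G m) m
       = x_shift 0 k (T_op j G) m + x_shift j k (T_op j G) m"
proof -
  define a b where "a = m 0" and "b = m j"
  define g where "g x y = G (m(0 := x, j := y))" for x y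
  define h where "h c = g (a + b - k - c) c - g c (a + b - k - c)" for c
  have up: "(m(0 := x, j := y)) (0 := x', j := y') = m(0 := x', j := y')"
    "(m(0 := x, j := y)) (0 := x') = m(0 := x', j := y)"
    "(m(0 := x, j := y)) (j := y') = m(0 := x, j := y')" for x y x' y'
    using j by (auto simp: fun_eq_iff)
  have up': "m(j := y, 0 := x, j := z) = m(0 := x, j := z)" for x y z
    using j by (auto simp: fun_eq_iff)
  have "T_op j (\<lambda>m. x_shift 0 k G m + x_shift j k G m) m =
    (\<Sum>c<b. (if k \<le> a + b - c then g (a + b - c - k) c else 0) + (if k \<le> c then g (a + b - c) (c - k) else 0)
       - ((if k \<le> c then g (c - k) (a + b - c) else 0) + (if k \<le> a + b - c then g c (a + b - c - k) else 0)))"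
    unfolding T_op_def x_shift_def using j
    by (simp add: up a_def[symmetric] b_def[symmetric] g_def cong: if_cong)
  also have "\<dots> = (\<Sum>c<b. (if c \<le> a + b - k \<and> k \<le> a + b then h c else 0) + (if k \<le> c then h (c - k) else 0))"
  proof (rule sum.cong[OF refl])
    fix c assume c: "c \<in> {..<b}"
    have 1: "a + b - c - k = a + b - k - c" by simp
    have 2: "k \<le> c \<longrightarrow> k \<le> a + b" using c by auto
    have 3: "k \<le> a + b - c \<longleftrightarrow> c \<le> a + b - k \<and> k \<le> a + b" using c by auto
    show "(if k \<le> a + b - c then g (a + b - c - k) c else 0) + (if k \<le> c then g (a + b - c) (c - k) else 0)
       - ((if k \<le> c then g (c - k) (a + b - c) else 0) + (if k \<le> a + b - c then g c (a + b - c - k) else 0))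
       = (if c \<le> a + b - k \<and> k \<le> a + b then h c else 0) + (if k \<le> c then h (c - k) else 0)"
      unfolding 1 3 h_def using 2 by (cases "k \<le> c") (simp_all del: diff_diff_left)
  qed
  also have "\<dots> = (\<Sum>c<b. if c \<le> a + b - k \<and> k \<le> a + b then h c else 0) + (\<Sum>c<b. if k \<le> c then h (c - k) else 0)"
    by (simp add: sum.distrib)
  also have "(\<Sum>c<b. if k \<le> c then h (c - k) else 0) = (\<Sum>c\<in>{k..<b}. h (c - k))"
    by (rule sum.mono_neutral_cong_right) auto
  also have "\<dots> = (\<Sum>c<b - k. h c)"
    by (rule sum.reindex_bij_witness[of _ "\<lambda>c. c + k" "\<lambda>c. c - k"]) auto
  also have "(\<Sum>c<b. if c \<le> a + b - k \<and> k \<le> a + b then h c else 0) = (if k \<le> a then (\<Sum>c<b. h c) else 0)"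
  proof (cases "k \<le> a")
    case True
    then show ?thesis by (auto intro!: sum.cong)
  next
    case False
    show ?thesis
    proof (cases "k \<le> a + b")
      case True
      \<comment> \<open>Here \<open>a < k\<close>, so \<open>a + b - k < b\<close> and the sum fills
        the whole interval up to \<open>a + b - k\<close>, on which \<open>h\<close> is
        antisymmetric. This agrees with \<open>x_shift 0 k\<close>, which gives 0 at
        \<open>m\<close>.\<close>
      have "(\<Sum>c<b. if c \<le> a + b - k \<and> k \<le> a + b then h c else 0) = (\<Sum>c=0..a + b - k. h c)"
        using False True k by (intro sum.mono_neutral_cong_right) auto
      also have "\<dots> = 0"
        by (rule sum_antisymmetric_zero) (simp add: h_def del: diff_diff_left)
      finally show ?thesis using False by simp
    qed (use False in auto)
  qed
  also have "(if k \<le> a then (\<Sum>c<b. h c) else 0) = x_shift 0 k (T_op j G) m"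
    unfolding T_op_def x_shift_def using j
    by (auto simp: up' a_def[symmetric] b_def[symmetric] g_def[symmetric] h_def cong: if_cong intro!: sum.cong)
  also have "(\<Sum>c<b - k. h c) = x_shift j k (T_op j G) m"
    unfolding T_op_def x_shift_def using j
    by (auto simp: up' a_def[symmetric] b_def[symmetric] g_def[symmetric] h_def cong: if_cong intro!: sum.cong)
  finally show ?thesis .
qed

lemma T_op_add: "T_op j (\<lambda>m. G m + H m) m = T_op j G m + T_op j H m"
  unfolding T_op_def by (simp add: sum.distrib[symmetric] algebra_simps)

lemma T_op_p_times:
  assumes "j \<in> {1..<N}" and k: "k > 0"
  shows "T_op j (p_times N k G) m = p_times N k (T_op j G) m"
proof -
  have S: "{..<N} = insert 0 (insert j ({..<N} - {0, j}))" using assms by auto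
  have split: "p_times N k H = (\<lambda>m. (x_shift 0 k H m + x_shift j k H m) + (\<Sum>i\<in>{..<N} - {0, j}. x_shift i k H m))" for H
    unfolding p_times_def by (rule ext, subst S, subst sum.insert) (use assms in auto)
  show ?thesis
    unfolding split T_op_add T_op_sum
    using assms by (simp add: T_op_x_shift_pair[unfolded T_op_add] T_op_x_shift_other)
qed

text \<open>\<open>p_k\<close> is symmetric in \<open>x_0\<close> and \<open>x_j\<close>, so it
  passes through every \<open>T_op j\<close>. Only the Euler term \<open>\<alpha> x_0 d/dx_0\<close>
  fails to commute; by the Leibniz rule it adds \<open>\<alpha> k x_0^k\<close>.\<close>

lemma Y_op_p_times:
  assumes k: "k > 0" and N: "N > 0"
  shows "Y_op \<alpha> N (p_times N k G) m = p_times N k (Y_op \<alpha> N G) m + \<alpha> * real k * x_shift 0 k G m"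
proof -
  have S: "{..<N} = insert 0 {1..<N}" using N by auto
  have "p_times N k (\<lambda>m. \<alpha> * real (m 0) * G m) m + \<alpha> * real k * x_shift 0 k G m
      = \<alpha> * real (m 0) * p_times N k G m"
    unfolding p_times_def S
    by (subst (1 2) sum.insert) (auto simp: x_shift_def sum_distrib_left algebra_simps of_nat_diff intro!: sum.cong)
  moreover have "p_times N k (Y_op \<alpha> N G) m = p_times N k (\<lambda>m. \<alpha> * real (m 0) * G m) m + (\<Sum>j\<in>{1..<N}. p_times N k (T_op j G) m)"
    unfolding Y_op_def[abs_def] p_times_add p_times_sum ..
  ultimately show ?thesis
    using k by (simp add: Y_op_def T_op_p_times)
qed

interpretation p_times: comp_fun_commute "p_times N"
  by standard (auto simp: fun_eq_iff p_times_commute)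

text \<open>The image of \<open>w^k p_\<rho>\<close> under \<open>w = x_0\<close>; the fold is well
  defined because multiplications by power sums commute.\<close>

definition pw_basis :: "nat \<Rightarrow> nat \<Rightarrow> nat multiset \<Rightarrow> (nat \<Rightarrow> nat) \<Rightarrow> real" where
  "pw_basis N k \<rho> = fold_mset (p_times N) (x_shift 0 k (x_one N)) \<rho>"

lemma pw_basis_empty: "pw_basis N k {#} = x_shift 0 k (x_one N)"
  by (simp add: pw_basis_def)

lemma pw_basis_add: "pw_basis N k (add_mset x \<rho>) = p_times N x (pw_basis N k \<rho>)"
  by (simp add: pw_basis_def)

lemma x_shift_pw_basis: "x_shift 0 i (pw_basis N k \<rho>) = pw_basis N (k + i) \<rho>"
proof (induction \<rho>)
  case empty
  show ?case
    by (rule ext) (auto simp: pw_basis_empty x_shift_def add.commute)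
next
  case (add x \<rho>)
  then show ?case by (simp add: pw_basis_add p_times_x_shift[symmetric])
qed

text \<open>Division gives the sum of \<open>x_0^(k - i) x_j^i\<close> over
  \<open>1 \<le> i \<le> k\<close> for \<open>T_op j\<close>. Completing these sums to power sums
  needs the terms with \<open>j = 0\<close>, which are \<open>k\<close> copies of
  \<open>x_0^k\<close>; this turns the Euler coefficient \<open>\<alpha>\<close> into
  \<open>\<alpha> - 1\<close>.\<close>

lemma Y_op_pw_basis_empty:
  assumes N: "N > 0"
  shows "Y_op \<alpha> N (x_shift 0 k (x_one N)) m =
    (\<Sum>i=1..k. p_times N i (x_shift 0 (k - i) (x_one N)) m) + (\<alpha> - 1) * real k * x_shift 0 k (x_one N) m"
proof -
  have S: "{..<N} = insert 0 {1..<N}" using N by auto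
  have X: "x_shift 0 k (x_one N) m = (if m 0 = k \<and> (\<forall>i\<in>{1..<N}. m i = 0) then 1 else 0)" for m k
    using N by (fastforce simp: x_shift_def x_one_def)
  have T: "T_op j (x_shift 0 k (x_one N)) m = (\<Sum>i=1..k. x_shift j i (x_shift 0 (k - i) (x_one N)) m)"
    if j: "j \<in> {1..<N}" for j
  proof -
    let ?R = "\<forall>i\<in>{1..<N} - {j}. m i = 0"
    have *: "(\<forall>i\<in>{1..<N}. (m(0 := x, j := c)) i = 0) \<longleftrightarrow> c = 0 \<and> ?R" for x c
      using j by auto
    have **: "(\<forall>i\<in>{1..<N}. (m(j := c)) i = 0) \<longleftrightarrow> c = 0 \<and> ?R" for c
      using j by auto
    have "T_op j (x_shift 0 k (x_one N)) m = (\<Sum>c<m j. if c = 0 then (if m 0 + m j = k \<and> ?R then 1 else 0) else 0)"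
      unfolding T_op_def X * using j by (intro sum.cong) auto
    also have "\<dots> = (if m 0 + m j = k \<and> ?R \<and> m j > 0 then 1 else 0)"
      by (auto simp: sum.delta)
    finally have 1: "T_op j (x_shift 0 k (x_one N)) m = (if m 0 + m j = k \<and> ?R \<and> m j > 0 then 1 else 0)" .
    have "(\<Sum>i=1..k. x_shift j i (x_shift 0 (k - i) (x_one N)) m) =
       (\<Sum>i=1..k. if i = m j then (if m 0 + m j = k \<and> ?R then 1 else 0) else 0)"
      unfolding x_shift_def[of j] X ** using j by (intro sum.cong) auto
    also have "\<dots> = (if m 0 + m j = k \<and> ?R \<and> m j > 0 then 1 else 0)"
      by (auto simp: sum.delta)
    finally show ?thesis using 1 by simp
  qed
  have 0: "x_shift 0 i (x_shift 0 (k - i) (x_one N)) m = x_shift 0 k (x_one N) m" if "i \<in> {1..k}" for i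
    using that by (auto simp: x_shift_def)
  have P: "(\<Sum>i=1..k. p_times N i (x_shift 0 (k - i) (x_one N)) m)
    = real k * x_shift 0 k (x_one N) m + (\<Sum>j\<in>{1..<N}. \<Sum>i=1..k. x_shift j i (x_shift 0 (k - i) (x_one N)) m)"
    unfolding p_times_def S by (subst sum.swap) (simp add: 0)
  have M: "real (m 0) * x_shift 0 k (x_one N) m = real k * x_shift 0 k (x_one N) m"
    by (simp add: X)
  show ?thesis
    unfolding Y_op_def P using M by (simp add: T algebra_simps)
qed

lemma p_times_mset_sum: "p_times N k (\<lambda>m. \<Sum>a\<in>#A. G a m) m = (\<Sum>a\<in>#A. p_times N k (G a) m)"
  by (induction A) (auto simp: p_times_add p_times_def x_shift_def sum.distrib[symmetric] intro!: sum.cong)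

text \<open>\<open>Y_op\<close> is carried past one factor \<open>p_x\<close> at a time; each
  passage leaves the commutator \<open>\<alpha> x x_0^x\<close>, which is the term of
  \<open>lax\<close> that removes the part \<open>x\<close>.\<close>

lemma Y_op_pw_basis:
  assumes N: "N > 0" and "0 \<notin># \<rho>"
  shows "Y_op \<alpha> N (pw_basis N k \<rho>) m = lax \<alpha> (\<lambda>k \<rho>. pw_basis N k \<rho> m) k \<rho>"
  using \<open>0 \<notin># \<rho>\<close>
proof (induction \<rho> arbitrary: m)
  case empty
  show ?case
    using N by (simp add: pw_basis_empty Y_op_pw_basis_empty lax_def pw_basis_add)
next
  case (add x \<rho>)
  have IH: "Y_op \<alpha> N (pw_basis N k \<rho>) = (\<lambda>m. lax \<alpha> (\<lambda>k \<rho>. pw_basis N k \<rho> m) k \<rho>)"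
    using add by auto
  have x: "x > 0" using add.prems by (cases x) auto
  have "Y_op \<alpha> N (pw_basis N k (add_mset x \<rho>)) m =
     p_times N x (\<lambda>m. lax \<alpha> (\<lambda>k \<rho>. pw_basis N k \<rho> m) k \<rho>) m + \<alpha> * real x * pw_basis N (k + x) \<rho> m"
    unfolding pw_basis_add using x N by (subst Y_op_p_times) (auto simp: IH x_shift_pw_basis)
  also have "p_times N x (\<lambda>m. lax \<alpha> (\<lambda>k \<rho>. pw_basis N k \<rho> m) k \<rho>) m =
     (\<Sum>y\<in>#\<rho>. \<alpha> * real y * pw_basis N (k + y) (add_mset x (\<rho> - {#y#})) m) +
     (\<Sum>i=1..k. pw_basis N (k - i) (add_mset i (add_mset x \<rho>)) m) + (\<alpha> - 1) * real k * pw_basis N k (add_mset x \<rho>) m"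
    unfolding lax_def p_times_add p_times_scale p_times_sum p_times_mset_sum
    by (simp add: pw_basis_add add_mset_commute[of _ x])
  also have "(\<Sum>y\<in>#\<rho>. \<alpha> * real y * pw_basis N (k + y) (add_mset x (\<rho> - {#y#})) m) =
     (\<Sum>y\<in>#\<rho>. \<alpha> * real y * pw_basis N (k + y) (add_mset x \<rho> - {#y#}) m)"
    by (intro arg_cong[of _ _ sum_mset] image_mset_cong) (auto simp: diff_union_swap2)
  finally show ?case by (simp add: lax_def)
qed

section \<open>The scalar product\<close>

definition par :: "nat \<Rightarrow> nat multiset set" where
  "par n = {\<rho>. sum_mset \<rho> = n \<and> 0 \<notin># \<rho>}"

lemma finite_par: "finite (par n)"
proof (induction n rule: less_induct)
  case (less n)
  have "par n \<subseteq> insert {#} (\<Union>x\<in>{1..n}. add_mset x ` par (n - x))"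
  proof
    fix \<rho> assume r: "\<rho> \<in> par n"
    show "\<rho> \<in> insert {#} (\<Union>x\<in>{1..n}. add_mset x ` par (n - x))"
    proof (cases \<rho>)
      case (add x \<rho>')
      then have "x \<in> {1..n}" "\<rho>' \<in> par (n - x)"
        using r by (auto simp: par_def)
      then show ?thesis using add by auto
    qed simp
  qed
  moreover have "finite (\<Union>x\<in>{1..n}. add_mset x ` par (n - x))"
    using less by auto
  ultimately show ?case
    using finite_subset by blast
qed

definition states :: "nat \<Rightarrow> (nat \<times> nat multiset) set" where
  "states n = (SIGMA k:{..n}. par (n - k))"

lemma finite_states: "finite (states n)"
  by (simp add: states_def finite_par)

lemma in_states: "(k, \<rho>) \<in> states n \<longleftrightarrow> k + sum_mset \<rho> = n \<and> 0 \<notin># \<rho>"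
  by (auto simp: states_def par_def)

text \<open>The inverse square norm of \<open>w^k p_\<rho>\<close>. It appears in \<open>ip\<close>
  because \<open>f k \<rho>\<close> is a scalar product with the basis vector, not a
  coefficient.\<close>

definition pweight :: "real \<Rightarrow> nat multiset \<Rightarrow> real" where
  "pweight \<alpha> \<rho> = 1 / (\<alpha> ^ size \<rho> * real (z_num \<rho>))"

lemma z_num_add: "z_num (add_mset x \<rho>) = x * (count \<rho> x + 1) * z_num \<rho>"
proof -
  let ?S = "insert x (set_mset \<rho>)"
  have "(\<Prod>y\<in>?S. fact (count (add_mset x \<rho>) y)) = (\<Prod>y\<in>?S. (if y = x then count \<rho> x + 1 else 1) * fact (count \<rho> y))"
    by (intro prod.cong) auto
  also have "\<dots> = (count \<rho> x + 1) * (\<Prod>y\<in>?S. fact (count \<rho> y))"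
    by (simp add: prod.distrib)
  also have "(\<Prod>y\<in>?S. fact (count \<rho> y)) = (\<Prod>y\<in>set_mset \<rho>. fact (count \<rho> y) :: nat)"
    by (rule prod.mono_neutral_right) (auto simp: not_in_iff)
  finally show ?thesis by (simp add: z_num_def algebra_simps)
qed

lemma z_num_pos: "0 \<notin># \<rho> \<Longrightarrow> z_num \<rho> > 0"
  by (induction \<rho>) (auto simp: z_num_add, simp add: z_num_def)

lemma pweight_pos: "\<alpha> > 0 \<Longrightarrow> 0 \<notin># \<rho> \<Longrightarrow> pweight \<alpha> \<rho> > 0"
  by (simp add: pweight_def z_num_pos)

lemma pweight_add:
  assumes "\<alpha> > 0" "x > 0"
  shows "pweight \<alpha> (add_mset x \<rho>) * (real (count \<rho> x + 1) * (\<alpha> * real x)) = pweight \<alpha> \<rho>"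
proof (cases "z_num \<rho> = 0")
  case False
  define C where "C = real (count \<rho> x + 1)"
  have C: "C > 0" by (simp add: C_def)
  have "real (z_num (add_mset x \<rho>)) = real x * C * real (z_num \<rho>)"
    by (simp only: C_def z_num_add of_nat_mult)
  then show ?thesis
    unfolding C_def[symmetric] using C assms False by (simp add: pweight_def field_simps)
qed (simp add: pweight_def z_num_add)

definition ip :: "real \<Rightarrow> nat \<Rightarrow> (nat \<Rightarrow> nat multiset \<Rightarrow> real) \<Rightarrow> (nat \<Rightarrow> nat multiset \<Rightarrow> real) \<Rightarrow> real" where
  "ip \<alpha> n f g = (\<Sum>(k, \<rho>)\<in>states n. pweight \<alpha> \<rho> * f k \<rho> * g k \<rho>)"

lemma ip_commute: "ip \<alpha> n f g = ip \<alpha> n g f"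
  by (auto simp: ip_def intro!: sum.cong)

lemma ip_add_left: "ip \<alpha> n (\<lambda>k \<rho>. f k \<rho> + g k \<rho>) h = ip \<alpha> n f h + ip \<alpha> n g h"
  by (simp add: ip_def sum.distrib[symmetric] algebra_simps case_prod_beta)

lemma ip_scale_left: "ip \<alpha> n (\<lambda>k \<rho>. c * f k \<rho>) h = c * ip \<alpha> n f h"
  by (simp add: ip_def sum_distrib_left algebra_simps case_prod_beta)

lemma ip_sum_left: "ip \<alpha> n (\<lambda>k \<rho>. \<Sum>a\<in>A. f a k \<rho>) h = (\<Sum>a\<in>A. ip \<alpha> n (f a) h)"
  unfolding ip_def by (subst sum.swap) (simp add: sum_distrib_left sum_distrib_right case_prod_beta)

lemma ip_diff_left: "ip \<alpha> n (\<lambda>k \<rho>. f k \<rho> - g k \<rho>) h = ip \<alpha> n f h - ip \<alpha> n g h"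
  by (simp add: ip_def sum_subtractf[symmetric] algebra_simps case_prod_beta)

lemma ip_cong:
  assumes "\<And>k \<rho>. (k, \<rho>) \<in> states n \<Longrightarrow> f k \<rho> = f' k \<rho>" "\<And>k \<rho>. (k, \<rho>) \<in> states n \<Longrightarrow> g k \<rho> = g' k \<rho>"
  shows "ip \<alpha> n f g = ip \<alpha> n f' g'"
  using assms by (auto simp: ip_def intro!: sum.cong)

lemma ip_zero:
  assumes a: "\<alpha> > 0" and z: "ip \<alpha> n f f = 0" and s: "(k, \<rho>) \<in> states n"
  shows "f k \<rho> = 0"
proof -
  have "\<forall>s\<in>states n. (case s of (k, \<rho>) \<Rightarrow> pweight \<alpha> \<rho> * f k \<rho> * f k \<rho>) = 0"
    using z unfolding ip_def
    by (subst (asm) sum_nonneg_eq_0_iff)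
       (auto simp: finite_states in_states mult.assoc less_imp_le[OF pweight_pos[OF a]])
  then have "pweight \<alpha> \<rho> * f k \<rho> * f k \<rho> = 0" using s by auto
  moreover have "pweight \<alpha> \<rho> \<noteq> 0"
    using pweight_pos[OF a, of \<rho>] s by (auto simp: in_states)
  ultimately show ?thesis by simp
qed

lemma sum_mset_conv_count:
  fixes g :: "nat \<Rightarrow> real"
  shows "(\<Sum>x\<in>#A. g x) = (\<Sum>x\<in>set_mset A. real (count A x) * g x)"
proof (induction A)
  case (add x A)
  have "(\<Sum>y\<in>set_mset (add_mset x A). real (count (add_mset x A) y) * g y) =
      (\<Sum>y\<in>set_mset (add_mset x A). real (count A y) * g y + (if y = x then g y else 0))"
    by (intro sum.cong) (auto simp: algebra_simps)
  also have "\<dots> = (\<Sum>y\<in>set_mset (add_mset x A). real (count A y) * g y) + g x"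
    by (simp add: sum.distrib)
  also have "(\<Sum>y\<in>set_mset (add_mset x A). real (count A y) * g y) = (\<Sum>y\<in>set_mset A. real (count A y) * g y)"
    by (rule sum.mono_neutral_right) (auto simp: not_in_iff)
  finally show ?case using add by simp
qed simp

text \<open>Removing a part is inverted by adding it. The multiplicity with which \<open>x\<close>
  occurs in the sum over the multiset is what \<open>pweight_add\<close> needs to turn the weight of
  \<open>\<rho>\<close> into that of \<open>\<rho> - {#x#}\<close>.\<close>

lemma ip_create_annihilate:
  assumes a: "\<alpha> > 0"
  shows "ip \<alpha> n (\<lambda>k \<rho>. \<Sum>x\<in>#\<rho>. \<alpha> * real x * f (k + x) (\<rho> - {#x#})) g
       = ip \<alpha> n f (\<lambda>k \<rho>. \<Sum>i=1..k. g (k - i) (add_mset i \<rho>))"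
proof -
  have "ip \<alpha> n (\<lambda>k \<rho>. \<Sum>x\<in>#\<rho>. \<alpha> * real x * f (k + x) (\<rho> - {#x#})) g =
    (\<Sum>s\<in>states n. \<Sum>x\<in>set_mset (snd s). pweight \<alpha> (snd s) * (real (count (snd s) x) * (\<alpha> * real x)) *
       f (fst s + x) (snd s - {#x#}) * g (fst s) (snd s))"
    unfolding ip_def sum_mset_conv_count
    by (auto simp: sum_distrib_left sum_distrib_right algebra_simps intro!: sum.cong)
  also have "\<dots> = (\<Sum>(s, x)\<in>(SIGMA s:states n. set_mset (snd s)). pweight \<alpha> (snd s) * (real (count (snd s) x) * (\<alpha> * real x)) *
       f (fst s + x) (snd s - {#x#}) * g (fst s) (snd s))"
    by (rule sum.Sigma) (auto simp: finite_states)
  also have "\<dots> = (\<Sum>(s, x)\<in>(SIGMA s:states n. {1..fst s}). pweight \<alpha> (snd s) * f (fst s) (snd s) * g (fst s - x) (add_mset x (snd s)))"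
  proof (rule sum.reindex_bij_witness[of _ "\<lambda>((k, \<rho>), x). ((k - x, add_mset x \<rho>), x)" "\<lambda>((k, \<rho>), x). ((k + x, \<rho> - {#x#}), x)"], goal_cases)
    case (1 t)
    then show ?case by (auto simp: in_states)
  next
    case (2 t)
    then obtain k \<rho> x where t: "t = ((k, \<rho>), x)" "x \<in># \<rho>" "(k, \<rho>) \<in> states n" by auto
    then obtain \<rho>' where "\<rho> = add_mset x \<rho>'" by (meson mset_add)
    then show ?case using t by (auto simp: in_states)
  next
    case (3 t)
    then show ?case by auto
  next
    case (4 t)
    then show ?case by (auto simp: in_states)
  next
    case (5 t)
    then obtain k \<rho> x where t: "t = ((k, \<rho>), x)" "x \<in># \<rho>" "(k, \<rho>) \<in> states n" by auto
    then obtain \<rho>' where r: "\<rho> = add_mset x \<rho>'" by (meson mset_add)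
    then have "x > 0" using t by (cases x) (auto simp: in_states)
    then show ?case using t pweight_add[OF a, of x \<rho>'] by (auto simp: r)
  qed
  also have "\<dots> = (\<Sum>s\<in>states n. \<Sum>x\<in>{1..fst s}. pweight \<alpha> (snd s) * f (fst s) (snd s) * g (fst s - x) (add_mset x (snd s)))"
    by (rule sum.Sigma[symmetric]) (auto simp: finite_states)
  also have "\<dots> = ip \<alpha> n f (\<lambda>k \<rho>. \<Sum>i=1..k. g (k - i) (add_mset i \<rho>))"
    unfolding ip_def by (auto simp: sum_distrib_left intro!: sum.cong)
  finally show ?thesis .
qed

lemma ip_lax:
  assumes a: "\<alpha> > 0"
  shows "ip \<alpha> n (lax \<alpha> f) g = ip \<alpha> n f (lax \<alpha> g)"
proof -
  have L: "lax \<alpha> f = (\<lambda>k \<rho>. ((\<Sum>x\<in>#\<rho>. \<alpha> * real x * f (k + x) (\<rho> - {#x#})) +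
     (\<Sum>i=1..k. f (k - i) (add_mset i \<rho>))) + (\<alpha> - 1) * real k * f k \<rho>)" for f
    by (simp add: lax_def fun_eq_iff)
  have 1: "ip \<alpha> n (lax \<alpha> f) g = ip \<alpha> n f (\<lambda>k \<rho>. \<Sum>i=1..k. g (k - i) (add_mset i \<rho>))
     + ip \<alpha> n g (\<lambda>k \<rho>. \<Sum>i=1..k. f (k - i) (add_mset i \<rho>))
     + ip \<alpha> n (\<lambda>k \<rho>. (\<alpha> - 1) * real k * f k \<rho>) g" for f g
    unfolding L ip_add_left ip_create_annihilate[OF a] by (simp add: ip_commute)
  have 2: "ip \<alpha> n (\<lambda>k \<rho>. (\<alpha> - 1) * real k * f k \<rho>) g = ip \<alpha> n (\<lambda>k \<rho>. (\<alpha> - 1) * real k * g k \<rho>) f"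
    by (auto simp: ip_def intro!: sum.cong)
  show ?thesis
    unfolding ip_commute[of \<alpha> n f] 1 2 by simp
qed

text \<open>The polynomial in \<open>N\<close> variables with coordinates \<open>f\<close>, after
  \<open>w = x_0\<close>; \<open>pweight\<close> converts coordinates into coefficients of the
  basis.\<close>

definition xpoly :: "real \<Rightarrow> nat \<Rightarrow> nat \<Rightarrow> (nat \<Rightarrow> nat multiset \<Rightarrow> real) \<Rightarrow> (nat \<Rightarrow> nat) \<Rightarrow> real" where
  "xpoly \<alpha> N n f m = ip \<alpha> n f (\<lambda>k \<rho>. pw_basis N k \<rho> m)"

text \<open>By linearity \<open>Y_op\<close> acts on the basis vectors through \<open>lax\<close>;
  self-adjointness moves this action over to the coordinates.\<close>

lemma Y_op_xpoly:
  assumes a: "\<alpha> > 0" and N: "N > 0"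
  shows "Y_op \<alpha> N (xpoly \<alpha> N n f) m = xpoly \<alpha> N n (lax \<alpha> f) m"
proof -
  have "xpoly \<alpha> N n f = (\<lambda>m. \<Sum>s\<in>states n. pweight \<alpha> (snd s) * f (fst s) (snd s) * pw_basis N (fst s) (snd s) m)"
    by (simp add: xpoly_def ip_def case_prod_beta fun_eq_iff)
  then have "Y_op \<alpha> N (xpoly \<alpha> N n f) m = ip \<alpha> n f (lax \<alpha> (\<lambda>k \<rho>. pw_basis N k \<rho> m))"
    using N by (auto simp: Y_op_sum Y_op_scale ip_def Y_op_pw_basis in_states case_prod_beta intro!: sum.cong)
  then show ?thesis
    by (simp add: xpoly_def ip_lax[OF a])
qed

lemma pw_basis_degree:
  assumes "pw_basis N k \<rho> m \<noteq> 0" "N > 0"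
  shows "(\<Sum>i<N. m i) = k + sum_mset \<rho>"
  using assms(1)
proof (induction \<rho> arbitrary: m)
  case empty
  then have k: "k \<le> m 0" "\<forall>i<N. (m(0 := m 0 - k)) i = 0"
    by (auto simp: pw_basis_empty x_shift_def x_one_def split: if_splits)
  have "\<forall>i\<in>{..<N} - {0}. m i = 0"
  proof
    fix i assume "i \<in> {..<N} - {0}"
    then show "m i = 0" using k(2)[rule_format, of i] by auto
  qed
  moreover have "m 0 = k"
    using k(1) k(2)[rule_format, of 0] assms(2) by auto
  moreover have "(\<Sum>i<N. m i) = m 0 + (\<Sum>i\<in>{..<N} - {0}. m i)"
    using assms(2) by (subst sum.remove[of _ 0]) auto
  ultimately show ?case by simp
next
  case (add x \<rho>)
  then obtain i where i: "i < N" "x_shift i x (pw_basis N k \<rho>) m \<noteq> 0"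
    unfolding pw_basis_add p_times_def by (metis lessThan_iff sum.neutral)
  then have x: "x \<le> m i" and "pw_basis N k \<rho> (m(i := m i - x)) \<noteq> 0"
    by (auto simp: x_shift_def split: if_splits)
  then have "(\<Sum>j<N. (m(i := m i - x)) j) = k + sum_mset \<rho>"
    using add.IH by blast
  moreover have "(\<Sum>j<N. (m(i := m i - x)) j) = (m i - x) + (\<Sum>j\<in>{..<N} - {i}. m j)"
    using i by (subst sum.remove[of _ i]) auto
  moreover have "(\<Sum>j<N. m j) = m i + (\<Sum>j\<in>{..<N} - {i}. m j)"
    using i by (subst sum.remove[of _ i]) auto
  ultimately show ?case using x by simp
qed

section \<open>Triangularity\<close>

definition exps :: "nat \<Rightarrow> (nat \<Rightarrow> nat) \<Rightarrow> nat multiset" where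
  "exps N m = filter_mset (\<lambda>x. x \<noteq> 0) (image_mset m (mset_set {..<N}))"

text \<open>Dominance is tested by the convex functions \<open>x \<mapsto> max (x - t) 0\<close> (truncated subtraction), which
  avoids sorting.\<close>

definition excess :: "nat multiset \<Rightarrow> nat \<Rightarrow> nat" where
  "excess \<nu> t = (\<Sum>x\<in>#\<nu>. x - t)"

lemma sum_exps:
  fixes g :: "nat \<Rightarrow> 'b::comm_monoid_add"
  assumes "g 0 = 0"
  shows "(\<Sum>x\<in>#exps N m. g x) = (\<Sum>i<N. g (m i))"
proof -
  have "(\<Sum>x\<in>#filter_mset (\<lambda>x. x \<noteq> 0) A. g x) = (\<Sum>x\<in>#A. g x)" for A
    using assms by (induction A) auto
  then show ?thesis
    by (simp add: exps_def sum_unfold_sum_mset image_mset.compositionality comp_def)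
qed

lemma excess_exps: "excess (exps N m) t = (\<Sum>i<N. m i - t)"
  unfolding excess_def by (rule sum_exps) simp

lemma sum_mset_exps: "sum_mset (exps N m) = (\<Sum>i<N. m i)"
  using sum_exps[of "\<lambda>x. x" N m] by simp

lemma zero_notin_exps: "0 \<notin># exps N m"
  by (simp add: exps_def)

lemma xpoly_support: "xpoly \<alpha> N n f m \<noteq> 0 \<Longrightarrow> N > 0 \<Longrightarrow> exps N m \<in> par n"
proof -
  assume *: "xpoly \<alpha> N n f m \<noteq> 0" "N > 0"
  then obtain s where "s \<in> states n" "pw_basis N (fst s) (snd s) m \<noteq> 0"
    unfolding xpoly_def ip_def by (metis (mono_tags, lifting) case_prod_beta mult_zero_right sum.neutral)
  then show ?thesis
    using pw_basis_degree[of N "fst s" "snd s" m] * in_states[of "fst s" "snd s" n]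
    by (auto simp: par_def sum_mset_exps zero_notin_exps)
qed

text \<open>The induction works with the multiset of all \<open>N\<close> exponents, zeros included,
  since multiplication by a power sum alters one of them. At the end the zeros are recovered from
  their number, which is \<open>N\<close> minus the size of \<open>exps N m\<close>.\<close>

lemma pw_basis_symmetric:
  obtains H where "\<And>m. pw_basis N 0 \<rho> m = H (exps N m)"
proof -
  let ?fm = "\<lambda>m. image_mset m (mset_set {..<N})"
  have "\<exists>H. \<forall>m. pw_basis N 0 \<rho> m = H (?fm m)"
  proof (induction \<rho>)
    case empty
    have "pw_basis N 0 {#} m = (if set_mset (?fm m) \<subseteq> {0} then 1 else 0)" for m
      by (auto simp: pw_basis_empty x_shift_def x_one_def)
    then show ?case by (intro exI[of _ "\<lambda>M. if set_mset M \<subseteq> {0} then 1 else 0"]) auto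
  next
    case (add x \<rho>)
    then obtain H where H: "\<And>m. pw_basis N 0 \<rho> m = H (?fm m)" by auto
    have "pw_basis N 0 (add_mset x \<rho>) m = (\<Sum>v\<in>#?fm m. if x \<le> v then H (add_mset (v - x) (?fm m - {#v#})) else 0)" for m
    proof -
      have "?fm (m(i := y)) = add_mset y (?fm m - {#m i#})" if "i < N" for i y
      proof -
        have S: "{..<N} = insert i ({..<N} - {i})" using that by auto
        have 1: "?fm m' = add_mset (m' i) (image_mset m' (mset_set ({..<N} - {i})))" for m'
          by (subst S, subst mset_set.insert) auto
        have 2: "image_mset (m(i := y)) (mset_set ({..<N} - {i})) = image_mset m (mset_set ({..<N} - {i}))"
          by (intro image_mset_cong) auto
        show ?thesis unfolding 1[of "m(i := y)"] 1[of m] 2 by simp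
      qed
      then show ?thesis
        by (auto simp: pw_basis_add p_times_def x_shift_def H sum_unfold_sum_mset image_mset.compositionality comp_def
            intro!: arg_cong[of _ _ sum_mset] image_mset_cong)
    qed
    then show ?case by (intro exI[of _ "\<lambda>M. \<Sum>v\<in>#M. if x \<le> v then H (add_mset (v - x) (M - {#v#})) else 0"]) auto
  qed
  then obtain H where H: "\<And>m. pw_basis N 0 \<rho> m = H (?fm m)" by auto
  have "?fm m = exps N m + replicate_mset (N - size (exps N m)) 0" for m
  proof -
    have "?fm m = exps N m + filter_mset (\<lambda>x. \<not> x \<noteq> 0) (?fm m)"
      unfolding exps_def by (rule multiset_partition)
    moreover have "filter_mset (\<lambda>x. \<not> x \<noteq> 0) (?fm m) = replicate_mset (count (?fm m) 0) 0"
      by (simp add: filter_eq_replicate_mset[symmetric] eq_commute)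
    moreover have "size (?fm m) = N" by simp
    ultimately show ?thesis
      by (metis add_diff_cancel_left' size_replicate_mset size_union)
  qed
  then show thesis
    using that[of "\<lambda>\<nu>. H (\<nu> + replicate_mset (N - size \<nu>) 0)"] H by metis
qed

text \<open>Terms with \<open>c\<close> strictly between the two exponents cancel in pairs under
  \<open>c \<mapsto> m 0 + m j - c\<close>; the term \<open>c = m 0\<close> survives as the exchange
  of the exponents.\<close>

lemma T_op_split:
  assumes "j \<noteq> 0"
  shows "T_op j G m =
    (\<Sum>c<min (m 0) (m j). G (m(0 := m 0 + m j - c, j := c)) - G (m(0 := c, j := m 0 + m j - c))) +
    (if m 0 < m j then G (m(0 := m j, j := m 0)) - G m else 0)"
proof (cases "m 0 < m j")
  case False
  then show ?thesis by (simp add: T_op_def min_def)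
next
  case True
  let ?h = "\<lambda>c. G (m(0 := m 0 + m j - c, j := c)) - G (m(0 := c, j := m 0 + m j - c))"
  have S: "{..<m j} = ({..<m 0} \<union> {m 0}) \<union> {m 0 + 1..m j - 1}" using True by auto
  have "sum ?h {m 0 + 1..m j - 1} = 0"
    by (rule sum_antisymmetric_zero) (use True in auto)
  then have "T_op j G m = sum ?h {..<m 0} + ?h (m 0)"
    unfolding T_op_def S by (subst sum.union_disjoint; (subst sum.union_disjoint)?; auto)
  moreover have "m(0 := m 0, j := m j) = m" by auto
  ultimately show ?thesis using True by (simp add: min_def)
qed

lemma sum_update_two:
  fixes g m :: "nat \<Rightarrow> nat"
  assumes "0 < N" "j < N" "j \<noteq> 0"
  shows "(\<Sum>i<N. g ((m(0 := x, j := y)) i)) = g x + g y + (\<Sum>i\<in>{..<N} - {0, j}. g (m i))"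
proof -
  let ?m = "m(0 := x, j := y)"
  have "(\<Sum>i<N. g (?m i)) = g (?m 0) + (g (?m j) + (\<Sum>i\<in>{..<N} - {0} - {j}. g (?m i)))"
    using sum.remove[of "{..<N}" 0 "\<lambda>i. g (?m i)"] sum.remove[of "{..<N} - {0}" j "\<lambda>i. g (?m i)"] assms
    by simp
  also have "{..<N} - {0} - {j} = {..<N} - {0, j}" by auto
  also have "(\<Sum>i\<in>{..<N} - {0, j}. g (?m i)) = (\<Sum>i\<in>{..<N} - {0, j}. g (m i))"
    by (intro sum.cong) auto
  finally show ?thesis using assms by (simp add: fun_upd_def)
qed

lemma excess_update_two:
  assumes "0 < N" "j < N" "j \<noteq> 0"
  shows "excess (exps N (m(0 := x, j := y))) t = (x - t) + (y - t) + (\<Sum>i\<in>{..<N} - {0, j}. m i - t)"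
  unfolding excess_exps using sum_update_two[OF assms, of "\<lambda>v. v - t"] by simp

lemma excess_two:
  assumes "0 < N" "j < N" "j \<noteq> 0"
  shows "excess (exps N m) t = (m 0 - t) + (m j - t) + (\<Sum>i\<in>{..<N} - {0, j}. m i - t)"
  using excess_update_two[OF assms, of m "m 0" "m j"] by simp

definition excess_le :: "nat multiset \<Rightarrow> nat multiset \<Rightarrow> bool" where
  "excess_le \<mu> \<nu> \<longleftrightarrow> sum_mset \<mu> = sum_mset \<nu> \<and> (\<forall>t. excess \<mu> t \<le> excess \<nu> t)"

definition lower_set :: "nat multiset set \<Rightarrow> bool" where
  "lower_set S \<longleftrightarrow> (\<forall>\<mu> \<nu>. \<nu> \<in> S \<longrightarrow> 0 \<notin># \<mu> \<longrightarrow> excess_le \<mu> \<nu> \<longrightarrow> \<mu> \<in> S)"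

definition supported :: "nat \<Rightarrow> nat multiset set \<Rightarrow> ((nat \<Rightarrow> nat) \<Rightarrow> real) \<Rightarrow> bool" where
  "supported N S G \<longleftrightarrow> (\<forall>m. G m \<noteq> 0 \<longrightarrow> exps N m \<in> S)"

text \<open>Moving two numbers apart while keeping their sum increases the sum of every convex
  function.\<close>

lemma excess_le_spread:
  assumes "0 < N" "j < N" "j \<noteq> 0" "c \<le> min (m 0) (m j)" "x + y = m 0 + m j" "x = c \<or> y = c"
  shows "excess_le (exps N m) (exps N (m(0 := x, j := y)))"
proof -
  have "(m 0 - t) + (m j - t) \<le> (x - t) + (y - t)" for t
    using assms by auto
  moreover have "sum_mset \<mu> = excess \<mu> 0" for \<mu> by (simp add: excess_def)
  ultimately show ?thesis
    using assms by (simp add: excess_le_def excess_update_two excess_two)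
qed

text \<open>The coefficient of \<open>Y_op \<alpha> N G\<close> at \<open>m\<close> uses
  \<open>G\<close> only at exponents obtained from \<open>m\<close> by spreading or exchanging two
  of them, and these dominate \<open>m\<close>.\<close>

lemma supported_Y_op:
  assumes S: "lower_set S" and G: "supported N S G" and N: "0 < N"
  shows "supported N S (Y_op \<alpha> N G)"
  unfolding supported_def
proof (intro allI impI, rule ccontr)
  fix m assume Y: "Y_op \<alpha> N G m \<noteq> 0" and n: "exps N m \<notin> S"
  have G0: "G m' = 0" if "excess_le (exps N m) (exps N m')" for m'
    using that S G n zero_notin_exps unfolding lower_set_def supported_def by metis
  have "G m = 0" using G0[of m] by (simp add: excess_le_def)
  moreover have "T_op j G m = 0" if j: "j \<in> {1..<N}" for j
  proof -
    have j': "0 < N" "j < N" "j \<noteq> 0" using j by auto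
    have "G (m(0 := m 0 + m j - c, j := c)) = 0" "G (m(0 := c, j := m 0 + m j - c)) = 0" if "c \<le> min (m 0) (m j)" for c
      using that by (auto intro!: G0 excess_le_spread[OF j', of c])
    moreover have "G (m(0 := m j, j := m 0)) = 0" if "m 0 < m j"
      using that by (auto intro!: G0 excess_le_spread[OF j', of "m 0"])
    ultimately show ?thesis
      using \<open>G m = 0\<close> j' by (subst T_op_split) auto
  qed
  ultimately show False using Y by (simp add: Y_op_def)
qed

text \<open>At a monomial of the top type, a strict spread of two exponents leaves the support of
  \<open>G\<close>, so each \<open>T_op j\<close> is reduced to its exchange term.\<close>

lemma Y_op_leading:
  assumes N: "0 < N" and m: "exps N m = \<nu>"
    and G: "supported N {\<mu>. excess_le \<mu> \<nu>} G"
  shows "Y_op \<alpha> N G m = \<alpha> * real (m 0) * G m +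
     (\<Sum>j\<in>{1..<N}. if m 0 < m j then G (m(0 := m j, j := m 0)) - G m else 0)"
proof -
  have "T_op j G m = (if m 0 < m j then G (m(0 := m j, j := m 0)) - G m else 0)" if j: "j \<in> {1..<N}" for j
  proof -
    have j': "0 < N" "j < N" "j \<noteq> 0" using j by auto
    have "G (m(0 := x, j := y)) = 0" if "x + y = m 0 + m j" "x = c \<or> y = c" "c < min (m 0) (m j)" for x y c
    proof (rule ccontr)
      assume "G (m(0 := x, j := y)) \<noteq> 0"
      then have "excess_le (exps N (m(0 := x, j := y))) (exps N m)"
        using G m by (auto simp: supported_def)
      \<comment> \<open>Truncation at the larger exponent detects a strict spread: both exponents
        contribute 0 before it, and one of them a positive number after it.\<close>
      then have "excess (exps N (m(0 := x, j := y))) (max (m 0) (m j)) \<le> excess (exps N m) (max (m 0) (m j))"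
        by (auto simp: excess_le_def)
      then show False
        unfolding excess_update_two[OF j'] excess_two[OF j', of m] using that by auto
    qed
    then have "(\<Sum>c<min (m 0) (m j). G (m(0 := m 0 + m j - c, j := c)) - G (m(0 := c, j := m 0 + m j - c))) = 0"
    proof (intro sum.neutral ballI)
      fix c assume "c \<in> {..<min (m 0) (m j)}"
      then show "G (m(0 := m 0 + m j - c, j := c)) - G (m(0 := c, j := m 0 + m j - c)) = 0"
        using \<open>\<And>x y c. \<lbrakk>x + y = m 0 + m j; x = c \<or> y = c; c < min (m 0) (m j)\<rbrakk> \<Longrightarrow> G (m(0 := x, j := y)) = 0\<close>[of _ _ c]
        by simp
    qed
    then show ?thesis using j' by (subst T_op_split) auto
  qed
  then show ?thesis by (simp add: Y_op_def)
qed

text \<open>\<open>tau \<alpha> \<nu> k v\<close> is the coefficient in \<open>L\<^sup>k m\<^sub>\<nu>\<close> of the rearrangements of \<open>x\<^sup>\<nu>\<close> in which \<open>x\<^sub>0\<close>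
  has exponent \<open>v\<close>.\<close>

fun tau :: "real \<Rightarrow> nat multiset \<Rightarrow> nat \<Rightarrow> nat \<Rightarrow> real" where
  "tau \<alpha> \<nu> 0 v = 1"
| "tau \<alpha> \<nu> (Suc k) v = \<alpha> * real v * tau \<alpha> \<nu> k v + (\<Sum>x\<in>#\<nu>. if v < x then tau \<alpha> \<nu> k x - tau \<alpha> \<nu> k v else 0)"

text \<open>Exchanges keep the type, so the leading coefficients remain functions of the exponent of
  \<open>x_0\<close> alone. This is one step of the recursion defining \<open>tau\<close>.\<close>

lemma Y_op_leading_value:
  assumes N: "0 < N" and m: "exps N m = \<nu>"
    and G: "supported N {\<mu>. excess_le \<mu> \<nu>} G"
    and t: "\<And>m. exps N m = \<nu> \<Longrightarrow> G m = \<phi> (m 0)"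
  shows "Y_op \<alpha> N G m = \<alpha> * real (m 0) * \<phi> (m 0) + (\<Sum>x\<in>#\<nu>. if m 0 < x then \<phi> x - \<phi> (m 0) else 0)"
proof -
  have "exps N (m(0 := m j, j := m 0)) = \<nu>" if j: "j \<in> {1..<N}" for j
  proof -
    have S: "{..<N} = insert 0 (insert j ({..<N} - {0, j}))" using j by auto
    have *: "image_mset m (mset_set {..<N}) = add_mset (m 0) (add_mset (m j) (image_mset m (mset_set ({..<N} - {0, j}))))" for m
      by (subst S, subst mset_set.insert) (use j in auto)
    have "image_mset (m(0 := m j, j := m 0)) (mset_set ({..<N} - {0, j})) = image_mset m (mset_set ({..<N} - {0, j}))"
      by (intro image_mset_cong) auto
    then have "image_mset (m(0 := m j, j := m 0)) (mset_set {..<N}) = image_mset m (mset_set {..<N})"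
      unfolding *[of m] *[of "m(0 := m j, j := m 0)"] using j by (auto simp: add_mset_commute)
    then show ?thesis using m by (simp add: exps_def)
  qed
  then have "Y_op \<alpha> N G m = \<alpha> * real (m 0) * \<phi> (m 0) + (\<Sum>j\<in>{1..<N}. if m 0 < m j then \<phi> (m j) - \<phi> (m 0) else 0)"
    unfolding Y_op_leading[OF N m G] using m by (auto simp: t intro!: sum.cong)
  also have "(\<Sum>j\<in>{1..<N}. if m 0 < m j then \<phi> (m j) - \<phi> (m 0) else 0) = (\<Sum>j<N. if m 0 < m j then \<phi> (m j) - \<phi> (m 0) else 0)"
  proof (rule sum.mono_neutral_left)
    show "\<forall>i\<in>{..<N} - {1..<N}. (if m 0 < m i then \<phi> (m i) - \<phi> (m 0) else 0) = 0"
    proof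
      fix i assume "i \<in> {..<N} - {1..<N}"
      then have "i = 0" by auto
      then show "(if m 0 < m i then \<phi> (m i) - \<phi> (m 0) else 0) = 0" by simp
    qed
  qed auto
  also have "\<dots> = (\<Sum>x\<in>#\<nu>. if m 0 < x then \<phi> x - \<phi> (m 0) else 0)"
    unfolding m[symmetric] by (subst sum_exps) auto
  finally show ?thesis .
qed

section \<open>Dominance order and truncated sums\<close>

lemma filter_nonzero_id: "0 \<notin># (\<nu> :: nat multiset) \<Longrightarrow> filter_mset (\<lambda>x. x \<noteq> 0) \<nu> = \<nu>"
  by (induction \<nu>) auto

lemma part_antimono: "i \<le> j \<Longrightarrow> part \<nu> j \<le> part \<nu> i"
proof (cases "j < size \<nu>")
  case True
  assume ij: "i \<le> j"
  let ?l = "sorted_list_of_multiset \<nu>"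
  have s: "length ?l = size \<nu>" by (metis mset_sorted_list_of_multiset size_mset)
  then have "rev ?l ! j \<le> rev ?l ! i"
    using True ij by (auto simp: rev_nth intro!: sorted_nth_mono)
  then show ?thesis using True ij by (simp add: part_def)
qed (simp add: part_def)

lemma part_eq_0: "size \<nu> \<le> i \<Longrightarrow> part \<nu> i = 0"
  by (simp add: part_def)

lemma exps_part:
  assumes "0 \<notin># \<nu>" "size \<nu> \<le> M"
  shows "exps M (part \<nu>) = \<nu>"
proof -
  let ?l = "sorted_list_of_multiset \<nu>"
  have s: "length ?l = size \<nu>" by (metis mset_sorted_list_of_multiset size_mset)
  have "map (part \<nu>) [0..<M] = rev ?l @ replicate (M - size \<nu>) 0"
    using assms s by (intro nth_equalityI) (auto simp: part_def nth_append)
  moreover have "image_mset (part \<nu>) (mset_set {..<M}) = mset (map (part \<nu>) [0..<M])"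
    by (simp add: lessThan_atLeast0)
  ultimately have "image_mset (part \<nu>) (mset_set {..<M}) = \<nu> + replicate_mset (M - size \<nu>) 0"
    by (simp del: map_map mset_map)
  then show ?thesis
    unfolding exps_def using filter_nonzero_id[OF assms(1)] by simp
qed

lemma size_le_sum_mset: "0 \<notin># \<rho> \<Longrightarrow> size \<rho> \<le> sum_mset \<rho>"
  by (induction \<rho>) auto

lemma sum_mset_part:
  fixes g :: "nat \<Rightarrow> 'b::comm_monoid_add"
  assumes "0 \<notin># \<nu>" "size \<nu> \<le> M" "g 0 = 0"
  shows "(\<Sum>x\<in>#\<nu>. g x) = (\<Sum>i<M. g (part \<nu> i))"
  using sum_exps[of g M "part \<nu>"] assms by (simp add: exps_part)

lemma excess_part:
  assumes "0 \<notin># \<nu>" "size \<nu> \<le> M"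
  shows "excess \<nu> t = (\<Sum>i<M. part \<nu> i - t)"
  unfolding excess_def by (rule sum_mset_part[OF assms]) simp

text \<open>Legendre duality: a part is at most \<open>t\<close> plus its truncation at
  \<open>t\<close>. Equality, in the next lemma, occurs when \<open>t\<close> separates the first
  \<open>k\<close> parts from the others.\<close>

lemma partial_sum_le_excess:
  assumes "0 \<notin># \<nu>"
  shows "(\<Sum>i<k. part \<nu> i) \<le> k * t + excess \<nu> t"
proof -
  define M where "M = max k (size \<nu>)"
  have "(\<Sum>i<k. part \<nu> i) \<le> (\<Sum>i<k. t + (part \<nu> i - t))"
    by (intro sum_mono) auto
  also have "\<dots> = k * t + (\<Sum>i<k. part \<nu> i - t)"
    by (simp add: sum.distrib)
  also have "(\<Sum>i<k. part \<nu> i - t) \<le> (\<Sum>i<M. part \<nu> i - t)"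
    by (intro sum_mono2) (auto simp: M_def)
  also have "\<dots> = excess \<nu> t"
    by (rule excess_part[symmetric]) (auto simp: assms M_def)
  finally show ?thesis by simp
qed

lemma partial_sum_eq_excess:
  assumes "0 \<notin># \<nu>" and lo: "\<And>i. i < k \<Longrightarrow> t \<le> part \<nu> i" and hi: "\<And>i. k \<le> i \<Longrightarrow> part \<nu> i \<le> t"
  shows "(\<Sum>i<k. part \<nu> i) = k * t + excess \<nu> t"
proof -
  define M where "M = max k (size \<nu>)"
  have "excess \<nu> t = (\<Sum>i<M. part \<nu> i - t)"
    by (rule excess_part) (auto simp: assms M_def)
  also have "\<dots> = (\<Sum>i<k. part \<nu> i - t)"
    using hi by (intro sum.mono_neutral_right) (auto simp: M_def)
  finally have "k * t + excess \<nu> t = (\<Sum>i<k. t + (part \<nu> i - t))"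
    by (simp add: sum.distrib)
  also have "\<dots> = (\<Sum>i<k. part \<nu> i)"
    using lo by (intro sum.cong) auto
  finally show ?thesis by simp
qed

text \<open>In each direction the dual parameter is chosen where the duality is an equality:
  \<open>k\<close> is the number of parts of \<open>\<mu>\<close> above \<open>t\<close>,
  respectively \<open>t\<close> is the part of \<open>\<nu>\<close> with index
  \<open>k\<close>.\<close>

lemma dominated_iff_excess_le:
  assumes m: "0 \<notin># \<mu>" and n: "0 \<notin># \<nu>"
  shows "dominated \<mu> \<nu> \<longleftrightarrow> excess_le \<mu> \<nu>"
proof
  assume d: "dominated \<mu> \<nu>"
  have "excess \<mu> t \<le> excess \<nu> t" for t
  proof -
    define k where "k = (LEAST i. part \<mu> i \<le> t)"
    have ex: "part \<mu> (size \<mu>) \<le> t" by (simp add: part_def)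
    have "(\<Sum>i<k. part \<mu> i) = k * t + excess \<mu> t"
    proof (rule partial_sum_eq_excess[OF m])
      show "t \<le> part \<mu> i" if "i < k" for i
        using not_less_Least[of i "\<lambda>i. part \<mu> i \<le> t"] that by (simp add: k_def)
      show "part \<mu> i \<le> t" if "k \<le> i" for i
        using LeastI[of "\<lambda>i. part \<mu> i \<le> t", OF ex] part_antimono[OF that, of \<mu>] by (simp add: k_def)
    qed
    moreover have "(\<Sum>i<k. part \<mu> i) \<le> (\<Sum>i<k. part \<nu> i)"
      using d by (simp add: dominated_def)
    ultimately show ?thesis
      using partial_sum_le_excess[OF n, of k t] by linarith
  qed
  then show "excess_le \<mu> \<nu>" using d by (simp add: dominated_def excess_le_def)
next
  assume e: "excess_le \<mu> \<nu>"
  have "(\<Sum>i<k. part \<mu> i) \<le> (\<Sum>i<k. part \<nu> i)" for k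
  proof -
    have "(\<Sum>i<k. part \<nu> i) = k * part \<nu> k + excess \<nu> (part \<nu> k)"
      by (rule partial_sum_eq_excess[OF n]) (auto intro: part_antimono)
    moreover have "excess \<mu> (part \<nu> k) \<le> excess \<nu> (part \<nu> k)"
      using e by (auto simp: excess_le_def)
    ultimately show ?thesis
      using partial_sum_le_excess[OF m, of k "part \<nu> k"] by linarith
  qed
  then show "dominated \<mu> \<nu>" using e by (simp add: dominated_def excess_le_def)
qed

lemma parts_eq_imp_eq:
  assumes "0 \<notin># \<mu>" "0 \<notin># \<nu>" "\<And>i. part \<mu> i = part \<nu> i"
  shows "\<mu> = \<nu>"
proof -
  let ?M = "max (size \<mu>) (size \<nu>)"
  have "part \<mu> = part \<nu>" by (rule ext) (rule assms(3))
  then have "exps ?M (part \<mu>) = exps ?M (part \<nu>)" by (rule arg_cong)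
  moreover have "exps ?M (part \<mu>) = \<mu>" "exps ?M (part \<nu>) = \<nu>"
    by (rule exps_part; simp add: assms(1,2))+
  ultimately show ?thesis by simp
qed

lemma excess_le_antisym:
  assumes "0 \<notin># \<mu>" "0 \<notin># \<nu>" "excess_le \<mu> \<nu>" "excess_le \<nu> \<mu>"
  shows "\<mu> = \<nu>"
proof (rule parts_eq_imp_eq[OF assms(1,2)])
  fix i
  have *: "(\<Sum>i<k. part \<mu> i) = (\<Sum>i<k. part \<nu> i)" for k
  proof (rule antisym)
    show "(\<Sum>i<k. part \<mu> i) \<le> (\<Sum>i<k. part \<nu> i)"
      using assms dominated_iff_excess_le[of \<mu> \<nu>] unfolding dominated_def by blast
    show "(\<Sum>i<k. part \<nu> i) \<le> (\<Sum>i<k. part \<mu> i)"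
      using assms dominated_iff_excess_le[of \<nu> \<mu>] unfolding dominated_def by blast
  qed
  show "part \<mu> i = part \<nu> i" using *[of i] *[of "Suc i"] by simp
qed

lemma excess_le_refl: "excess_le \<mu> \<mu>"
  by (simp add: excess_le_def)

lemma excess_le_trans: "excess_le \<mu> \<nu> \<Longrightarrow> excess_le \<nu> \<rho> \<Longrightarrow> excess_le \<mu> \<rho>"
  unfolding excess_le_def by (auto intro: le_trans)

definition below :: "nat multiset \<Rightarrow> nat multiset set" where
  "below \<nu> = {\<mu>. 0 \<notin># \<mu> \<and> excess_le \<mu> \<nu> \<and> \<mu> \<noteq> \<nu>}"

lemma below_subset_par: "\<nu> \<in> par n \<Longrightarrow> below \<nu> \<subseteq> par n"
  by (auto simp: below_def par_def excess_le_def)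

lemma finite_below: "finite (below \<nu>)"
proof (rule finite_subset)
  show "below \<nu> \<subseteq> par (sum_mset \<nu>)"
    by (auto simp: below_def par_def excess_le_def)
qed (rule finite_par)

lemma below_trans: "0 \<notin># \<nu> \<Longrightarrow> \<mu> \<in> below \<nu> \<Longrightarrow> \<rho> \<in> below \<mu> \<Longrightarrow> \<rho> \<in> below \<nu>"
  unfolding below_def mem_Collect_eq by (metis excess_le_antisym excess_le_trans)

lemma card_below_less: "0 \<notin># \<nu> \<Longrightarrow> \<mu> \<in> below \<nu> \<Longrightarrow> card (below \<mu>) < card (below \<nu>)"
proof (intro psubset_card_mono finite_below)
  assume "0 \<notin># \<nu>" "\<mu> \<in> below \<nu>"
  then have "below \<mu> \<subseteq> below \<nu>" by (meson below_trans subsetI)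
  moreover have "\<mu> \<notin> below \<mu>" by (simp add: below_def)
  ultimately show "below \<mu> \<subset> below \<nu>" using \<open>\<mu> \<in> below \<nu>\<close> by blast
qed

lemma lower_set_below: "0 \<notin># \<nu> \<Longrightarrow> lower_set (below \<nu>)"
  unfolding lower_set_def
proof (intro allI impI)
  fix \<mu> \<rho> assume "0 \<notin># \<nu>" "\<rho> \<in> below \<nu>" "0 \<notin># \<mu>" "excess_le \<mu> \<rho>"
  then show "\<mu> \<in> below \<nu>"
    using below_trans[of \<nu> \<rho> \<mu>] by (cases "\<mu> = \<rho>") (simp_all add: below_def)
qed

lemma lower_set_atmost: "lower_set {\<mu>. excess_le \<mu> \<nu>}"
  by (auto simp: lower_set_def intro: excess_le_trans)

section \<open>Power sums and monomial symmetric functions\<close>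

lemma p_times_nonneg:
  assumes "\<And>m. G m \<ge> 0"
  shows "p_times N k G m \<ge> 0"
  unfolding p_times_def x_shift_def by (intro sum_nonneg) (auto simp: assms)

lemma pw_basis_nonneg: "pw_basis N k \<rho> m \<ge> 0"
  by (induction \<rho> arbitrary: m) (auto simp: pw_basis_add p_times_nonneg, simp add: pw_basis_empty x_shift_def x_one_def)

lemma exps_update:
  assumes "i < N"
  shows "exps N m = (if m i = 0 then {#} else {#m i#}) + exps N (m(i := 0))"
proof -
  have S: "{..<N} = insert i ({..<N} - {i})" using assms by auto
  have 1: "image_mset m' (mset_set {..<N}) = add_mset (m' i) (image_mset m' (mset_set ({..<N} - {i})))" for m' :: "nat \<Rightarrow> nat"
    by (subst S, subst mset_set.insert) auto
  have 2: "image_mset (m(i := 0)) (mset_set ({..<N} - {i})) = image_mset m (mset_set ({..<N} - {i}))"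
    by (intro image_mset_cong) auto
  show ?thesis unfolding exps_def 1[of m] 1[of "m(i := 0)"] 2 by simp
qed

text \<open>A new factor \<open>p_x\<close> either raises an exponent that is already positive,
  which adds no length, or creates the new exponent \<open>x\<close>. Full length means that no
  parts were merged.\<close>

lemma pw_basis_triangular:
  assumes "0 \<notin># \<rho>" "pw_basis N 0 \<rho> m \<noteq> 0"
  shows "size (exps N m) \<le> size \<rho> \<and> (size (exps N m) = size \<rho> \<longrightarrow> exps N m = \<rho>)"
  using assms
proof (induction \<rho> arbitrary: m)
  case empty
  then have "\<forall>i<N. m i = 0"
    by (auto simp: pw_basis_empty x_shift_def x_one_def split: if_splits)
  then have "exps N m = {#}"
    by (auto simp: exps_def)
  then show ?case by simp
next
  case (add x \<rho>)
  then obtain i where i: "i < N" "x_shift i x (pw_basis N 0 \<rho>) m \<noteq> 0"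
    unfolding pw_basis_add p_times_def by (metis lessThan_iff sum.neutral)
  then have x: "x \<le> m i" and "pw_basis N 0 \<rho> (m(i := m i - x)) \<noteq> 0"
    by (auto simp: x_shift_def split: if_splits)
  then have IH: "size (exps N (m(i := m i - x))) \<le> size \<rho> \<and> (size (exps N (m(i := m i - x))) = size \<rho> \<longrightarrow> exps N (m(i := m i - x)) = \<rho>)"
    using add by auto
  have x0: "x > 0" using add.prems by (cases x) auto
  show ?case
    using IH x x0 exps_update[OF i(1), of m] exps_update[OF i(1), of "m(i := m i - x)"]
    by (cases "m i = x") auto
qed

lemma pw_basis_diagonal:
  assumes "0 \<notin># \<rho>" "exps N m = \<rho>"
  shows "pw_basis N 0 \<rho> m > 0"
  using assms
proof (induction \<rho> arbitrary: m)
  case empty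
  then have "\<forall>i<N. m i = 0"
    by (auto simp: exps_def)
  then show ?case
    by (simp add: pw_basis_empty x_shift_def x_one_def)
next
  case (add x \<rho>)
  have x0: "x > 0" using add.prems by (cases x) auto
  have "x \<in># exps N m" using add.prems by simp
  then obtain i where i: "i < N" "m i = x" by (auto simp: exps_def)
  then have "exps N (m(i := 0)) = \<rho>"
    using exps_update[OF i(1), of m] add.prems x0 by simp
  then have "pw_basis N 0 \<rho> (m(i := 0)) > 0" using add by auto
  then have "x_shift i x (pw_basis N 0 \<rho>) m > 0" using i by (simp add: x_shift_def)
  moreover have "x_shift j x (pw_basis N 0 \<rho>) m \<ge> 0" for j
    by (simp add: x_shift_def pw_basis_nonneg)
  ultimately show ?case
    unfolding pw_basis_add p_times_def using i by (intro sum_pos2[of _ i]) auto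
qed

text \<open>Symmetric functions are the elements of degree 0 in \<open>w\<close>.\<close>

definition sym_emb :: "(nat multiset \<Rightarrow> real) \<Rightarrow> nat \<Rightarrow> nat multiset \<Rightarrow> real" where
  "sym_emb c k \<rho> = (if k = 0 then c \<rho> else 0)"

lemma ip_sym_emb: "ip \<alpha> n (sym_emb c) g = (\<Sum>\<rho>\<in>par n. pweight \<alpha> \<rho> * c \<rho> * g 0 \<rho>)"
proof -
  have "ip \<alpha> n (sym_emb c) g = (\<Sum>s\<in>Pair 0 ` par n. case s of (k, \<rho>) \<Rightarrow> pweight \<alpha> \<rho> * sym_emb c k \<rho> * g k \<rho>)"
    unfolding ip_def
    by (rule sum.mono_neutral_right) (auto simp: finite_states in_states par_def sym_emb_def)
  then show ?thesis
    by (simp add: sum.reindex inj_on_def sym_emb_def)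
qed

lemma xpoly_sym_emb: "xpoly \<alpha> N n (sym_emb c) m = (\<Sum>\<rho>\<in>par n. pweight \<alpha> \<rho> * c \<rho> * pw_basis N 0 \<rho> m)"
  by (simp add: xpoly_def ip_sym_emb)

lemma xpoly_sym_emb_exps:
  assumes "exps N m = exps N m'"
  shows "xpoly \<alpha> N n (sym_emb c) m = xpoly \<alpha> N n (sym_emb c) m'"
  unfolding xpoly_sym_emb by (intro sum.cong refl) (metis assms pw_basis_symmetric)

text \<open>Among the \<open>p_\<rho>\<close> that occur, take one of maximal length: no other one
  that occurs contains monomials of type \<open>\<rho>0\<close>. The bound \<open>N > n\<close>
  leaves room for all parts.\<close>

lemma xpoly_sym_emb_injective:
  assumes a: "\<alpha> > 0" and N: "N > n" and z: "\<And>m. xpoly \<alpha> N n (sym_emb c) m = 0" and r: "\<rho> \<in> par n"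
  shows "c \<rho> = 0"
proof (rule ccontr)
  assume "c \<rho> \<noteq> 0"
  then have ne: "\<rho> \<in> {\<rho>\<in>par n. c \<rho> \<noteq> 0}" (is "_ \<in> ?A") using r by simp
  have "finite ?A" by (simp add: finite_par)
  then have "Max (size ` ?A) \<in> size ` ?A" using ne by (intro Max_in) auto
  then obtain \<rho>0 where r0: "\<rho>0 \<in> ?A" "size \<rho>0 = Max (size ` ?A)" by auto
  then have mx: "size \<rho>' \<le> size \<rho>0" if "\<rho>' \<in> ?A" for \<rho>'
    using that \<open>finite ?A\<close> by (auto intro: Max_ge)
  have p0: "0 \<notin># \<rho>0" "size \<rho>0 \<le> N"
    using r0 N size_le_sum_mset[of \<rho>0] by (auto simp: par_def)
  have "xpoly \<alpha> N n (sym_emb c) (part \<rho>0) = (\<Sum>\<rho>'\<in>{\<rho>0}. pweight \<alpha> \<rho>' * c \<rho>' * pw_basis N 0 \<rho>' (part \<rho>0))"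
    unfolding xpoly_sym_emb
  proof (rule sum.mono_neutral_right)
    show "\<forall>\<rho>'\<in>par n - {\<rho>0}. pweight \<alpha> \<rho>' * c \<rho>' * pw_basis N 0 \<rho>' (part \<rho>0) = 0"
    proof
      fix \<rho>' assume r': "\<rho>' \<in> par n - {\<rho>0}"
      have "pw_basis N 0 \<rho>' (part \<rho>0) = 0" if "c \<rho>' \<noteq> 0"
      proof (rule ccontr)
        assume "pw_basis N 0 \<rho>' (part \<rho>0) \<noteq> 0"
        then have "size \<rho>0 \<le> size \<rho>'" "size \<rho>0 = size \<rho>' \<longrightarrow> \<rho>0 = \<rho>'"
          using pw_basis_triangular[of \<rho>' N "part \<rho>0"] r' p0 by (auto simp: exps_part par_def)
        then show False using mx[of \<rho>'] that r' by auto
      qed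
      then show "pweight \<alpha> \<rho>' * c \<rho>' * pw_basis N 0 \<rho>' (part \<rho>0) = 0" by auto
    qed
  qed (use r0 finite_par in auto)
  moreover have "pw_basis N 0 \<rho>0 (part \<rho>0) > 0"
    using p0 by (intro pw_basis_diagonal) (auto simp: exps_part)
  moreover have "pweight \<alpha> \<rho>0 > 0" using a p0 by (simp add: pweight_pos)
  ultimately show False using z[of "part \<rho>0"] r0 by simp
qed

text \<open>Inversion of the triangular system by induction on the length: \<open>p_\<mu>\<close> is
  \<open>H \<mu>\<close> times \<open>m_\<mu>\<close> plus monomial functions of smaller
  length.\<close>

lemma monomial_power_sum_expansion:
  assumes a: "\<alpha> > 0" and N: "N > n" and r: "\<mu> \<in> par n"
  shows "\<exists>c. \<forall>m. xpoly \<alpha> N n (sym_emb c) m = (if exps N m = \<mu> then 1 else 0)"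
  using r
proof (induction "size \<mu>" arbitrary: \<mu> rule: less_induct)
  case less
  let ?L = "{\<nu>\<in>par n. size \<nu> < size \<mu>}"
  have fL: "finite ?L" by (simp add: finite_par)
  have "\<forall>\<nu>\<in>?L. \<exists>c. \<forall>m. xpoly \<alpha> N n (sym_emb c) m = (if exps N m = \<nu> then 1 else 0)"
    using less by auto
  then obtain C where C: "\<And>\<nu> m. \<nu> \<in> ?L \<Longrightarrow> xpoly \<alpha> N n (sym_emb (C \<nu>)) m = (if exps N m = \<nu> then 1 else 0)"
    by metis
  obtain H where H: "\<And>m. pw_basis N 0 \<mu> m = H (exps N m)"
    using pw_basis_symmetric[of N \<mu>] by blast
  have mu: "0 \<notin># \<mu>" "size \<mu> \<le> N" using less.prems N size_le_sum_mset[of \<mu>] by (auto simp: par_def)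
  have H0: "H \<mu> > 0"
    using pw_basis_diagonal[of \<mu> N "part \<mu>"] mu H[of "part \<mu>"] by (simp add: exps_part)
  have exp: "pw_basis N 0 \<mu> m = (if exps N m = \<mu> then H \<mu> else 0) + (\<Sum>\<nu>\<in>?L. H \<nu> * (if exps N m = \<nu> then 1 else 0))" for m
  proof (cases "pw_basis N 0 \<mu> m = 0")
    case True
    then have "H (exps N m) = 0" by (simp add: H)
    then have "exps N m \<noteq> \<mu>" "(\<Sum>\<nu>\<in>?L. H \<nu> * (if exps N m = \<nu> then 1 else 0)) = 0"
      using H0 by (auto intro!: sum.neutral)
    then show ?thesis using True by simp
  next
    case False
    have "exps N m \<in> par n"
      using pw_basis_degree[OF False] N less.prems by (simp add: par_def sum_mset_exps zero_notin_exps)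
    then have "exps N m = \<mu> \<or> exps N m \<in> ?L"
      using pw_basis_triangular[OF mu(1) False] by auto
    then show ?thesis
    proof
      assume e: "exps N m = \<mu>"
      then have "(\<Sum>\<nu>\<in>?L. H \<nu> * (if exps N m = \<nu> then 1 else 0)) = 0"
        by (auto intro!: sum.neutral)
      then show ?thesis using e by (simp add: H)
    next
      assume e: "exps N m \<in> ?L"
      then have "(\<Sum>\<nu>\<in>?L. H \<nu> * (if exps N m = \<nu> then 1 else 0)) = H (exps N m)"
        using fL by (simp add: sum.delta' mult.commute[of "H _"] if_distrib[of "\<lambda>x. x * _"] cong: if_cong)
      then show ?thesis using e by (auto simp: H)
    qed
  qed
  \<comment> \<open>Coordinates are coefficients times square norms, so \<open>p_\<mu>\<close>
    itself has the single coordinate \<open>1 / pweight \<alpha> \<mu>\<close>.\<close>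
  define c where "c \<rho> = ((if \<rho> = \<mu> then 1 / pweight \<alpha> \<mu> else 0) - (\<Sum>\<nu>\<in>?L. H \<nu> * C \<nu> \<rho>)) / H \<mu>" for \<rho>
  have w: "pweight \<alpha> \<mu> \<noteq> 0" using pweight_pos[OF a mu(1)] by simp
  have "xpoly \<alpha> N n (sym_emb c) m = (if exps N m = \<mu> then 1 else 0)" for m
  proof -
    have "xpoly \<alpha> N n (sym_emb c) m =
      (\<Sum>\<rho>\<in>par n. ((if \<rho> = \<mu> then pw_basis N 0 \<mu> m else 0) - (\<Sum>\<nu>\<in>?L. H \<nu> * (pweight \<alpha> \<rho> * C \<nu> \<rho> * pw_basis N 0 \<rho> m))) / H \<mu>)"
      unfolding xpoly_sym_emb c_def using w
      by (intro sum.cong refl) (auto simp: algebra_simps sum_distrib_left diff_divide_distrib)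
    also have "\<dots> = ((\<Sum>\<rho>\<in>par n. (if \<rho> = \<mu> then pw_basis N 0 \<mu> m else 0)) -
         (\<Sum>\<nu>\<in>?L. H \<nu> * xpoly \<alpha> N n (sym_emb (C \<nu>)) m)) / H \<mu>"
      unfolding xpoly_sym_emb sum_divide_distrib[symmetric] sum_subtractf
      by (simp add: sum_distrib_left sum.swap[of _ ?L])
    also have "\<dots> = (pw_basis N 0 \<mu> m - (\<Sum>\<nu>\<in>?L. H \<nu> * (if exps N m = \<nu> then 1 else 0))) / H \<mu>"
      using less.prems by (simp add: finite_par C)
    also have "\<dots> = (if exps N m = \<mu> then 1 else 0)"
      unfolding exp using H0 by simp
    finally show ?thesis .
  qed
  then show ?case by blast
qed

text \<open>One Gram-Schmidt step: \<open>x'\<close> is the new vector made orthogonal to the old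
  ones. The vectors may be dependent; an \<open>x'\<close> of norm 0 vanishes on
  \<open>states n\<close> and is orthogonal to everything.\<close>

lemma orthogonal_projection:
  assumes a: "\<alpha> > 0" and "finite T"
  shows "\<exists>u. \<forall>s\<in>T. ip \<alpha> n (\<lambda>k \<rho>. v k \<rho> - (\<Sum>t\<in>T. u t * b t k \<rho>)) (b s) = 0"
  using \<open>finite T\<close>
proof (induction T arbitrary: v rule: finite_induct)
  case (insert x T)
  obtain ux where ux: "\<And>s. s \<in> T \<Longrightarrow> ip \<alpha> n (\<lambda>k \<rho>. b x k \<rho> - (\<Sum>t\<in>T. ux t * b t k \<rho>)) (b s) = 0"
    using insert.IH by blast
  obtain uv where uv: "\<And>s. s \<in> T \<Longrightarrow> ip \<alpha> n (\<lambda>k \<rho>. v k \<rho> - (\<Sum>t\<in>T. uv t * b t k \<rho>)) (b s) = 0"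
    using insert.IH by blast
  define x' where "x' = (\<lambda>k \<rho>. b x k \<rho> - (\<Sum>t\<in>T. ux t * b t k \<rho>))"
  define v' where "v' = (\<lambda>k \<rho>. v k \<rho> - (\<Sum>t\<in>T. uv t * b t k \<rho>))"
  define c where "c = ip \<alpha> n v' x' / ip \<alpha> n x' x'"
  define w where "w = (\<lambda>k \<rho>. v' k \<rho> - c * x' k \<rho>)"
  define u where "u t = (if t = x then c else uv t - c * ux t)" for t
  have w: "w = (\<lambda>k \<rho>. v k \<rho> - (\<Sum>t\<in>insert x T. u t * b t k \<rho>))"
  proof (intro ext)
    fix k \<rho>
    have "(\<Sum>t\<in>insert x T. u t * b t k \<rho>) = c * b x k \<rho> + (\<Sum>t\<in>T. (uv t - c * ux t) * b t k \<rho>)"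
      using insert.hyps by (auto simp: u_def intro!: sum.cong)
    then show "w k \<rho> = v k \<rho> - (\<Sum>t\<in>insert x T. u t * b t k \<rho>)"
      by (simp add: w_def v'_def x'_def algebra_simps sum_subtractf sum_distrib_left)
  qed
  have wT: "ip \<alpha> n w (b s) = 0" if "s \<in> T" for s
    unfolding w_def ip_diff_left ip_scale_left using ux[OF that] uv[OF that] by (simp add: v'_def x'_def)
  have wx': "ip \<alpha> n w x' = 0"
  proof (cases "ip \<alpha> n x' x' = 0")
    case True
    then have "ip \<alpha> n w x' = ip \<alpha> n w (\<lambda>k \<rho>. 0)"
      using ip_zero[OF a True] by (intro ip_cong) auto
    then show ?thesis by (simp add: ip_def)
  next
    case False
    then show ?thesis unfolding w_def ip_diff_left ip_scale_left by (simp add: c_def)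
  qed
  have "ip \<alpha> n w (b x) = ip \<alpha> n (\<lambda>k \<rho>. x' k \<rho> + (\<Sum>t\<in>T. ux t * b t k \<rho>)) w"
    by (subst ip_commute) (simp add: x'_def)
  also have "\<dots> = 0"
    unfolding ip_add_left ip_sum_left ip_scale_left using wx' wT by (simp add: ip_commute[of _ _ _ w])
  finally show ?case
    using wT unfolding w by blast
qed simp

section \<open>Separation of partitions by their eigenvalues\<close>

lemma tau_step:
  assumes "0 \<notin># \<nu>"
  shows "tau \<alpha> \<nu> (Suc k) (part \<nu> i) = (\<alpha> * real (part \<nu> i) - real i) * tau \<alpha> \<nu> k (part \<nu> i) + (\<Sum>j<i. tau \<alpha> \<nu> k (part \<nu> j))"
proof -
  let ?M = "max i (size \<nu>)" and ?t = "tau \<alpha> \<nu> k" and ?v = "part \<nu> i"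
  have "(\<Sum>x\<in>#\<nu>. if ?v < x then ?t x - ?t ?v else 0) = (\<Sum>j<?M. if ?v < part \<nu> j then ?t (part \<nu> j) - ?t ?v else 0)"
    by (rule sum_mset_part) (auto simp: assms)
  also have "\<dots> = (\<Sum>j<i. if ?v < part \<nu> j then ?t (part \<nu> j) - ?t ?v else 0)"
  proof (rule sum.mono_neutral_right)
    show "\<forall>j\<in>{..<?M} - {..<i}. (if ?v < part \<nu> j then ?t (part \<nu> j) - ?t ?v else 0) = 0"
      using part_antimono[of i _ \<nu>] by (auto simp: not_less[symmetric])
  qed auto
  also have "\<dots> = (\<Sum>j<i. ?t (part \<nu> j) - ?t ?v)"
  proof (intro sum.cong refl)
    fix j assume "j \<in> {..<i}"
    then have "?v \<le> part \<nu> j" by (auto intro: part_antimono)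
    then show "(if ?v < part \<nu> j then ?t (part \<nu> j) - ?t ?v else 0) = ?t (part \<nu> j) - ?t ?v"
      by (cases "?v = part \<nu> j") auto
  qed
  finally show ?thesis by (simp add: sum_subtractf algebra_simps)
qed

text \<open>On the parts, the recursion of \<open>tau\<close> is a triangular linear system with
  diagonal entries \<open>a i\<close>; its accumulated series \<open>S i\<close> satisfy a two-term
  relation, which telescopes to a product. Index \<open>M\<close> lies behind the last part, where
  the part is 0 and \<open>a M = - M\<close>: this gives the series of the values at 0 and the
  factor \<open>1 + M X\<close>.\<close>

lemma tau_generating_product:
  fixes \<alpha> :: real
  assumes nu: "0 \<notin># \<nu>" and M: "size \<nu> \<le> M"
  defines "a \<equiv> \<lambda>i. \<alpha> * real (part \<nu> i) - real i"
  shows "(1 + fps_const (real M) * fps_X) * Abs_fps (\<lambda>k. tau \<alpha> \<nu> k 0) * (\<Prod>i<M. 1 - fps_const (a i) * fps_X)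
       = (\<Prod>i<M. 1 - fps_const (a i - 1) * fps_X)"
proof -
  define x where "x i = Abs_fps (\<lambda>k. tau \<alpha> \<nu> k (part \<nu> i))" for i
  define S where "S i = 1 + fps_X * (\<Sum>j<i. x j)" for i
  have step: "(1 - fps_const (a i) * fps_X) * x i = S i" for i
  proof (rule fps_ext)
    fix k
    show "fps_nth ((1 - fps_const (a i) * fps_X) * x i) k = fps_nth (S i) k"
      by (cases k) (auto simp: S_def x_def a_def tau_step[OF nu] fps_sum_nth algebra_simps simp del: tau.simps(2))
  qed
  have rec: "(1 - fps_const (a i) * fps_X) * S (Suc i) = (1 - fps_const (a i - 1) * fps_X) * S i" for i
  proof -
    have "S (Suc i) = S i + fps_X * x i" by (simp add: S_def algebra_simps)
    then have "(1 - fps_const (a i) * fps_X) * S (Suc i) = (1 - fps_const (a i) * fps_X) * S i + fps_X * ((1 - fps_const (a i) * fps_X) * x i)"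
      by (simp add: algebra_simps)
    also have "\<dots> = (1 - (fps_const (a i) - 1) * fps_X) * S i"
      unfolding step by (simp add: algebra_simps)
    finally show ?thesis by (simp add: fps_const_sub[symmetric] del: fps_const_sub)
  qed
  have "S m * (\<Prod>i<m. 1 - fps_const (a i) * fps_X) = (\<Prod>i<m. 1 - fps_const (a i - 1) * fps_X)" for m
  proof (induction m)
    case 0
    then show ?case by (simp add: S_def)
  next
    case (Suc m)
    have "S (Suc m) * (\<Prod>i<Suc m. 1 - fps_const (a i) * fps_X) =
      ((1 - fps_const (a m) * fps_X) * S (Suc m)) * (\<Prod>i<m. 1 - fps_const (a i) * fps_X)"
      by (simp add: algebra_simps)
    also have "\<dots> = (1 - fps_const (a m - 1) * fps_X) * (S m * (\<Prod>i<m. 1 - fps_const (a i) * fps_X))"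
      unfolding rec by (simp add: mult.assoc)
    finally show ?case unfolding Suc by (simp add: mult.commute)
  qed
  moreover have "S M = (1 + fps_const (real M) * fps_X) * Abs_fps (\<lambda>k. tau \<alpha> \<nu> k 0)"
    using step[of M] M by (simp add: a_def x_def part_eq_0 algebra_simps flip: fps_const_neg)
  ultimately show ?thesis by metis
qed

text \<open>The largest of the numbers \<open>a 0\<close>, \<open>b 0\<close> is a root of one side only, unless they coincide.\<close>

lemma linear_factors_separate:
  fixes a b :: "nat \<Rightarrow> real"
  assumes "\<And>i j. i < j \<Longrightarrow> a j < a i" "\<And>i j. i < j \<Longrightarrow> b j < b i"
    and "(\<Prod>i<M. [:- (a i - 1), 1:]) * (\<Prod>i<M. [:- b i, 1:]) = (\<Prod>i<M. [:- (b i - 1), 1:]) * (\<Prod>i<M. [:- a i, 1:])"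
    and "i < M"
  shows "a i = b i"
  using assms
proof (induction M arbitrary: a b i)
  case (Suc M)
  have top: "a 0 \<le> b 0"
    if eq: "(\<Prod>i<Suc M. [:- (a i - 1), 1:]) * (\<Prod>i<Suc M. [:- b i, 1:]) = (\<Prod>i<Suc M. [:- (b i - 1), 1:]) * (\<Prod>i<Suc M. [:- a i, 1:])"
      and ad: "\<And>i j. i < j \<Longrightarrow> a j < a i" and bd: "\<And>i j. i < j \<Longrightarrow> b j < b i" for a b :: "nat \<Rightarrow> real"
  proof (rule ccontr)
    assume gt: "\<not> a 0 \<le> b 0"
    have "poly ((\<Prod>i<Suc M. [:- (b i - 1), 1:]) * (\<Prod>i<Suc M. [:- a i, 1:])) (a 0) = 0"
      by (auto simp: poly_prod prod.lessThan_Suc_shift simp del: prod.lessThan_Suc)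
    then have "(\<exists>i<Suc M. a 0 - (a i - 1) = 0) \<or> (\<exists>i<Suc M. a 0 - b i = 0)"
      unfolding eq[symmetric] by (auto simp: poly_prod simp del: prod.lessThan_Suc)
    moreover have "a i \<le> a 0" "b i \<le> b 0" for i
      using ad[of 0 i] bd[of 0 i] by (cases i; force)+
    ultimately show False using gt by (metis add.commute add_less_same_cancel1 diff_add_cancel diff_diff_eq2 eq_iff_diff_eq_0 le_less_trans less_numeral_extra(1) linorder_not_less not_one_less_zero)
  qed
  have a0: "a 0 = b 0"
    using top[of a b] top[of b a] Suc.prems(1-3) by (metis antisym)
  have "[:- (a 0 - 1), 1:] * [:- a 0, 1:] * ((\<Prod>i<M. [:- (a (Suc i) - 1), 1:]) * (\<Prod>i<M. [:- b (Suc i), 1:]))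
     = [:- (a 0 - 1), 1:] * [:- a 0, 1:] * ((\<Prod>i<M. [:- (b (Suc i) - 1), 1:]) * (\<Prod>i<M. [:- a (Suc i), 1:]))"
    using Suc.prems(3) unfolding prod.lessThan_Suc_shift a0 by (simp only: mult_ac)
  then have eq: "(\<Prod>i<M. [:- (a (Suc i) - 1), 1:]) * (\<Prod>i<M. [:- b (Suc i), 1:])
     = (\<Prod>i<M. [:- (b (Suc i) - 1), 1:]) * (\<Prod>i<M. [:- a (Suc i), 1:])"
    by (subst (asm) mult_cancel_left) auto
  show ?case
  proof (cases i)
    case (Suc i')
    then show ?thesis
      using Suc.IH[of "\<lambda>i. a (Suc i)" "\<lambda>i. b (Suc i)" i'] eq Suc.prems by auto
  qed (simp add: a0)
qed simp

text \<open>With a common \<open>M\<close> the two products have the same unknown factor, which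
  cross multiplication eliminates. Reversing the resulting polynomials turns \<open>1 - c X\<close>
  into the monic \<open>X - c\<close>, so that roots can be compared.\<close>

lemma tau_separates:
  assumes a: "\<alpha> > 0" and mu: "0 \<notin># \<mu>" and nu: "0 \<notin># \<nu>" and t: "\<And>k. tau \<alpha> \<mu> k 0 = tau \<alpha> \<nu> k 0"
  shows "\<mu> = \<nu>"
proof -
  define M where "M = max (size \<mu>) (size \<nu>)"
  define a where "a = (\<lambda>i. \<alpha> * real (part \<mu> i) - real i)"
  define b where "b = (\<lambda>i. \<alpha> * real (part \<nu> i) - real i)"
  let ?f = "\<lambda>c::real. 1 - fps_const c * fps_X"
  let ?p = "\<lambda>c::real. [:1, - c:]"
  have fp: "fps_of_poly (?p c) = ?f c" for c
    by (simp add: fps_of_poly_pCons flip: fps_const_neg)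
  have A: "(1 + fps_const (real M) * fps_X) * Abs_fps (\<lambda>k. tau \<alpha> \<mu> k 0) * (\<Prod>i<M. ?f (a i)) = (\<Prod>i<M. ?f (a i - 1))"
    unfolding a_def by (rule tau_generating_product) (auto simp: mu M_def)
  have B: "(1 + fps_const (real M) * fps_X) * Abs_fps (\<lambda>k. tau \<alpha> \<mu> k 0) * (\<Prod>i<M. ?f (b i)) = (\<Prod>i<M. ?f (b i - 1))"
    unfolding b_def t by (rule tau_generating_product) (auto simp: nu M_def)
  have "(\<Prod>i<M. ?f (a i - 1)) * (\<Prod>i<M. ?f (b i)) = (\<Prod>i<M. ?f (b i - 1)) * (\<Prod>i<M. ?f (a i))"
    unfolding A[symmetric] B[symmetric] by (simp only: mult_ac)
  then have "fps_of_poly ((\<Prod>i<M. ?p (a i - 1)) * (\<Prod>i<M. ?p (b i))) = fps_of_poly ((\<Prod>i<M. ?p (b i - 1)) * (\<Prod>i<M. ?p (a i)))"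
    by (simp only: fps_of_poly_mult fps_of_poly_prod fp)
  then have P: "(\<Prod>i<M. ?p (a i - 1)) * (\<Prod>i<M. ?p (b i)) = (\<Prod>i<M. ?p (b i - 1)) * (\<Prod>i<M. ?p (a i))"
    by (simp only: fps_of_poly_eq_iff)
  let ?q = "\<lambda>c::real. [:- c, 1:]"
  have rev: "poly ((\<Prod>i<M. ?q (c i)) * (\<Prod>i<M. ?q (d i))) x = x ^ M * x ^ M * poly ((\<Prod>i<M. ?p (c i)) * (\<Prod>i<M. ?p (d i))) (1 / x)"
    if "x \<noteq> 0" for c d :: "nat \<Rightarrow> real" and x
  proof -
    have "(\<Prod>i<M. x - c i) = x ^ M * (\<Prod>i<M. 1 - c i / x)" for c
    proof -
      have "(\<Prod>i<M. x - c i) = (\<Prod>i<M. x * (1 - c i / x))"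
        using that by (intro prod.cong) (auto simp: field_simps)
      then show ?thesis by (simp add: prod.distrib)
    qed
    then show ?thesis by (simp add: poly_prod)
  qed
  let ?Q = "(\<Prod>i<M. ?q (a i - 1)) * (\<Prod>i<M. ?q (b i)) - (\<Prod>i<M. ?q (b i - 1)) * (\<Prod>i<M. ?q (a i))"
  have "{x. x \<noteq> 0} \<subseteq> {x. poly ?Q x = 0}"
  proof
    fix x :: real assume "x \<in> {x. x \<noteq> 0}"
    then have x: "x \<noteq> 0" by simp
    show "x \<in> {x. poly ?Q x = 0}"
      unfolding mem_Collect_eq poly_diff rev[OF x, of "\<lambda>i. a i - 1" b] rev[OF x, of "\<lambda>i. b i - 1" a] P
      by (rule diff_self)
  qed
  moreover have "infinite {x::real. x \<noteq> 0}"
    using infinite_UNIV_char_0[where 'a = real] finite_insert[of 0 "{x::real. x \<noteq> 0}"]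
    by (metis (mono_tags) Collect_mem_eq UNIV_eq_I finite_subset insertCI insertI2 mem_Collect_eq subsetI)
  ultimately have "?Q = 0"
    using poly_roots_finite[of ?Q] finite_subset by blast
  then have Q: "(\<Prod>i<M. ?q (a i - 1)) * (\<Prod>i<M. ?q (b i)) = (\<Prod>i<M. ?q (b i - 1)) * (\<Prod>i<M. ?q (a i))"
    by simp
  \<comment> \<open>The parts decrease weakly and the index increases, so these shifted parts
    decrease strictly and determine the partition.\<close>
  have dec: "\<alpha> * real (part \<kappa> j) - real j < \<alpha> * real (part \<kappa> i) - real i" if "i < j" for \<kappa> i j
    using part_antimono[of i j \<kappa>] that \<open>\<alpha> > 0\<close>
    by (smt (verit) less_imp_le mult_left_mono nat_less_real_le of_nat_le_iff of_nat_less_iff)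
  have "a i = b i" if "i < M" for i
    by (rule linear_factors_separate[OF _ _ Q that]) (auto simp: a_def b_def dec)
  then have "part \<mu> i = part \<nu> i" for i
    using \<open>\<alpha> > 0\<close> by (cases "i < M") (force simp: a_def b_def, simp add: M_def part_eq_0)
  then show ?thesis by (rule parts_eq_imp_eq[OF mu nu])
qed

section \<open>The component of degree 0 in w\<close>

lemma xpoly_diff: "xpoly \<alpha> N n (\<lambda>k \<rho>. f k \<rho> - g k \<rho>) m = xpoly \<alpha> N n f m - xpoly \<alpha> N n g m"
  by (simp add: xpoly_def ip_diff_left)

lemma xpoly_add: "xpoly \<alpha> N n (\<lambda>k \<rho>. f k \<rho> + g k \<rho>) m = xpoly \<alpha> N n f m + xpoly \<alpha> N n g m"
  by (simp add: xpoly_def ip_add_left)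

lemma xpoly_scale: "xpoly \<alpha> N n (\<lambda>k \<rho>. c * g k \<rho>) m = c * xpoly \<alpha> N n g m"
  by (simp add: xpoly_def ip_scale_left)

lemma xpoly_sum: "xpoly \<alpha> N n (\<lambda>k \<rho>. \<Sum>a\<in>A. f a k \<rho>) m = (\<Sum>a\<in>A. xpoly \<alpha> N n (f a) m)"
  by (simp add: xpoly_def ip_sum_left)

lemma sym_emb_diff: "sym_emb (\<lambda>\<rho>. f \<rho> - g \<rho>) = (\<lambda>k \<rho>. sym_emb f k \<rho> - sym_emb g k \<rho>)"
  by (simp add: sym_emb_def fun_eq_iff)

lemma sym_emb_add: "sym_emb (\<lambda>\<rho>. f \<rho> + g \<rho>) = (\<lambda>k \<rho>. sym_emb f k \<rho> + sym_emb g k \<rho>)"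
  by (simp add: sym_emb_def fun_eq_iff)

lemma sym_emb_scale: "sym_emb (\<lambda>\<rho>. c * g \<rho>) = (\<lambda>k \<rho>. c * sym_emb g k \<rho>)"
  by (simp add: sym_emb_def fun_eq_iff)

lemma sym_emb_sum: "sym_emb (\<lambda>\<rho>. \<Sum>a\<in>A. f a \<rho>) = (\<lambda>k \<rho>. \<Sum>a\<in>A. sym_emb (f a) k \<rho>)"
  by (simp add: sym_emb_def fun_eq_iff)

text \<open>Basis elements with \<open>k > 0\<close> are divisible by \<open>x_0\<close>, so
  monomials without \<open>x_0\<close> see only the component of \<open>w^0\<close>.\<close>

lemma xpoly_at_zero:
  assumes "m 0 = 0"
  shows "xpoly \<alpha> N n g m = xpoly \<alpha> N n (sym_emb (g 0)) m"
proof -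
  have "pw_basis N k \<rho> m = 0" if "k > 0" for k \<rho>
    using assms that by (subst add_0[of k, symmetric], subst x_shift_pw_basis[symmetric]) (simp add: x_shift_def)
  then show ?thesis
    unfolding xpoly_def ip_def by (intro sum.cong) (auto simp: sym_emb_def)
qed

lemma exps_shift: "exps (Suc n) (case_nat 0 h) = exps n h"
proof -
  have "mset_set {..<Suc n} = add_mset 0 (image_mset Suc (mset_set {..<n}))"
    by (subst lessThan_Suc_eq_insert_0, subst mset_set.insert) (auto simp: image_mset_mset_set)
  then show ?thesis
    by (simp add: exps_def image_mset.compositionality comp_def)
qed

lemma exps_shift_part:
  assumes "\<mu> \<in> par n"
  shows "exps (Suc n) (case_nat 0 (part \<mu>)) = \<mu>"
  unfolding exps_shift using assms size_le_sum_mset[of \<mu>] by (auto simp: par_def intro!: exps_part)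

text \<open>Of \<open>n + 1\<close> variables, \<open>n\<close> remain besides \<open>x_0\<close>,
  enough to realize every partition of \<open>n\<close> by a monomial without \<open>x_0\<close>.
  This explains the choice of \<open>Suc n\<close> variables.\<close>

lemma xpoly_sym_part_zero:
  assumes "exps (Suc n) m \<in> par n"
  shows "xpoly \<alpha> (Suc n) n (sym_emb (g 0)) m = xpoly \<alpha> (Suc n) n g (case_nat 0 (part (exps (Suc n) m)))"
  using xpoly_at_zero[of "case_nat 0 (part (exps (Suc n) m))" \<alpha> "Suc n" n g]
    xpoly_sym_emb_exps[of "Suc n" m "case_nat 0 (part (exps (Suc n) m))"] assms
  by (simp add: exps_shift_part)

lemma supported_zero_component:
  assumes "supported (Suc n) S (xpoly \<alpha> (Suc n) n g)"
  shows "supported (Suc n) S (xpoly \<alpha> (Suc n) n (sym_emb (g 0)))"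
  unfolding supported_def
proof (intro allI impI)
  fix m assume m: "xpoly \<alpha> (Suc n) n (sym_emb (g 0)) m \<noteq> 0"
  then have p: "exps (Suc n) m \<in> par n" by (rule xpoly_support) simp
  then have "xpoly \<alpha> (Suc n) n g (case_nat 0 (part (exps (Suc n) m))) \<noteq> 0"
    using m by (simp add: xpoly_sym_part_zero)
  then show "exps (Suc n) m \<in> S"
    using assms p unfolding supported_def by (metis exps_shift_part)
qed

lemma ip_sym_component: "ip \<alpha> n (sym_emb f) g = ip \<alpha> n (sym_emb f) (sym_emb (g 0))"
  by (simp add: ip_sym_emb sym_emb_def)

section \<open>Jack functions\<close>

text \<open>The scalar products of \<open>m_\<mu>\<close> with the power sums;
  \<open>xpoly_sym_emb_injective\<close> shows that the choice is unique on partitions of the same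
  size.\<close>

definition mono_coeff :: "real \<Rightarrow> nat multiset \<Rightarrow> nat multiset \<Rightarrow> real" where
  "mono_coeff \<alpha> \<mu> = (SOME c. \<forall>m. xpoly \<alpha> (Suc (sum_mset \<mu>)) (sum_mset \<mu>) (sym_emb c) m =
     (if exps (Suc (sum_mset \<mu>)) m = \<mu> then 1 else 0))"

lemma xpoly_mono_coeff:
  assumes "\<alpha> > 0" "\<mu> \<in> par n"
  shows "xpoly \<alpha> (Suc n) n (sym_emb (mono_coeff \<alpha> \<mu>)) m = (if exps (Suc n) m = \<mu> then 1 else 0)"
proof -
  have n: "sum_mset \<mu> = n" using assms by (simp add: par_def)
  show ?thesis
    using someI_ex[OF monomial_power_sum_expansion[OF assms(1) lessI assms(2)]]
    unfolding mono_coeff_def n by blast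
qed

text \<open>The coefficient of \<open>m_\<mu>\<close> is read at the monomial with exponents
  \<open>part \<mu>\<close>. The difference of the two sides then has no monomial left, and
  injectivity applies.\<close>

lemma sym_expand:
  assumes a: "\<alpha> > 0" and S: "finite S" "S \<subseteq> par n" and h: "supported (Suc n) S (xpoly \<alpha> (Suc n) n (sym_emb h))"
    and r: "\<rho> \<in> par n"
  shows "h \<rho> = (\<Sum>\<mu>\<in>S. xpoly \<alpha> (Suc n) n (sym_emb h) (part \<mu>) * mono_coeff \<alpha> \<mu> \<rho>)"
proof -
  let ?X = "xpoly \<alpha> (Suc n) n"
  let ?d = "\<lambda>\<rho>. h \<rho> - (\<Sum>\<mu>\<in>S. ?X (sym_emb h) (part \<mu>) * mono_coeff \<alpha> \<mu> \<rho>)"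
  have "?X (sym_emb ?d) m = 0" for m
  proof -
    have "?X (sym_emb ?d) m = ?X (sym_emb h) m - (\<Sum>\<mu>\<in>S. ?X (sym_emb h) (part \<mu>) * (if exps (Suc n) m = \<mu> then 1 else 0))"
      unfolding sym_emb_diff sym_emb_sum sym_emb_scale xpoly_diff xpoly_sum xpoly_scale
      using S by (simp add: xpoly_mono_coeff[OF a] subset_iff cong: sum.cong)
    also have "\<dots> = 0"
    proof (cases "exps (Suc n) m \<in> S")
      case True
      then have "exps (Suc n) m \<in> par n" using S by auto
      then have "exps (Suc n) (part (exps (Suc n) m)) = exps (Suc n) m"
        using size_le_sum_mset[of "exps (Suc n) m"] by (intro exps_part) (auto simp: par_def)
      then have "?X (sym_emb h) (part (exps (Suc n) m)) = ?X (sym_emb h) m"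
        by (rule xpoly_sym_emb_exps)
      then show ?thesis
        using True S by (simp add: if_distrib[of "\<lambda>x. _ * x"] cong: if_cong)
    next
      case False
      then have "?X (sym_emb h) m = 0" using h by (auto simp: supported_def)
      moreover have "(\<Sum>\<mu>\<in>S. ?X (sym_emb h) (part \<mu>) * (if exps (Suc n) m = \<mu> then 1 else 0)) = 0"
        using False by (intro sum.neutral) auto
      ultimately show ?thesis by simp
    qed
    finally show ?thesis .
  qed
  then have "?d \<rho> = 0"
    by (rule xpoly_sym_emb_injective[OF a lessI _ r])
  then show ?thesis by simp
qed

text \<open>A function without \<open>w\<close> pairs only with the component \<open>g 0\<close>,
  and this is a combination of the \<open>m_\<mu>\<close> with \<open>\<mu>\<close> in
  \<open>S\<close>.\<close>

lemma ip_zero_on_lower: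
  assumes a: "\<alpha> > 0" and S: "finite S" "S \<subseteq> par n" and g: "supported (Suc n) S (xpoly \<alpha> (Suc n) n g)"
    and o: "\<And>\<mu>. \<mu> \<in> S \<Longrightarrow> ip \<alpha> n (sym_emb f) (sym_emb (mono_coeff \<alpha> \<mu>)) = 0"
  shows "ip \<alpha> n (sym_emb f) g = 0"
proof -
  let ?X = "xpoly \<alpha> (Suc n) n"
  have *: "g 0 \<rho> = (\<Sum>\<mu>\<in>S. ?X (sym_emb (g 0)) (part \<mu>) * mono_coeff \<alpha> \<mu> \<rho>)" if "\<rho> \<in> par n" for \<rho>
    by (rule sym_expand[OF a S supported_zero_component[OF g] that])
  have "ip \<alpha> n (sym_emb f) g = ip \<alpha> n (sym_emb f) (sym_emb (\<lambda>\<rho>. \<Sum>\<mu>\<in>S. ?X (sym_emb (g 0)) (part \<mu>) * mono_coeff \<alpha> \<mu> \<rho>))"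
    unfolding ip_sym_emb using * by (simp add: sym_emb_def)
  also have "\<dots> = (\<Sum>\<mu>\<in>S. ?X (sym_emb (g 0)) (part \<mu>) * ip \<alpha> n (sym_emb f) (sym_emb (mono_coeff \<alpha> \<mu>)))"
    unfolding ip_commute[of _ _ "sym_emb f"] sym_emb_sum sym_emb_scale ip_sum_left ip_scale_left ..
  also have "\<dots> = 0" using o by (intro sum.neutral) auto
  finally show ?thesis .
qed

text \<open>The Jack function of \<open>\<nu>\<close> is \<open>m\<^sub>\<nu>\<close> minus its orthogonal projection to the span of the \<open>m\<^sub>\<mu>\<close>
  with \<open>\<mu>\<close> strictly below \<open>\<nu>\<close>; \<open>f\<close> is the family of its coordinates \<open>\<alpha>\<^bsup>\<ell>(\<rho>)\<^esup> z\<^sub>\<rho> c\<^sub>\<rho>\<close>.\<close>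

definition is_jack_vector :: "real \<Rightarrow> nat multiset \<Rightarrow> (nat multiset \<Rightarrow> real) \<Rightarrow> bool" where
  "is_jack_vector \<alpha> \<nu> f \<longleftrightarrow>
     (\<exists>u. f = (\<lambda>\<rho>. mono_coeff \<alpha> \<nu> \<rho> - (\<Sum>\<mu>\<in>below \<nu>. u \<mu> * mono_coeff \<alpha> \<mu> \<rho>))) \<and>
     (\<forall>\<mu>\<in>below \<nu>. ip \<alpha> (sum_mset \<nu>) (sym_emb f) (sym_emb (mono_coeff \<alpha> \<mu>)) = 0)"

lemma jack_vector_exists:
  assumes "\<alpha> > 0"
  shows "\<exists>f. is_jack_vector \<alpha> \<nu> f"
proof -
  obtain u where "\<forall>s\<in>below \<nu>. ip \<alpha> (sum_mset \<nu>) (\<lambda>k \<rho>. sym_emb (mono_coeff \<alpha> \<nu>) k \<rho> -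
      (\<Sum>\<mu>\<in>below \<nu>. u \<mu> * sym_emb (mono_coeff \<alpha> \<mu>) k \<rho>)) (sym_emb (mono_coeff \<alpha> s)) = 0"
    using orthogonal_projection[OF assms finite_below, of \<nu> "sum_mset \<nu>" "sym_emb (mono_coeff \<alpha> \<nu>)" "\<lambda>\<mu>. sym_emb (mono_coeff \<alpha> \<mu>)"]
    by blast
  then have "is_jack_vector \<alpha> \<nu> (\<lambda>\<rho>. mono_coeff \<alpha> \<nu> \<rho> - (\<Sum>\<mu>\<in>below \<nu>. u \<mu> * mono_coeff \<alpha> \<mu> \<rho>))"
    unfolding is_jack_vector_def sym_emb_diff sym_emb_sum sym_emb_scale by blast
  then show ?thesis by blast
qed

definition jack_vector :: "real \<Rightarrow> nat multiset \<Rightarrow> nat multiset \<Rightarrow> real" where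
  "jack_vector \<alpha> \<nu> = (SOME f. is_jack_vector \<alpha> \<nu> f)"

lemma is_jack_vector: "\<alpha> > 0 \<Longrightarrow> is_jack_vector \<alpha> \<nu> (jack_vector \<alpha> \<nu>)"
  unfolding jack_vector_def by (rule someI_ex[OF jack_vector_exists])

lemma jack_vector_expansion:
  assumes a: "\<alpha> > 0" and n: "\<nu> \<in> par n"
  obtains u where "\<And>m. xpoly \<alpha> (Suc n) n (sym_emb (jack_vector \<alpha> \<nu>)) m =
     (if exps (Suc n) m = \<nu> then 1 else 0) - (\<Sum>\<mu>\<in>below \<nu>. u \<mu> * (if exps (Suc n) m = \<mu> then 1 else 0))"
proof -
  obtain u where u: "jack_vector \<alpha> \<nu> = (\<lambda>\<rho>. mono_coeff \<alpha> \<nu> \<rho> - (\<Sum>\<mu>\<in>below \<nu>. u \<mu> * mono_coeff \<alpha> \<mu> \<rho>))"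
    using is_jack_vector[OF a, of \<nu>] unfolding is_jack_vector_def by blast
  have "xpoly \<alpha> (Suc n) n (sym_emb (jack_vector \<alpha> \<nu>)) m =
     (if exps (Suc n) m = \<nu> then 1 else 0) - (\<Sum>\<mu>\<in>below \<nu>. u \<mu> * (if exps (Suc n) m = \<mu> then 1 else 0))" for m
    unfolding u sym_emb_diff sym_emb_sum sym_emb_scale xpoly_diff xpoly_sum xpoly_scale
    using below_subset_par[OF n] n by (simp add: xpoly_mono_coeff[OF a] subset_iff cong: sum.cong)
  then show thesis by (rule that)
qed

lemma jack_vector_leading:
  assumes a: "\<alpha> > 0" and n: "\<nu> \<in> par n"
  shows "supported (Suc n) {\<mu>. excess_le \<mu> \<nu>} (xpoly \<alpha> (Suc n) n (sym_emb (jack_vector \<alpha> \<nu>)))"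
    and "exps (Suc n) m = \<nu> \<Longrightarrow> xpoly \<alpha> (Suc n) n (sym_emb (jack_vector \<alpha> \<nu>)) m = 1"
proof -
  obtain u where u: "\<And>m. xpoly \<alpha> (Suc n) n (sym_emb (jack_vector \<alpha> \<nu>)) m =
     (if exps (Suc n) m = \<nu> then 1 else 0) - (\<Sum>\<mu>\<in>below \<nu>. u \<mu> * (if exps (Suc n) m = \<mu> then 1 else 0))"
    using jack_vector_expansion[OF a n] by blast
  show "supported (Suc n) {\<mu>. excess_le \<mu> \<nu>} (xpoly \<alpha> (Suc n) n (sym_emb (jack_vector \<alpha> \<nu>)))"
    unfolding supported_def
  proof (intro allI impI, rule ccontr)
    fix m assume nz: "xpoly \<alpha> (Suc n) n (sym_emb (jack_vector \<alpha> \<nu>)) m \<noteq> 0" and "exps (Suc n) m \<notin> {\<mu>. excess_le \<mu> \<nu>}"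
    then have "exps (Suc n) m \<noteq> \<nu>" "exps (Suc n) m \<notin> below \<nu>" by (auto simp: below_def excess_le_refl)
    moreover from this have "(\<Sum>\<mu>\<in>below \<nu>. u \<mu> * (if exps (Suc n) m = \<mu> then 1 else 0)) = 0"
      by (intro sum.neutral) auto
    ultimately show False using nz unfolding u by simp
  qed
  assume "exps (Suc n) m = \<nu>"
  moreover from this have "(\<Sum>\<mu>\<in>below \<nu>. u \<mu> * (if exps (Suc n) m = \<mu> then 1 else 0)) = 0"
    by (intro sum.neutral) (auto simp: below_def)
  ultimately show "xpoly \<alpha> (Suc n) n (sym_emb (jack_vector \<alpha> \<nu>)) m = 1" unfolding u by simp
qed

lemma jack_vector_orthogonal_below:
  assumes a: "\<alpha> > 0" and n: "\<nu> \<in> par n" and g: "supported (Suc n) (below \<nu>) (xpoly \<alpha> (Suc n) n g)"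
  shows "ip \<alpha> n (sym_emb (jack_vector \<alpha> \<nu>)) g = 0"
proof -
  have s: "sum_mset \<nu> = n" using n by (simp add: par_def)
  show ?thesis
    using is_jack_vector[OF a, of \<nu>] unfolding is_jack_vector_def s
    by (intro ip_zero_on_lower[OF a finite_below below_subset_par[OF n] g]) blast
qed

lemma xpoly_lax: "\<alpha> > 0 \<Longrightarrow> xpoly \<alpha> (Suc n) n (lax \<alpha> f) = Y_op \<alpha> (Suc n) (xpoly \<alpha> (Suc n) n f)"
  by (rule ext) (simp add: Y_op_xpoly)

lemma supported_lax_power:
  assumes "\<alpha> > 0" "lower_set S" "supported (Suc n) S (xpoly \<alpha> (Suc n) n g)"
  shows "supported (Suc n) S (xpoly \<alpha> (Suc n) n ((lax \<alpha> ^^ k) g))"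
  by (induction k) (use assms in \<open>auto simp: xpoly_lax intro!: supported_Y_op\<close>)

lemma ip_lax_power: "\<alpha> > 0 \<Longrightarrow> ip \<alpha> n ((lax \<alpha> ^^ k) f) g = ip \<alpha> n f ((lax \<alpha> ^^ k) g)"
proof (induction k arbitrary: g)
  case (Suc k)
  have "(lax \<alpha> ^^ k) (lax \<alpha> g) = lax \<alpha> ((lax \<alpha> ^^ k) g)" by (simp add: funpow_swap1)
  then show ?case using Suc by (simp add: ip_lax)
qed simp

lemma jack_vector_lax_leading:
  assumes a: "\<alpha> > 0" and n: "\<nu> \<in> par n" and "exps (Suc n) m = \<nu>"
  shows "xpoly \<alpha> (Suc n) n ((lax \<alpha> ^^ k) (sym_emb (jack_vector \<alpha> \<nu>))) m = tau \<alpha> \<nu> k (m 0)"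
  using assms(3)
proof (induction k arbitrary: m)
  case 0
  then show ?case by (simp add: jack_vector_leading[OF a n])
next
  case (Suc k)
  have "supported (Suc n) {\<mu>. excess_le \<mu> \<nu>} (xpoly \<alpha> (Suc n) n ((lax \<alpha> ^^ k) (sym_emb (jack_vector \<alpha> \<nu>))))"
    by (rule supported_lax_power[OF a lower_set_atmost jack_vector_leading(1)[OF a n]])
  then show ?case
    using Suc by (simp add: xpoly_lax[OF a] Y_op_leading_value[where \<phi> = "tau \<alpha> \<nu> k"])
qed

text \<open>The moments \<open>P\<^sub>0 L\<^sup>k\<close> of the Lax operator are self-adjoint and preserve the span of the
  \<open>m\<^sub>\<mu>\<close> below \<open>\<nu>\<close>, hence also the orthogonal complement of that span in the span of the \<open>m\<^sub>\<mu>\<close> with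
  \<open>\<mu> \<le> \<nu>\<close>, which is a line.\<close>

lemma jack_vector_eigen:
  assumes a: "\<alpha> > 0" and n: "\<nu> \<in> par n" and r: "\<rho> \<in> par n"
  shows "(lax \<alpha> ^^ k) (sym_emb (jack_vector \<alpha> \<nu>)) 0 \<rho> = tau \<alpha> \<nu> k 0 * jack_vector \<alpha> \<nu> \<rho>"
proof -
  let ?E = "sym_emb (jack_vector \<alpha> \<nu>)" and ?t = "tau \<alpha> \<nu> k 0" and ?X = "xpoly \<alpha> (Suc n) n"
  let ?g = "\<lambda>k' \<rho>. (lax \<alpha> ^^ k) ?E k' \<rho> - ?t * ?E k' \<rho>"
  define h where "h = ?g 0"
  have nu0: "0 \<notin># \<nu>" using n by (simp add: par_def)
  have sup: "supported (Suc n) (below \<nu>) (?X (sym_emb h))"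
    unfolding supported_def
  proof (intro allI impI)
    fix m assume m: "?X (sym_emb h) m \<noteq> 0"
    have "supported (Suc n) {\<mu>. excess_le \<mu> \<nu>} (?X ((lax \<alpha> ^^ k) ?E))"
      by (rule supported_lax_power[OF a lower_set_atmost jack_vector_leading(1)[OF a n]])
    then have "supported (Suc n) {\<mu>. excess_le \<mu> \<nu>} (?X ?g)"
      using jack_vector_leading(1)[OF a n] unfolding supported_def xpoly_diff xpoly_scale by force
    then have "exps (Suc n) m \<in> {\<mu>. excess_le \<mu> \<nu>}"
      using supported_zero_component[of n _ \<alpha> ?g] m unfolding h_def supported_def by blast
    moreover have "exps (Suc n) m \<noteq> \<nu>"
    proof
      assume e: "exps (Suc n) m = \<nu>"
      \<comment> \<open>Read at a monomial without \<open>x_0\<close>: there the coefficient of the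
        power of \<open>lax\<close> is \<open>tau\<close> at 0 and that of \<open>?E\<close> is
        1.\<close>
      have "?X (sym_emb h) m = ?X ?g (case_nat 0 (part \<nu>))"
        unfolding h_def using xpoly_sym_part_zero[of n m \<alpha> ?g] e n by simp
      also have "\<dots> = 0"
        unfolding xpoly_diff xpoly_scale
        by (subst jack_vector_lax_leading[OF a n]; (subst jack_vector_leading(2)[OF a n])?; simp add: exps_shift_part[OF n])
      finally show False using m by simp
    qed
    ultimately show "exps (Suc n) m \<in> below \<nu>"
      by (simp add: below_def zero_notin_exps)
  qed
  have 0: "ip \<alpha> n ?E ((lax \<alpha> ^^ j) (sym_emb h)) = 0" for j
    by (rule jack_vector_orthogonal_below[OF a n supported_lax_power[OF a lower_set_below[OF nu0] sup]])
  \<comment> \<open>\<open>h\<close> has degree 0 in \<open>w\<close>, so pairing with it ignores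
    the other components of \<open>?g\<close>.\<close>
  have "ip \<alpha> n (sym_emb h) (sym_emb h) = ip \<alpha> n (sym_emb h) ?g"
    by (subst (2) ip_sym_component) (simp add: h_def)
  also have "\<dots> = ip \<alpha> n ((lax \<alpha> ^^ k) ?E) (sym_emb h) - ?t * ip \<alpha> n ?E (sym_emb h)"
    by (subst ip_commute) (simp only: ip_diff_left ip_scale_left)
  also have "\<dots> = 0"
    using 0[of k] 0[of 0] by (simp add: ip_lax_power[OF a])
  finally have "sym_emb h 0 \<rho> = 0"
    by (rule ip_zero[OF a]) (use r in \<open>simp add: in_states par_def\<close>)
  then show ?thesis by (simp add: h_def sym_emb_def)
qed

text \<open>The projection says nothing about incomparable partitions. A nonzero scalar product
  would force equal eigenvalues of all the self-adjoint moments, and these separate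
  partitions.\<close>

lemma jack_vector_orthogonal:
  assumes a: "\<alpha> > 0" and n: "\<nu> \<in> par n" and m: "\<mu> \<in> par n" and ne: "\<nu> \<noteq> \<mu>"
  shows "ip \<alpha> n (sym_emb (jack_vector \<alpha> \<nu>)) (sym_emb (jack_vector \<alpha> \<mu>)) = 0"
proof (rule ccontr)
  let ?E = "\<lambda>\<nu>. sym_emb (jack_vector \<alpha> \<nu>)"
  assume nz: "ip \<alpha> n (?E \<nu>) (?E \<mu>) \<noteq> 0"
  have *: "ip \<alpha> n (?E \<mu>) ((lax \<alpha> ^^ k) (?E \<nu>)) = tau \<alpha> \<nu> k 0 * ip \<alpha> n (?E \<mu>) (?E \<nu>)" if "\<nu> \<in> par n" for k \<mu> \<nu>
    unfolding ip_sym_emb using jack_vector_eigen[OF a that]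
    by (simp add: sum_distrib_left sym_emb_def[of _ 0] mult_ac)
  have "tau \<alpha> \<nu> k 0 = tau \<alpha> \<mu> k 0" for k
  proof -
    have "tau \<alpha> \<nu> k 0 * ip \<alpha> n (?E \<nu>) (?E \<mu>) = tau \<alpha> \<mu> k 0 * ip \<alpha> n (?E \<nu>) (?E \<mu>)"
      using *[OF n, of \<mu> k] *[OF m, of \<nu> k] ip_lax_power[OF a, of n k "?E \<nu>" "?E \<mu>"]
      by (simp add: ip_commute)
    then show ?thesis using nz by simp
  qed
  then show False
    using tau_separates[OF a, of \<nu> \<mu>] n m ne by (auto simp: par_def)
qed

section \<open>Comparison with formal power series\<close>

lemma finite_poly_mapping_decompositions:
  fixes m :: "nat \<Rightarrow>\<^sub>0 nat"
  shows "finite {(a, b). a + b = m}"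
proof -
  define K where "K = Poly_Mapping.keys m"
  define B where "B = (\<Sum>j\<in>K. Poly_Mapping.lookup m j)"
  define A where "A = {a. \<exists>b. a + b = m}"
  define F :: "(nat \<Rightarrow> nat) set" where "F = {f. \<forall>i. (i \<in> K \<longrightarrow> f i \<in> {..B}) \<and> (i \<notin> K \<longrightarrow> f i = 0)}"
  have K: "finite K" by (simp add: K_def)
  have "Poly_Mapping.lookup ` A \<subseteq> F"
  proof
    fix f assume "f \<in> Poly_Mapping.lookup ` A"
    then obtain a b where ab: "m = a + b" and f: "f = Poly_Mapping.lookup a" unfolding A_def by blast
    have le: "f i \<le> Poly_Mapping.lookup m i" for i
      unfolding ab f lookup_add by (rule le_add1)
    have "f i \<le> B" if "i \<in> K" for i
    proof -
      have "Poly_Mapping.lookup m i \<le> B"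
        unfolding B_def using that K by (intro member_le_sum) auto
      then show ?thesis using le[of i] by (rule le_trans[rotated])
    qed
    moreover have "f i = 0" if "i \<notin> K" for i
    proof -
      have "Poly_Mapping.lookup m i = 0" using that unfolding K_def by (simp add: in_keys_iff)
      then show ?thesis using le[of i] by linarith
    qed
    ultimately show "f \<in> F" unfolding F_def by blast
  qed
  moreover have "finite F" unfolding F_def by (rule finite_set_of_finite_funs[OF K]) simp
  ultimately have "finite (Poly_Mapping.lookup ` A)" by (rule finite_subset)
  then have "finite A"
    by (rule finite_imageD) (simp add: inj_on_def lookup_inject)
  then have "finite ((\<lambda>a. (a, m - a)) ` A)" by (rule finite_imageI)
  moreover have "{(a, b). a + b = m} \<subseteq> (\<lambda>a. (a, m - a)) ` A"
  proof
    fix s assume "s \<in> {(a, b). a + b = m}"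
    then obtain a b where s: "s = (a, b)" and ab: "a + b = m" by blast
    have "b = m - a" unfolding ab[symmetric] by simp
    then show "s \<in> (\<lambda>a. (a, m - a)) ` A" using s ab unfolding A_def by blast
  qed
  ultimately show ?thesis by (rule rev_finite_subset)
qed

lemma series_times_power_sum:
  assumes x: "x > 0" and k: "Poly_Mapping.keys m \<subseteq> {..<N}"
  shows "series_times (power_sum x) g m =
    (\<Sum>i<N. if x \<le> Poly_Mapping.lookup m i then g (m - Poly_Mapping.single i x) else 0)"
proof -
  let ?I = "{i\<in>{..<N}. x \<le> Poly_Mapping.lookup m i}"
  let ?\<phi> = "\<lambda>i. (Poly_Mapping.single i x, m - Poly_Mapping.single i x)"
  have dec: "Poly_Mapping.single i x + (m - Poly_Mapping.single i x) = m" if "x \<le> Poly_Mapping.lookup m i" for i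
    using that by (intro poly_mapping_eqI) (auto simp: lookup_add lookup_minus lookup_single when_def)
  have "series_times (power_sum x) g m = (\<Sum>(a, b)\<in>?\<phi> ` ?I. power_sum x a * g b)"
    unfolding series_times_def
  proof (rule sum.mono_neutral_right)
    \<comment> \<open>A sum over an infinite set would be 0 by convention; the convolution has its
      meaning because a monomial has finitely many decompositions.\<close>
    show "finite {(a, b). a + b = m}" by (rule finite_poly_mapping_decompositions)
    show "?\<phi> ` ?I \<subseteq> {(a, b). a + b = m}" using dec by auto
    show "\<forall>s\<in>{(a, b). a + b = m} - ?\<phi> ` ?I. (case s of (a, b) \<Rightarrow> power_sum x a * g b) = 0"
    proof
      fix s assume "s \<in> {(a, b). a + b = m} - ?\<phi> ` ?I"
      then obtain a b where s: "s = (a, b)" and ab: "(a, b) \<notin> ?\<phi> ` ?I" "m = a + b" by blast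
      have "power_sum x a = 0"
      proof (rule ccontr)
        assume "power_sum x a \<noteq> 0"
        then obtain i where i: "a = Poly_Mapping.single i x"
          by (auto simp: power_sum_def split: if_splits)
        then have "x \<le> Poly_Mapping.lookup m i" by (simp add: ab lookup_add)
        moreover from this have "i < N"
        proof -
          have "i \<in> Poly_Mapping.keys m" using x \<open>x \<le> Poly_Mapping.lookup m i\<close> by (simp add: in_keys_iff)
          then show ?thesis using k by blast
        qed
        moreover have "b = m - a" by (simp add: ab)
        ultimately show False using ab(1) i by auto
      qed
      then show "(case s of (a, b) \<Rightarrow> power_sum x a * g b) = 0" by (simp add: s)
    qed
  qed
  also have "\<dots> = (\<Sum>i\<in>?I. power_sum x (Poly_Mapping.single i x) * g (m - Poly_Mapping.single i x))"
  proof (subst sum.reindex)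
    have "i = j" if "Poly_Mapping.single i x = Poly_Mapping.single j x" for i j :: nat
      using that x by (metis lookup_single_eq lookup_single_not_eq not_gr_zero)
    then show "inj_on ?\<phi> ?I" by (auto simp: inj_on_def)
  qed simp
  also have "\<dots> = (\<Sum>i\<in>?I. g (m - Poly_Mapping.single i x))"
    by (intro sum.cong refl) (auto simp: power_sum_def)
  also have "\<dots> = (\<Sum>i<N. if x \<le> Poly_Mapping.lookup m i then g (m - Poly_Mapping.single i x) else 0)"
    by (rule sum.inter_filter) simp
  finally show ?thesis .
qed

text \<open>Passage from series in infinitely many variables to polynomials: variables with index at
  least \<open>N\<close> do not divide the monomial \<open>m\<close>, so they cannot
  contribute.\<close>

lemma power_sum_prod_eq_pw_basis:
  assumes "0 \<notin># \<rho>" and k: "Poly_Mapping.keys m \<subseteq> {..<N}"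
  shows "power_sum_prod \<rho> m = pw_basis N 0 \<rho> (Poly_Mapping.lookup m)"
proof -
  have "foldr series_times (map power_sum xs) series_one m = pw_basis N 0 (mset xs) (Poly_Mapping.lookup m)"
    if "0 \<notin> set xs" for xs
    using that k
  proof (induction xs arbitrary: m)
    case Nil
    have "m = 0 \<longleftrightarrow> (\<forall>i<N. Poly_Mapping.lookup m i = 0)"
    proof
      assume "\<forall>i<N. Poly_Mapping.lookup m i = 0"
      then have "Poly_Mapping.lookup m i = 0" for i
        using Nil.prems(2) by (cases "i < N") (auto simp: subset_iff in_keys_iff)
      then show "m = 0" by (intro poly_mapping_eqI) simp
    qed simp
    then show ?case by (simp add: series_one_def pw_basis_empty x_shift_def x_one_def)
  next
    case (Cons x xs)
    have x: "x > 0" using Cons.prems by (cases x) auto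
    have u: "Poly_Mapping.lookup (m - Poly_Mapping.single i x) = (Poly_Mapping.lookup m)(i := Poly_Mapping.lookup m i - x)" for i
      by (auto simp: fun_eq_iff lookup_minus lookup_single when_def)
    have ks: "Poly_Mapping.keys (m - Poly_Mapping.single i x) \<subseteq> {..<N}" for i
      using Cons.prems(2) by (auto simp: in_keys_iff u lookup_minus subset_iff)
    have "foldr series_times (map power_sum (x # xs)) series_one m =
      (\<Sum>i<N. if x \<le> Poly_Mapping.lookup m i then foldr series_times (map power_sum xs) series_one (m - Poly_Mapping.single i x) else 0)"
      by (simp add: series_times_power_sum[OF x Cons.prems(2)])
    also have "\<dots> = (\<Sum>i<N. if x \<le> Poly_Mapping.lookup m i then pw_basis N 0 (mset xs) ((Poly_Mapping.lookup m)(i := Poly_Mapping.lookup m i - x)) else 0)"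
    proof (intro sum.cong refl)
      fix i
      have "foldr series_times (map power_sum xs) series_one (m - Poly_Mapping.single i x) =
        pw_basis N 0 (mset xs) ((Poly_Mapping.lookup m)(i := Poly_Mapping.lookup m i - x))"
        using Cons.prems(1) Cons.IH[OF _ ks] unfolding u by (simp add: fun_upd_def)
      then show "(if x \<le> Poly_Mapping.lookup m i then foldr series_times (map power_sum xs) series_one (m - Poly_Mapping.single i x) else 0) =
         (if x \<le> Poly_Mapping.lookup m i then pw_basis N 0 (mset xs) ((Poly_Mapping.lookup m)(i := Poly_Mapping.lookup m i - x)) else 0)"
        by simp
    qed
    finally show ?case by (simp add: pw_basis_add p_times_def x_shift_def)
  qed
  from this[of "sorted_list_of_multiset \<rho>"] assms(1) show ?thesis
    by (simp add: power_sum_prod_def)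
qed

lemma exponents_eq_exps:
  assumes k: "Poly_Mapping.keys m \<subseteq> {..<N}"
  shows "exponents m = exps N (Poly_Mapping.lookup m)"
proof -
  have "exps N (Poly_Mapping.lookup m) = image_mset (Poly_Mapping.lookup m) (filter_mset (\<lambda>i. Poly_Mapping.lookup m i \<noteq> 0) (mset_set {..<N}))"
    unfolding exps_def by (simp add: filter_mset_image_mset)
  also have "filter_mset (\<lambda>i. Poly_Mapping.lookup m i \<noteq> 0) (mset_set {..<N}) = mset_set (Poly_Mapping.keys m)"
    using k by (subst filter_mset_mset_set) (auto intro!: arg_cong[of _ _ mset_set] simp: in_keys_iff subset_iff)
  finally show ?thesis by (simp add: exponents_def)
qed

lemma keys_bounded:
  fixes m :: "nat \<Rightarrow>\<^sub>0 nat"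
  obtains N where "N > K" "Poly_Mapping.keys m \<subseteq> {..<N}"
proof -
  obtain N where "\<forall>i\<in>Poly_Mapping.keys m. i < N"
    using finite_nat_set_iff_bounded[of "Poly_Mapping.keys m"] by auto
  then show thesis by (intro that[of "max N (Suc K)"]) auto
qed

lemma power_sum_prod_triangular:
  assumes "0 \<notin># \<rho>" "power_sum_prod \<rho> m \<noteq> 0"
  shows "sum_mset (exponents m) = sum_mset \<rho>" "size (exponents m) \<le> size \<rho>"
    "size (exponents m) = size \<rho> \<Longrightarrow> exponents m = \<rho>"
proof -
  obtain N where N: "N > 0" "Poly_Mapping.keys m \<subseteq> {..<N}" by (rule keys_bounded)
  have nz: "pw_basis N 0 \<rho> (Poly_Mapping.lookup m) \<noteq> 0"
    using assms power_sum_prod_eq_pw_basis[OF assms(1) N(2)] by simp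
  show "sum_mset (exponents m) = sum_mset \<rho>" "size (exponents m) \<le> size \<rho>"
    "size (exponents m) = size \<rho> \<Longrightarrow> exponents m = \<rho>"
    using pw_basis_triangular[OF assms(1) nz] pw_basis_degree[OF nz N(1)]
    by (auto simp: exponents_eq_exps[OF N(2)] sum_mset_exps)
qed

lemma power_sum_prod_diagonal:
  assumes "0 \<notin># \<rho>" "exponents m = \<rho>"
  shows "power_sum_prod \<rho> m > 0"
proof -
  obtain N where N: "N > 0" "Poly_Mapping.keys m \<subseteq> {..<N}" by (rule keys_bounded)
  show ?thesis
    using pw_basis_diagonal[OF assms(1), of N "Poly_Mapping.lookup m"] assms power_sum_prod_eq_pw_basis[OF assms(1) N(2)]
      exponents_eq_exps[OF N(2)] by simp
qed

definition part_monomial :: "nat multiset \<Rightarrow> nat \<Rightarrow>\<^sub>0 nat" where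
  "part_monomial \<mu> = Abs_poly_mapping (part \<mu>)"

lemma lookup_part_monomial: "Poly_Mapping.lookup (part_monomial \<mu>) = part \<mu>"
proof -
  have "finite {i. part \<mu> i \<noteq> 0}"
    by (rule finite_subset[of _ "{..<size \<mu>}"]) (auto simp: part_def split: if_splits)
  then show ?thesis by (simp add: part_monomial_def Abs_poly_mapping_inverse)
qed

lemma keys_part_monomial: "Poly_Mapping.keys (part_monomial \<mu>) \<subseteq> {..<size \<mu>}"
  by (auto simp: in_keys_iff lookup_part_monomial part_def split: if_splits)

lemma exponents_part_monomial: "0 \<notin># \<mu> \<Longrightarrow> exponents (part_monomial \<mu>) = \<mu>"
  by (simp add: exponents_eq_exps[OF keys_part_monomial] lookup_part_monomial exps_part)

text \<open>Among the indices where \<open>c\<close> and \<open>d\<close> differ, take one of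
  maximal length and compare coefficients at its monomial. This justifies the \<open>THE\<close> in
  \<open>power_sum_coeff\<close>.\<close>

lemma power_sum_expansion_unique:
  assumes c: "is_power_sum_expansion f c" and d: "is_power_sum_expansion f d"
  shows "c = d"
proof (rule ccontr)
  assume ne: "c \<noteq> d"
  define A where "A = {\<rho>. c \<rho> \<noteq> 0} \<union> {\<rho>. d \<rho> \<noteq> 0}"
  have fA: "finite A" using c d by (simp add: A_def is_power_sum_expansion_def)
  have pA: "0 \<notin># \<rho>" if "\<rho> \<in> A" for \<rho>
    using that c d by (auto simp: A_def is_power_sum_expansion_def is_partition_def)
  have sums: "(\<Sum>\<rho>\<in>A. c \<rho> * power_sum_prod \<rho> m) = (\<Sum>\<rho>\<in>A. d \<rho> * power_sum_prod \<rho> m)" for m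
  proof -
    have "(\<Sum>\<rho>\<in>A. c \<rho> * power_sum_prod \<rho> m) = f m"
    proof -
      have "f m = (\<Sum>\<rho> | c \<rho> \<noteq> 0. c \<rho> * power_sum_prod \<rho> m)"
        using c unfolding is_power_sum_expansion_def by metis
      also have "\<dots> = (\<Sum>\<rho>\<in>A. c \<rho> * power_sum_prod \<rho> m)"
        by (rule sum.mono_neutral_left) (auto simp: fA, auto simp: A_def)
      finally show ?thesis ..
    qed
    moreover have "(\<Sum>\<rho>\<in>A. d \<rho> * power_sum_prod \<rho> m) = f m"
    proof -
      have "f m = (\<Sum>\<rho> | d \<rho> \<noteq> 0. d \<rho> * power_sum_prod \<rho> m)"
        using d unfolding is_power_sum_expansion_def by metis
      also have "\<dots> = (\<Sum>\<rho>\<in>A. d \<rho> * power_sum_prod \<rho> m)"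
        by (rule sum.mono_neutral_left) (auto simp: fA, auto simp: A_def)
      finally show ?thesis ..
    qed
    ultimately show ?thesis by simp
  qed
  let ?B = "{\<rho>. c \<rho> \<noteq> d \<rho>}"
  have BA: "?B \<subseteq> A" by (auto simp: A_def)
  then have fB: "finite ?B" using fA finite_subset by blast
  have "?B \<noteq> {}" using ne by auto
  then have "Max (size ` ?B) \<in> size ` ?B" using fB by (intro Max_in) auto
  then obtain \<rho>0 where r0: "\<rho>0 \<in> ?B" "size \<rho>0 = Max (size ` ?B)" by auto
  have mx: "size \<rho> \<le> size \<rho>0" if "\<rho> \<in> ?B" for \<rho>
    using that fB r0(2) by (auto intro: Max_ge)
  let ?m = "part_monomial \<rho>0"
  have p0: "0 \<notin># \<rho>0" using r0 BA pA by blast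
  have "0 = (\<Sum>\<rho>\<in>A. (c \<rho> - d \<rho>) * power_sum_prod \<rho> ?m)"
    using sums[of ?m] by (simp add: left_diff_distrib sum_subtractf)
  also have "\<dots> = (\<Sum>\<rho>\<in>{\<rho>0}. (c \<rho> - d \<rho>) * power_sum_prod \<rho> ?m)"
  proof (rule sum.mono_neutral_right[OF fA])
    show "{\<rho>0} \<subseteq> A" using r0 BA by auto
    show "\<forall>\<rho>\<in>A - {\<rho>0}. (c \<rho> - d \<rho>) * power_sum_prod \<rho> ?m = 0"
    proof
      fix \<rho> assume r: "\<rho> \<in> A - {\<rho>0}"
      have "power_sum_prod \<rho> ?m = 0" if "c \<rho> \<noteq> d \<rho>"
      proof (rule ccontr)
        assume nz: "power_sum_prod \<rho> ?m \<noteq> 0"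
        have "0 \<notin># \<rho>" using r pA by auto
        from power_sum_prod_triangular[OF this nz] mx[of \<rho>] that r
        show False by (auto simp: exponents_part_monomial[OF p0])
      qed
      then show "(c \<rho> - d \<rho>) * power_sum_prod \<rho> ?m = 0" by auto
    qed
  qed
  finally have "(c \<rho>0 - d \<rho>0) * power_sum_prod \<rho>0 ?m = 0" by simp
  moreover have "power_sum_prod \<rho>0 ?m > 0"
    by (rule power_sum_prod_diagonal[OF p0 exponents_part_monomial[OF p0]])
  ultimately show False using r0 by simp
qed

definition ser :: "real \<Rightarrow> nat \<Rightarrow> (nat multiset \<Rightarrow> real) \<Rightarrow> series" where
  "ser \<alpha> n f m = (\<Sum>\<rho>\<in>par n. pweight \<alpha> \<rho> * f \<rho> * power_sum_prod \<rho> m)"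

lemma power_sum_coeff_ser:
  "power_sum_coeff (ser \<alpha> n f) \<rho> = (if \<rho> \<in> par n then pweight \<alpha> \<rho> * f \<rho> else 0)"
proof -
  let ?c = "\<lambda>\<rho>. if \<rho> \<in> par n then pweight \<alpha> \<rho> * f \<rho> else 0"
  have "is_power_sum_expansion (ser \<alpha> n f) ?c"
    unfolding is_power_sum_expansion_def
  proof (intro conjI allI impI ext)
    show "finite {\<rho>. ?c \<rho> \<noteq> 0}"
      by (rule finite_subset[OF _ finite_par[of n]]) (auto split: if_splits)
    show "is_partition \<rho>" if "?c \<rho> \<noteq> 0" for \<rho>
      using that by (auto simp: is_partition_def par_def split: if_splits)
    show "ser \<alpha> n f m = (\<Sum>\<rho> | ?c \<rho> \<noteq> 0. ?c \<rho> * power_sum_prod \<rho> m)" for m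
      unfolding ser_def
      by (rule sum.mono_neutral_cong_right[OF finite_par]) (auto split: if_splits)
  qed
  then have "power_sum_coeff (ser \<alpha> n f) = ?c"
    unfolding power_sum_coeff_def by (intro the_equality) (auto intro: power_sum_expansion_unique)
  then show ?thesis by simp
qed

lemma jack_inner_ser:
  assumes a: "\<alpha> > 0"
  shows "jack_inner \<alpha> (ser \<alpha> n f) (ser \<alpha> n g) = ip \<alpha> n (sym_emb f) (sym_emb g)"
proof -
  have "jack_inner \<alpha> (ser \<alpha> n f) (ser \<alpha> n g) =
     (\<Sum>\<rho>\<in>par n. \<alpha> ^ size \<rho> * real (z_num \<rho>) * power_sum_coeff (ser \<alpha> n f) \<rho> * power_sum_coeff (ser \<alpha> n g) \<rho>)"
    unfolding jack_inner_def
    by (rule sum.mono_neutral_left[OF finite_par]) (auto simp: power_sum_coeff_ser split: if_splits)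
  also have "\<dots> = (\<Sum>\<rho>\<in>par n. pweight \<alpha> \<rho> * f \<rho> * g \<rho>)"
  proof (intro sum.cong refl)
    fix \<rho> assume r: "\<rho> \<in> par n"
    then have "real (z_num \<rho>) \<noteq> 0" using z_num_pos[of \<rho>] by (auto simp: par_def)
    then have "\<alpha> ^ size \<rho> * real (z_num \<rho>) * pweight \<alpha> \<rho> = 1" using a by (simp add: pweight_def)
    then show "\<alpha> ^ size \<rho> * real (z_num \<rho>) * power_sum_coeff (ser \<alpha> n f) \<rho> * power_sum_coeff (ser \<alpha> n g) \<rho> = pweight \<alpha> \<rho> * f \<rho> * g \<rho>"
      using r by (simp add: power_sum_coeff_ser mult.assoc[symmetric])
  qed
  finally show ?thesis by (simp add: ip_sym_emb sym_emb_def)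
qed

lemma jack_inner_ser_degree:
  assumes "n \<noteq> n'"
  shows "jack_inner \<alpha> (ser \<alpha> n f) (ser \<alpha> n' g) = 0"
  unfolding jack_inner_def using assms
  by (intro sum.neutral) (auto simp: power_sum_coeff_ser par_def)

lemma pw_basis_more_variables:
  assumes "0 \<notin># \<rho>" "\<And>i. N \<le> i \<Longrightarrow> m i = 0" "N \<le> N'"
  shows "pw_basis N' 0 \<rho> m = pw_basis N 0 \<rho> m"
  using assms(1,2)
proof (induction \<rho> arbitrary: m)
  case empty
  have "(\<forall>i<N'. m i = 0) \<longleftrightarrow> (\<forall>i<N. m i = 0)"
    using empty.prems(2) assms(3) by (meson le_less_linear less_le_trans)
  then show ?case by (simp add: pw_basis_empty x_shift_def x_one_def)
next
  case (add x \<rho>)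
  have x: "x > 0" using add.prems by (cases x) auto
  have "pw_basis N' 0 (add_mset x \<rho>) m = (\<Sum>i<N'. x_shift i x (pw_basis N' 0 \<rho>) m)"
    by (simp add: pw_basis_add p_times_def)
  also have "\<dots> = (\<Sum>i<N. x_shift i x (pw_basis N 0 \<rho>) m)"
  proof (rule sum.mono_neutral_cong_right)
    show "\<forall>i\<in>{..<N'} - {..<N}. x_shift i x (pw_basis N' 0 \<rho>) m = 0"
      using x add.prems(2) by (auto simp: x_shift_def)
    show "x_shift i x (pw_basis N' 0 \<rho>) m = x_shift i x (pw_basis N 0 \<rho>) m" if "i \<in> {..<N}" for i
      unfolding x_shift_def using add that by auto
  qed (use assms in auto)
  finally show ?case by (simp add: pw_basis_add p_times_def)
qed

text \<open>By symmetry the monomial may be replaced by the one with sorted exponents, which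
  involves at most \<open>n\<close> variables; further variables do not change the
  coefficient.\<close>

lemma ser_eq_xpoly:
  assumes "exponents m \<in> par n"
  shows "ser \<alpha> n f m = xpoly \<alpha> (Suc n) n (sym_emb f) (part (exponents m))"
proof -
  obtain N where N: "N > n" "Poly_Mapping.keys m \<subseteq> {..<N}" by (rule keys_bounded)
  have sz: "size (exponents m) \<le> n" using assms size_le_sum_mset[of "exponents m"] by (auto simp: par_def)
  have e: "exps N (part (exponents m)) = exps N (Poly_Mapping.lookup m)"
    using assms sz N exps_part[of "exponents m" N] by (simp add: exponents_eq_exps[OF N(2)] par_def)
  have "power_sum_prod \<rho> m = pw_basis (Suc n) 0 \<rho> (part (exponents m))" if "\<rho> \<in> par n" for \<rho>
  proof -
    have r: "0 \<notin># \<rho>" using that by (simp add: par_def)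
    have "power_sum_prod \<rho> m = pw_basis N 0 \<rho> (Poly_Mapping.lookup m)"
      by (rule power_sum_prod_eq_pw_basis[OF r N(2)])
    also have "\<dots> = pw_basis N 0 \<rho> (part (exponents m))"
      using e by (metis pw_basis_symmetric)
    also have "\<dots> = pw_basis (Suc n) 0 \<rho> (part (exponents m))"
      by (rule pw_basis_more_variables[OF r]) (use sz N in \<open>auto simp: part_eq_0\<close>)
    finally show ?thesis .
  qed
  then show ?thesis
    by (simp add: ser_def xpoly_sym_emb)
qed

lemma ser_support: "ser \<alpha> n f m \<noteq> 0 \<Longrightarrow> exponents m \<in> par n"
proof -
  assume "ser \<alpha> n f m \<noteq> 0"
  then obtain \<rho> where r: "\<rho> \<in> par n" "power_sum_prod \<rho> m \<noteq> 0"
    unfolding ser_def by (metis (mono_tags, lifting) mult_zero_right sum.neutral)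
  then have "sum_mset (exponents m) = n" using power_sum_prod_triangular(1)[of \<rho> m] by (simp add: par_def)
  moreover have "0 \<notin># exponents m" by (auto simp: exponents_def in_keys_iff)
  ultimately show ?thesis by (simp add: par_def)
qed

lemma ser_mono_coeff:
  assumes a: "\<alpha> > 0" and "\<mu> \<in> par n"
  shows "ser \<alpha> n (mono_coeff \<alpha> \<mu>) = monomial_sym \<mu>"
proof
  fix m
  show "ser \<alpha> n (mono_coeff \<alpha> \<mu>) m = monomial_sym \<mu> m"
  proof (cases "exponents m \<in> par n")
    case True
    then have "exps (Suc n) (part (exponents m)) = exponents m"
      using size_le_sum_mset[of "exponents m"] by (intro exps_part) (auto simp: par_def)
    then show ?thesis
      using True by (simp add: ser_eq_xpoly xpoly_mono_coeff[OF assms] monomial_sym_def)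
  next
    case False
    then have "ser \<alpha> n (mono_coeff \<alpha> \<mu>) m = 0" using ser_support by blast
    then show ?thesis using False assms by (auto simp: monomial_sym_def)
  qed
qed

lemma ser_combination:
  "ser \<alpha> n (\<lambda>\<rho>. f \<rho> + (\<Sum>\<mu>\<in>A. u \<mu> * g \<mu> \<rho>)) m = ser \<alpha> n f m + (\<Sum>\<mu>\<in>A. u \<mu> * ser \<alpha> n (g \<mu>) m)"
proof -
  have "ser \<alpha> n (\<lambda>\<rho>. f \<rho> + (\<Sum>\<mu>\<in>A. u \<mu> * g \<mu> \<rho>)) m =
    ser \<alpha> n f m + (\<Sum>\<rho>\<in>par n. \<Sum>\<mu>\<in>A. u \<mu> * (pweight \<alpha> \<rho> * g \<mu> \<rho> * power_sum_prod \<rho> m))"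
    unfolding ser_def sum.distrib[symmetric]
    by (intro sum.cong refl) (simp add: algebra_simps sum_distrib_left)
  then show ?thesis
    unfolding ser_def by (subst (asm) sum.swap) (simp add: sum_distrib_left)
qed

section \<open>Existence and uniqueness of the Jack functions\<close>

lemma below_eq_dominated:
  assumes "is_partition \<nu>"
  shows "{\<mu>. is_partition \<mu> \<and> dominated \<mu> \<nu> \<and> \<mu> \<noteq> \<nu>} = below \<nu>"
  using assms dominated_iff_excess_le[of _ \<nu>] by (auto simp: below_def is_partition_def)

definition jack_series :: "real \<Rightarrow> nat multiset \<Rightarrow> series" where
  "jack_series \<alpha> \<nu> = ser \<alpha> (sum_mset \<nu>) (jack_vector \<alpha> \<nu>)"

lemma jack_series_family:
  assumes a: "\<alpha> > 0"
  shows "is_jack_P_family \<alpha> (jack_series \<alpha>)"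
  unfolding is_jack_P_family_def
proof (intro conjI allI impI)
  fix \<nu> assume p: "is_partition \<nu>"
  define n where "n = sum_mset \<nu>"
  have n: "\<nu> \<in> par n" using p by (simp add: n_def par_def is_partition_def)
  obtain u where u: "jack_vector \<alpha> \<nu> = (\<lambda>\<rho>. mono_coeff \<alpha> \<nu> \<rho> - (\<Sum>\<mu>\<in>below \<nu>. u \<mu> * mono_coeff \<alpha> \<mu> \<rho>))"
    using is_jack_vector[OF a, of \<nu>] unfolding is_jack_vector_def by blast
  have u': "jack_vector \<alpha> \<nu> = (\<lambda>\<rho>. mono_coeff \<alpha> \<nu> \<rho> + (\<Sum>\<mu>\<in>below \<nu>. (- u \<mu>) * mono_coeff \<alpha> \<mu> \<rho>))"
    unfolding u by (simp add: sum_negf)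
  have "jack_series \<alpha> \<nu> = (\<lambda>m. monomial_sym \<nu> m + (\<Sum>\<mu>\<in>below \<nu>. (- u \<mu>) * monomial_sym \<mu> m))"
    unfolding jack_series_def n_def[symmetric] u'
    using below_subset_par[OF n]
    by (intro ext, subst ser_combination) (simp add: ser_mono_coeff[OF a] n subset_iff cong: sum.cong)
  then show "\<exists>u. jack_series \<alpha> \<nu> = (\<lambda>m. monomial_sym \<nu> m +
           (\<Sum>\<mu> | is_partition \<mu> \<and> dominated \<mu> \<nu> \<and> \<mu> \<noteq> \<nu>. u \<mu> * monomial_sym \<mu> m))"
    unfolding below_eq_dominated[OF p] by (intro exI[of _ "\<lambda>\<mu>. - u \<mu>"])
next
  fix \<nu> \<mu> assume p: "is_partition \<nu>" "is_partition \<mu>" "\<nu> \<noteq> \<mu>"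
  show "jack_inner \<alpha> (jack_series \<alpha> \<nu>) (jack_series \<alpha> \<mu>) = 0"
  proof (cases "sum_mset \<nu> = sum_mset \<mu>")
    case True
    then show ?thesis
      using jack_vector_orthogonal[OF a, of \<nu> "sum_mset \<mu>" \<mu>] p
      by (simp add: jack_series_def jack_inner_ser[OF a] par_def is_partition_def)
  next
    case False
    then show ?thesis by (simp add: jack_series_def jack_inner_ser_degree)
  qed
qed

text \<open>By induction along the order, orthogonality of \<open>P \<nu>\<close> to the lower
  \<open>P \<mu>\<close> becomes orthogonality to the lower \<open>m_\<mu>\<close>. Hence the
  difference from the Jack vector lies in the span of the lower \<open>m_\<mu>\<close> and is
  orthogonal to it.\<close>

lemma jack_family_unique:
  assumes a: "\<alpha> > 0" and fam: "is_jack_P_family \<alpha> P" and p: "is_partition \<nu>"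
  shows "P \<nu> = jack_series \<alpha> \<nu>"
proof -
  define n where "n = sum_mset \<nu>"
  have n: "\<nu> \<in> par n" using p by (simp add: n_def par_def is_partition_def)
  have "\<exists>u. P \<mu> = ser \<alpha> n (\<lambda>\<rho>. mono_coeff \<alpha> \<mu> \<rho> + (\<Sum>\<kappa>\<in>below \<mu>. u \<kappa> * mono_coeff \<alpha> \<kappa> \<rho>))" if m: "\<mu> \<in> par n" for \<mu>
  proof -
    have pm: "is_partition \<mu>" using m by (simp add: par_def is_partition_def)
    obtain u where "P \<mu> = (\<lambda>m. monomial_sym \<mu> m + (\<Sum>\<kappa>\<in>below \<mu>. u \<kappa> * monomial_sym \<kappa> m))"
      using conjunct1[OF fam[unfolded is_jack_P_family_def], rule_format, OF pm]
      unfolding below_eq_dominated[OF pm] by blast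
    also have "\<dots> = ser \<alpha> n (\<lambda>\<rho>. mono_coeff \<alpha> \<mu> \<rho> + (\<Sum>\<kappa>\<in>below \<mu>. u \<kappa> * mono_coeff \<alpha> \<kappa> \<rho>))"
      using below_subset_par[OF m]
      by (intro ext, subst ser_combination) (simp add: ser_mono_coeff[OF a] m subset_iff cong: sum.cong)
    finally show ?thesis by blast
  qed
  then have "\<forall>\<mu>. \<exists>u. \<mu> \<in> par n \<longrightarrow> P \<mu> = ser \<alpha> n (\<lambda>\<rho>. mono_coeff \<alpha> \<mu> \<rho> + (\<Sum>\<kappa>\<in>below \<mu>. u \<kappa> * mono_coeff \<alpha> \<kappa> \<rho>))"
    by blast
  from choice[OF this] obtain u where u: "\<And>\<mu>. \<mu> \<in> par n \<Longrightarrow> P \<mu> = ser \<alpha> n (\<lambda>\<rho>. mono_coeff \<alpha> \<mu> \<rho> + (\<Sum>\<kappa>\<in>below \<mu>. u \<mu> \<kappa> * mono_coeff \<alpha> \<kappa> \<rho>))"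
    by blast
  define F where "F \<mu> = (\<lambda>\<rho>. mono_coeff \<alpha> \<mu> \<rho> + (\<Sum>\<kappa>\<in>below \<mu>. u \<mu> \<kappa> * mono_coeff \<alpha> \<kappa> \<rho>))" for \<mu>
  have PF: "P \<mu> = ser \<alpha> n (F \<mu>)" if "\<mu> \<in> par n" for \<mu> using u[OF that] by (simp add: F_def)
  have orth: "ip \<alpha> n (sym_emb (mono_coeff \<alpha> \<mu>)) (sym_emb (F \<nu>)) = 0" if "\<mu> \<in> below \<nu>" for \<mu>
    using that
  proof (induction "card (below \<mu>)" arbitrary: \<mu> rule: less_induct)
    case less
    have m: "\<mu> \<in> par n" "\<mu> \<noteq> \<nu>" using less.prems below_subset_par[OF n] by (auto simp: below_def)
    then have m0: "0 \<notin># \<mu>" by (simp add: par_def)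
    have "jack_inner \<alpha> (P \<mu>) (P \<nu>) = 0"
      using fam m n unfolding is_jack_P_family_def by (auto simp: is_partition_def par_def)
    then have "ip \<alpha> n (sym_emb (F \<mu>)) (sym_emb (F \<nu>)) = 0"
      by (simp add: PF[OF m(1)] PF[OF n] jack_inner_ser[OF a])
    then have "ip \<alpha> n (sym_emb (mono_coeff \<alpha> \<mu>)) (sym_emb (F \<nu>)) +
       (\<Sum>\<kappa>\<in>below \<mu>. u \<mu> \<kappa> * ip \<alpha> n (sym_emb (mono_coeff \<alpha> \<kappa>)) (sym_emb (F \<nu>))) = 0"
      unfolding F_def[of \<mu>] sym_emb_add sym_emb_sum sym_emb_scale ip_add_left ip_sum_left ip_scale_left .
    moreover have "ip \<alpha> n (sym_emb (mono_coeff \<alpha> \<kappa>)) (sym_emb (F \<nu>)) = 0" if "\<kappa> \<in> below \<mu>" for \<kappa>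
      using less.hyps[OF card_below_less[OF m0 that]] below_trans[of \<nu> \<mu> \<kappa>] less.prems that n by (auto simp: par_def)
    ultimately show ?case by simp
  qed
  define h where "h = (\<lambda>\<rho>. F \<nu> \<rho> - jack_vector \<alpha> \<nu> \<rho>)"
  obtain v where v: "jack_vector \<alpha> \<nu> = (\<lambda>\<rho>. mono_coeff \<alpha> \<nu> \<rho> - (\<Sum>\<mu>\<in>below \<nu>. v \<mu> * mono_coeff \<alpha> \<mu> \<rho>))"
    using is_jack_vector[OF a, of \<nu>] unfolding is_jack_vector_def by blast
  have h: "h = (\<lambda>\<rho>. \<Sum>\<mu>\<in>below \<nu>. (u \<nu> \<mu> + v \<mu>) * mono_coeff \<alpha> \<mu> \<rho>)"
    unfolding h_def F_def v by (simp add: fun_eq_iff distrib_right sum.distrib)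
  have oh: "ip \<alpha> n (sym_emb (mono_coeff \<alpha> \<mu>)) (sym_emb h) = 0" if "\<mu> \<in> below \<nu>" for \<mu>
  proof -
    have "ip \<alpha> n (sym_emb (jack_vector \<alpha> \<nu>)) (sym_emb (mono_coeff \<alpha> \<mu>)) = 0"
      using is_jack_vector[OF a, of \<nu>] that unfolding is_jack_vector_def n_def by blast
    then show ?thesis
      using orth[OF that] unfolding h_def sym_emb_diff ip_commute[of _ _ "sym_emb (mono_coeff \<alpha> \<mu>)"] ip_diff_left
      by simp
  qed
  have "ip \<alpha> n (sym_emb h) (sym_emb h) = (\<Sum>\<mu>\<in>below \<nu>. (u \<nu> \<mu> + v \<mu>) * ip \<alpha> n (sym_emb (mono_coeff \<alpha> \<mu>)) (sym_emb h))"
    by (subst (1) h) (simp only: sym_emb_sum sym_emb_scale ip_sum_left ip_scale_left)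
  then have "ip \<alpha> n (sym_emb h) (sym_emb h) = 0" using oh by simp
  then have "sym_emb h 0 \<rho> = 0" if "\<rho> \<in> par n" for \<rho>
    by (rule ip_zero[OF a]) (use that in \<open>simp add: in_states par_def\<close>)
  then have "F \<nu> \<rho> = jack_vector \<alpha> \<nu> \<rho>" if "\<rho> \<in> par n" for \<rho>
    using that by (auto simp: sym_emb_def h_def)
  then have "ser \<alpha> n (F \<nu>) = ser \<alpha> n (jack_vector \<alpha> \<nu>)"
    by (simp add: ser_def fun_eq_iff)
  then show ?thesis
    using PF[OF n] by (simp add: jack_series_def n_def)
qed

lemma jack_P_eq:
  assumes "\<alpha> > 0" "is_partition \<nu>"
  shows "jack_P \<alpha> \<nu> = jack_series \<alpha> \<nu>"
  unfolding jack_P_def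
proof (rule the_equality)
  show "\<exists>P. is_jack_P_family \<alpha> P \<and> jack_series \<alpha> \<nu> = P \<nu>"
    using jack_series_family[OF assms(1)] by blast
qed (auto simp: jack_family_unique[OF assms(1) _ assms(2)])

lemma jack_theta_eq:
  assumes a: "\<alpha> > 0" and p: "\<nu> \<in> par n" and r: "\<rho> \<in> par n"
  shows "jack_theta \<alpha> \<rho> \<nu> =
    (\<Prod>s\<in>boxes \<nu>. \<alpha> * real (arm \<nu> s) + real (leg \<nu> s) + 1) * (pweight \<alpha> \<rho> * jack_vector \<alpha> \<nu> \<rho>)"
proof -
  let ?H = "\<Prod>s\<in>boxes \<nu>. \<alpha> * real (arm \<nu> s) + real (leg \<nu> s) + 1"
  have nu: "is_partition \<nu>" "sum_mset \<nu> = n" using p by (auto simp: par_def is_partition_def)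
  have "jack_J \<alpha> \<nu> = ser \<alpha> n (\<lambda>\<rho>. ?H * jack_vector \<alpha> \<nu> \<rho>)"
    unfolding jack_J_def jack_P_eq[OF a nu(1)] jack_series_def nu(2) ser_def sum_distrib_left
    by (intro ext sum.cong refl) (simp only: mult_ac)
  then show ?thesis
    unfolding jack_theta_def using r by (simp add: power_sum_coeff_ser)
qed

lemma supported_add:
  assumes "supported N S G" "supported N S H"
  shows "supported N S (\<lambda>m. G m + c * H m)"
  unfolding supported_def
proof (intro allI impI)
  fix m assume "G m + c * H m \<noteq> 0"
  then have "G m \<noteq> 0 \<or> H m \<noteq> 0" by auto
  then show "exps N m \<in> S" using assms unfolding supported_def by blast
qed

section \<open>Rectangular diagrams\<close>

definition shifted_lax :: "real \<Rightarrow> real \<Rightarrow> (nat \<Rightarrow> nat multiset \<Rightarrow> real) \<Rightarrow> nat \<Rightarrow> nat multiset \<Rightarrow> real" where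
  "shifted_lax \<alpha> c f k \<rho> = lax \<alpha> f k \<rho> + c * f k \<rho>"

lemma xpoly_shifted_lax:
  assumes "\<alpha> > 0"
  shows "xpoly \<alpha> (Suc n) n (shifted_lax \<alpha> c f) = (\<lambda>m. Y_op \<alpha> (Suc n) (xpoly \<alpha> (Suc n) n f) m + c * xpoly \<alpha> (Suc n) n f m)"
  unfolding shifted_lax_def[abs_def] by (rule ext) (simp add: xpoly_add xpoly_scale xpoly_lax[OF assms])

lemma supported_shifted_lax:
  assumes a: "\<alpha> > 0" and "lower_set S" "supported (Suc n) S (xpoly \<alpha> (Suc n) n f)"
  shows "supported (Suc n) S (xpoly \<alpha> (Suc n) n (shifted_lax \<alpha> c f))"
  unfolding xpoly_shifted_lax[OF a] using assms by (intro supported_add supported_Y_op) auto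

lemma ip_shifted_lax:
  assumes "\<alpha> > 0"
  shows "ip \<alpha> n (shifted_lax \<alpha> c f) g = ip \<alpha> n f (shifted_lax \<alpha> c g)"
proof -
  have *: "ip \<alpha> n (shifted_lax \<alpha> c f) g = ip \<alpha> n (lax \<alpha> f) g + c * ip \<alpha> n f g" for f g
    unfolding shifted_lax_def[abs_def] ip_add_left ip_scale_left ..
  have "ip \<alpha> n f (shifted_lax \<alpha> c g) = ip \<alpha> n (lax \<alpha> g) f + c * ip \<alpha> n g f"
    by (subst ip_commute) (rule *)
  also have "ip \<alpha> n (lax \<alpha> g) f = ip \<alpha> n (lax \<alpha> f) g"
    by (subst ip_lax[OF assms]) (rule ip_commute)
  also have "ip \<alpha> n g f = ip \<alpha> n f g" by (rule ip_commute)
  finally show ?thesis unfolding * ..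
qed

text \<open>The top coefficients of \<open>(L - \<alpha> q) (L + p) E\<close> vanish because a part of the rectangle, or an
  additional zero, is \<open>q\<close> or \<open>0\<close>; the rest lies below the rectangle, to which \<open>E\<close> is orthogonal.\<close>

lemma rectangle_lax_quadratic:
  assumes a: "\<alpha> > 0" and p: "p > 0" and q: "q > 0" and s: "(k, \<rho>) \<in> states (p * q)"
  shows "shifted_lax \<alpha> (- \<alpha> * real q) (shifted_lax \<alpha> (real p) (sym_emb (jack_vector \<alpha> (replicate_mset p q)))) k \<rho> = 0"
proof -
  let ?\<nu> = "replicate_mset p q" and ?n = "p * q"
  let ?E = "sym_emb (jack_vector \<alpha> ?\<nu>)" and ?X = "xpoly \<alpha> (Suc ?n) ?n"
  let ?h1 = "shifted_lax \<alpha> (real p) ?E"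
  let ?h2 = "shifted_lax \<alpha> (- \<alpha> * real q) ?h1"
  have n: "?\<nu> \<in> par ?n" using q by (auto simp: par_def)
  have nu0: "0 \<notin># ?\<nu>" using q by auto
  have lowE: "supported (Suc ?n) {\<mu>. excess_le \<mu> ?\<nu>} (?X ?E)" by (rule jack_vector_leading(1)[OF a n])
  have low1: "supported (Suc ?n) {\<mu>. excess_le \<mu> ?\<nu>} (?X ?h1)" by (rule supported_shifted_lax[OF a lower_set_atmost lowE])
  have low2: "supported (Suc ?n) {\<mu>. excess_le \<mu> ?\<nu>} (?X ?h2)" by (rule supported_shifted_lax[OF a lower_set_atmost low1])
  have lead1: "?X ?h1 m = \<alpha> * real (m 0) + real p" if m: "exps (Suc ?n) m = ?\<nu>" for m
    unfolding xpoly_shifted_lax[OF a]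
    using Y_op_leading_value[OF _ m lowE, of "\<lambda>_. 1"] jack_vector_leading(2)[OF a n] m by simp
  have lead2: "?X ?h2 m = 0" if m: "exps (Suc ?n) m = ?\<nu>" for m
  proof -
    have Y: "Y_op \<alpha> (Suc ?n) (?X ?h1) m = \<alpha> * real (m 0) * (\<alpha> * real (m 0) + real p) +
       (\<Sum>x\<in>#?\<nu>. if m 0 < x then (\<alpha> * real x + real p) - (\<alpha> * real (m 0) + real p) else 0)"
      by (rule Y_op_leading_value[OF _ m low1]) (auto simp: lead1)
    have "m 0 = 0 \<or> m 0 \<in># exps (Suc ?n) m" by (auto simp: exps_def)
    then have "m 0 = 0 \<or> m 0 = q" using m by (auto split: if_splits)
    \<comment> \<open>For \<open>m 0 = q\<close> no part is larger and the two terms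
      \<open>\<alpha> q (\<alpha> q + p)\<close> cancel. For \<open>m 0 = 0\<close> each of the
      \<open>p\<close> parts contributes \<open>\<alpha> q\<close>, which cancels
      \<open>\<alpha> q\<close> times the value \<open>p\<close> of the inner function.\<close>
    then show ?thesis
      unfolding xpoly_shifted_lax[OF a, of _ _ ?h1] Y lead1[OF m] using q by (auto simp: algebra_simps)
  qed
  have sup2: "supported (Suc ?n) (below ?\<nu>) (?X ?h2)"
    using low2 lead2 unfolding supported_def below_def by (auto simp: zero_notin_exps)
  \<comment> \<open>Both operators move to the second argument, where they keep the support strictly
    below the rectangle.\<close>
  have "ip \<alpha> ?n ?h2 ?h2 = ip \<alpha> ?n ?E (shifted_lax \<alpha> (real p) (shifted_lax \<alpha> (- \<alpha> * real q) ?h2))"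
    by (simp only: ip_shifted_lax[OF a])
  also have "\<dots> = 0"
    by (intro jack_vector_orthogonal_below[OF a n] supported_shifted_lax[OF a lower_set_below[OF nu0]] sup2)
  finally show ?thesis by (rule ip_zero[OF a _ s])
qed

lemma shifted_lax_sym_emb:
  assumes "0 \<notin># \<rho>"
  shows "shifted_lax \<alpha> c (sym_emb f) k \<rho> = (if k = 0 then c * f \<rho> else f (add_mset k \<rho>))"
proof -
  have "(\<Sum>x\<in>#\<rho>. \<alpha> * real x * sym_emb f (k + x) (\<rho> - {#x#})) = (\<Sum>x\<in>#\<rho>. 0)"
    using assms by (intro arg_cong[of _ _ sum_mset] image_mset_cong) (auto simp: sym_emb_def)
  moreover have "(\<Sum>i=1..k. sym_emb f (k - i) (add_mset i \<rho>)) = (if k = 0 then 0 else f (add_mset k \<rho>))"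
  proof (cases "k = 0")
    case False
    have "(\<Sum>i=1..k. sym_emb f (k - i) (add_mset i \<rho>)) = (\<Sum>i\<in>{k}. sym_emb f (k - i) (add_mset i \<rho>))"
      using False by (intro sum.mono_neutral_right) (auto simp: sym_emb_def)
    then show ?thesis using False by (simp add: sym_emb_def)
  qed simp
  ultimately show ?thesis by (simp add: shifted_lax_def lax_def sym_emb_def)
qed

text \<open>\<open>L + p\<close> places \<open>f (add_mset j \<rho>)\<close> at \<open>w^j\<close>
  for \<open>j > 0\<close>, but \<open>p\<close> times \<open>f \<rho>\<close> at
  \<open>w^0\<close>. The second factor reaches \<open>w^0\<close> only through the summand
  \<open>i = k\<close>, which is the source of \<open>- real p\<close> on the right.\<close>

lemma rectangle_vector_recursion:
  assumes a: "\<alpha> > 0" and s: "k + sum_mset \<rho> = p * q" "0 \<notin># \<rho>" and k: "k > 0"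
  defines "f \<equiv> jack_vector \<alpha> (replicate_mset p q)"
  shows "(\<Sum>x\<in>#\<rho>. \<alpha> * real x * f (add_mset (k + x) (\<rho> - {#x#}))) + (\<Sum>i=1..<k. f (add_mset (k - i) (add_mset i \<rho>)))
    = (\<alpha> * real q - real p - (\<alpha> - 1) * real k) * f (add_mset k \<rho>)"
proof -
  let ?h = "shifted_lax \<alpha> (real p) (sym_emb f)"
  have pq: "p > 0" "q > 0" using s k by (auto intro: Nat.gr0I)
  have "shifted_lax \<alpha> (- \<alpha> * real q) ?h k \<rho> = 0"
    unfolding f_def using s by (intro rectangle_lax_quadratic[OF a pq]) (simp add: in_states)
  moreover have "(\<Sum>x\<in>#\<rho>. \<alpha> * real x * ?h (k + x) (\<rho> - {#x#})) = (\<Sum>x\<in>#\<rho>. \<alpha> * real x * f (add_mset (k + x) (\<rho> - {#x#})))"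
  proof (intro arg_cong[of _ _ sum_mset] image_mset_cong)
    fix x
    have "0 \<notin># \<rho> - {#x#}" using s(2) in_diffD by metis
    then show "\<alpha> * real x * ?h (k + x) (\<rho> - {#x#}) = \<alpha> * real x * f (add_mset (k + x) (\<rho> - {#x#}))"
      using k by (simp add: shifted_lax_sym_emb)
  qed
  moreover have "(\<Sum>i=1..k. ?h (k - i) (add_mset i \<rho>)) = real p * f (add_mset k \<rho>) + (\<Sum>i=1..<k. f (add_mset (k - i) (add_mset i \<rho>)))"
  proof -
    have "{1..k} = insert k {1..<k}" using k by auto
    then have "(\<Sum>i=1..k. ?h (k - i) (add_mset i \<rho>)) = ?h 0 (add_mset k \<rho>) + (\<Sum>i=1..<k. ?h (k - i) (add_mset i \<rho>))"
      by simp
    also have "?h 0 (add_mset k \<rho>) = real p * f (add_mset k \<rho>)"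
      using s k by (simp add: shifted_lax_sym_emb)
    also have "(\<Sum>i=1..<k. ?h (k - i) (add_mset i \<rho>)) = (\<Sum>i=1..<k. f (add_mset (k - i) (add_mset i \<rho>)))"
      using s by (intro sum.cong refl) (auto simp: shifted_lax_sym_emb)
    finally show ?thesis .
  qed
  moreover have "?h k \<rho> = f (add_mset k \<rho>)" using s k by (simp add: shifted_lax_sym_emb)
  ultimately show ?thesis
    unfolding shifted_lax_def[of _ "- \<alpha> * real q"] lax_def by (simp add: algebra_simps)
qed

section \<open>Monomial coefficients of the rectangle and normalization\<close>

lemma exps_swap_values:
  assumes "j \<in> {1..<N}"
  shows "exps N (m(0 := x, j := y)) = exps N (m(0 := y, j := x))"
proof -
  have *: "exps N (m(0 := x, j := y)) = (if x = 0 then {#} else {#x#}) + ((if y = 0 then {#} else {#y#}) + exps N (m(0 := 0, j := 0)))" for x y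
  proof -
    have "exps N (m(0 := x, j := y)) = (if y = 0 then {#} else {#y#}) + exps N (m(0 := x, j := 0))"
      using exps_update[of j N "m(0 := x, j := y)"] assms by simp
    moreover have "m(0 := x, j := 0, 0 := 0) = m(0 := 0, j := 0)" using assms by (auto simp: fun_eq_iff)
    then have "exps N (m(0 := x, j := 0)) = (if x = 0 then {#} else {#x#}) + exps N (m(0 := 0, j := 0))"
      using exps_update[of 0 N "m(0 := x, j := 0)"] assms by simp
    ultimately show ?thesis by simp
  qed
  show ?thesis unfolding *[of x y] *[of y x] by simp
qed

text \<open>The quadratic equation in the basis of monomials. The Jack function is symmetric, so
  every \<open>T_op j\<close> annihilates it and \<open>L + p\<close> multiplies its coefficient at
  \<open>m\<close> by \<open>\<alpha> * m 0 + p\<close>. What remains has a common factor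
  \<open>\<alpha>\<close>.\<close>

lemma rectangle_coefficient_equation:
  assumes a: "\<alpha> > 0" and p: "p > 0" and q: "q > 0"
  defines "G \<equiv> xpoly \<alpha> (Suc (p * q)) (p * q) (sym_emb (jack_vector \<alpha> (replicate_mset p q)))"
  shows "(real q - real (m 0)) * (\<alpha> * real (m 0) + real p) * G m =
     (\<Sum>j\<in>{1..<Suc (p * q)}. \<Sum>c<m j. (real (m 0 + m j) - 2 * real c) * G (m(0 := m 0 + m j - c, j := c)))"
proof -
  let ?n = "p * q"
  let ?N = "Suc ?n"
  let ?E = "sym_emb (jack_vector \<alpha> (replicate_mset p q))"
  let ?h1 = "shifted_lax \<alpha> (real p) ?E"
  have sym: "G (m(0 := x, j := y)) = G (m(0 := y, j := x))" if "j \<in> {1..<?N}" for m j x y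
    unfolding G_def by (rule xpoly_sym_emb_exps[OF exps_swap_values[OF that]])
  have T0: "T_op j G m = 0" if "j \<in> {1..<?N}" for j m
    unfolding T_op_def by (subst sym[OF that]) simp
  have G1: "xpoly \<alpha> ?N ?n ?h1 = (\<lambda>m. (\<alpha> * real (m 0) + real p) * G m)"
    unfolding xpoly_shifted_lax[OF a] G_def[symmetric] by (rule ext) (simp add: Y_op_def T0 algebra_simps)
  have "xpoly \<alpha> ?N ?n (shifted_lax \<alpha> (- \<alpha> * real q) ?h1) m = ip \<alpha> ?n (\<lambda>_ _. 0) (\<lambda>k \<rho>. pw_basis ?N k \<rho> m)"
    unfolding xpoly_def using rectangle_lax_quadratic[OF a p q] by (intro ip_cong) auto
  also have "\<dots> = 0" by (simp add: ip_def)
  finally have "Y_op \<alpha> ?N (xpoly \<alpha> ?N ?n ?h1) m - \<alpha> * real q * xpoly \<alpha> ?N ?n ?h1 m = 0"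
    unfolding xpoly_shifted_lax[OF a, of _ _ ?h1] by simp
  moreover have "Y_op \<alpha> ?N (xpoly \<alpha> ?N ?n ?h1) m = \<alpha> * real (m 0) * ((\<alpha> * real (m 0) + real p) * G m) +
     \<alpha> * (\<Sum>j\<in>{1..<?N}. \<Sum>c<m j. (real (m 0 + m j) - 2 * real c) * G (m(0 := m 0 + m j - c, j := c)))"
  proof -
    have "T_op j (xpoly \<alpha> ?N ?n ?h1) m = \<alpha> * (\<Sum>c<m j. (real (m 0 + m j) - 2 * real c) * G (m(0 := m 0 + m j - c, j := c)))"
      if j: "j \<in> {1..<?N}" for j
      unfolding T_op_def sum_distrib_left
    proof (intro sum.cong refl)
      fix c assume c: "c \<in> {..<m j}"
      have "j \<noteq> 0" using j by simp
      then show "xpoly \<alpha> ?N ?n ?h1 (m(0 := m 0 + m j - c, j := c)) - xpoly \<alpha> ?N ?n ?h1 (m(0 := c, j := m 0 + m j - c)) =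
        \<alpha> * ((real (m 0 + m j) - 2 * real c) * G (m(0 := m 0 + m j - c, j := c)))"
        unfolding G1 sym[OF j, of m c] using c by (simp add: of_nat_diff algebra_simps)
    qed
    then have "(\<Sum>j\<in>{1..<?N}. T_op j (xpoly \<alpha> ?N ?n ?h1) m) =
       \<alpha> * (\<Sum>j\<in>{1..<?N}. \<Sum>c<m j. (real (m 0 + m j) - 2 * real c) * G (m(0 := m 0 + m j - c, j := c)))"
      unfolding sum_distrib_left by (intro sum.cong refl) (simp only: sum_distrib_left)
    then show ?thesis unfolding Y_op_def by (simp only: G1)
  qed
  ultimately have "\<alpha> * ((\<Sum>j\<in>{1..<?N}. \<Sum>c<m j. (real (m 0 + m j) - 2 * real c) * G (m(0 := m 0 + m j - c, j := c)))
      - (real q - real (m 0)) * (\<alpha> * real (m 0) + real p) * G m) = 0"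
    unfolding G1 by (simp add: algebra_simps)
  then show ?thesis using a by simp
qed

lemma exps_le_part:
  assumes "excess_le (exps N m) (replicate_mset p q)" "i < N"
  shows "m i \<le> q"
proof -
  have "excess (replicate_mset p q) q = 0" by (simp add: excess_def)
  then have "(\<Sum>i<N. m i - q) = 0"
    using assms(1) unfolding excess_le_def excess_exps by (metis le_zero_eq)
  then show ?thesis using assms(2) by auto
qed

lemma filter_replicate_mset: "filter_mset P (replicate_mset n x) = (if P x then replicate_mset n x else {#})"
  by (induction n) auto

text \<open>A stage in the filling of the rectangle: \<open>r\<close> complete rows, one row with
  \<open>a\<close> boxes, and \<open>s\<close> boxes not yet placed.\<close>

definition hook_exps :: "nat \<Rightarrow> nat \<Rightarrow> nat \<Rightarrow> nat \<Rightarrow> nat multiset" where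
  "hook_exps q a r s = (if a = 0 then {#} else {#a#}) + replicate_mset r q + replicate_mset s 1"

definition rect_coeff :: "real \<Rightarrow> nat \<Rightarrow> nat \<Rightarrow> nat multiset \<Rightarrow> real" where
  "rect_coeff \<alpha> p q \<mu> = xpoly \<alpha> (Suc (p * q)) (p * q) (sym_emb (jack_vector \<alpha> (replicate_mset p q))) (part \<mu>)"

lemma rect_coeff_exps:
  assumes "exps (Suc (p * q)) m = \<mu>"
  shows "xpoly \<alpha> (Suc (p * q)) (p * q) (sym_emb (jack_vector \<alpha> (replicate_mset p q))) m = rect_coeff \<alpha> p q \<mu>"
  unfolding rect_coeff_def
proof (rule xpoly_sym_emb_exps)
  have "size \<mu> \<le> Suc (p * q)"
    using size_filter_mset_lesseq[of "\<lambda>x. x \<noteq> 0" "image_mset m (mset_set {..<Suc (p * q)})"]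
    unfolding assms[symmetric] exps_def by simp
  moreover have "0 \<notin># \<mu>" using zero_notin_exps[of "Suc (p * q)" m] assms by simp
  ultimately show "exps (Suc (p * q)) m = exps (Suc (p * q)) (part \<mu>)"
    using assms by (simp add: exps_part)
qed

text \<open>The coefficient equation at an exponent \<open>c\<close> for \<open>x_0\<close>,
  \<open>r\<close> exponents \<open>q\<close> and \<open>s\<close> exponents 1. Each variable with
  exponent \<open>q\<close> returns \<open>q - c\<close> copies of the same coefficient, which
  changes \<open>p\<close> into \<open>p - r\<close>; each variable with exponent 1 can give its box
  to \<open>x_0\<close>. For \<open>s = 0\<close> the truncated \<open>s - 1\<close> is multiplied
  by 0.\<close>

lemma rect_coeff_step:
  assumes a: "\<alpha> > 0" and p: "p > 0" and aq: "c < q" and rs: "r + s \<le> p * q"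
  shows "real (q - c) * (\<alpha> * real c + real p - real r) * rect_coeff \<alpha> p q (hook_exps q c r s) =
     real s * real (c + 1) * rect_coeff \<alpha> p q (hook_exps q (c + 1) r (s - 1))"
proof -
  let ?n = "p * q"
  let ?N = "Suc ?n"
  let ?E = "sym_emb (jack_vector \<alpha> (replicate_mset p q))"
  define G where "G = xpoly \<alpha> ?N ?n ?E"
  have q: "q > 0" using aq by simp
  have nu: "replicate_mset p q \<in> par ?n" using q by (auto simp: par_def)
  define m where "m i = (if i = 0 then c else if i \<le> r then q else if i \<le> r + s then 1 else 0)" for i
  let ?R = "{1..r}" and ?T = "{r + 1..r + s}"
  have exm: "exps ?N m' = hook_exps q (m' 0) r s" if "\<And>i. i > 0 \<Longrightarrow> m' i = m i" for m'
  proof -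
    have S: "{..<?N} = insert 0 (?R \<union> (?T \<union> {r + s + 1..?n}))" using rs by auto
    have "image_mset m' (mset_set {..<?N}) = add_mset (m' 0) (image_mset m' (mset_set ?R) + (image_mset m' (mset_set ?T) + image_mset m' (mset_set {r + s + 1..?n})))"
    proof -
      have "mset_set (?R \<union> (?T \<union> {r + s + 1..?n})) = mset_set ?R + mset_set (?T \<union> {r + s + 1..?n})"
        by (rule mset_set_Union) auto
      moreover have "mset_set (?T \<union> {r + s + 1..?n}) = mset_set ?T + mset_set {r + s + 1..?n}"
        by (rule mset_set_Union) auto
      moreover have "mset_set {..<?N} = add_mset 0 (mset_set (?R \<union> (?T \<union> {r + s + 1..?n})))"
        unfolding S by (rule mset_set.insert) auto
      ultimately show ?thesis by (simp del: One_nat_def)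
    qed
    moreover have "image_mset m' (mset_set ?R) = image_mset (\<lambda>_. q) (mset_set ?R)"
      by (intro image_mset_cong) (auto simp: that m_def)
    moreover have "image_mset m' (mset_set ?T) = image_mset (\<lambda>_. 1) (mset_set ?T)"
      by (intro image_mset_cong) (auto simp: that m_def)
    moreover have "image_mset m' (mset_set {r + s + 1..?n}) = image_mset (\<lambda>_. 0) (mset_set {r + s + 1..?n})"
      by (intro image_mset_cong) (auto simp: that m_def)
    ultimately show ?thesis
      using q unfolding exps_def hook_exps_def by (simp add: image_mset_const_eq filter_replicate_mset)
  qed
  have em: "exps ?N m = hook_exps q c r s" using exm[of m] by (simp add: m_def)
  have G0: "G m' = 0" if "i < ?N" "m' i > q" for m' i
    using jack_vector_leading(1)[OF a nu] exps_le_part[of ?N m' p q i] that unfolding G_def supported_def by fastforce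
  have sym: "G (m(0 := x, j := y)) = G (m(0 := y, j := x))" if "j \<in> {1..<?N}" for m j x y
    unfolding G_def by (rule xpoly_sym_emb_exps[OF exps_swap_values[OF that]])
  let ?t = "\<lambda>j. \<Sum>c<m j. (real (m 0 + m j) - 2 * real c) * G (m(0 := m 0 + m j - c, j := c))"
  have R: "?t j = real (q - c) * G m" if j: "j \<in> ?R" for j
  proof -
    have mj: "m j = q" "m 0 = c" "j \<noteq> 0" using j by (auto simp: m_def)
    have jN: "j \<in> {1..<?N}" using j rs by auto
    let ?h = "\<lambda>d. (real (c + q) - 2 * real d) * G (m(0 := c + q - d, j := d))"
    have S: "{..<q} = ({..<c} \<union> {c}) \<union> {c + 1..q - 1}" using aq by auto
    \<comment> \<open>Here \<open>x_0\<close> would have an exponent above \<open>q\<close>, which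
      no partition dominated by the rectangle allows.\<close>
    have "sum ?h {..<c} = 0"
      using mj by (intro sum.neutral ballI) (auto intro!: G0[of 0])
    moreover have "sum ?h {c + 1..q - 1} = 0"
    proof (rule sum_antisymmetric_zero)
      fix d assume d: "c + 1 \<le> d" "d \<le> q - 1"
      then have "c + 1 + (q - 1) - d = c + q - d" "c + q - (c + q - d) = d" using aq by auto
      then show "?h (c + 1 + (q - 1) - d) = - ?h d"
        unfolding sym[OF jN, of _ _ d] using d by (simp add: of_nat_diff algebra_simps)
    qed
    moreover have "?h c = real (q - c) * G m"
    proof -
      have "m(0 := c, j := q) = m" using mj by auto
      then have "G (m(0 := q, j := c)) = G m" using sym[OF jN, of m q c] by simp
      then show ?thesis using aq by (simp add: of_nat_diff)
    qed
    moreover have "sum ?h {..<q} = sum ?h {..<c} + ?h c + sum ?h {c + 1..q - 1}"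
      unfolding S by (subst sum.union_disjoint; (subst sum.union_disjoint)?; auto)
    ultimately show ?thesis using mj by simp
  qed
  have T: "?t j = real (c + 1) * rect_coeff \<alpha> p q (hook_exps q (c + 1) r (s - 1))" if j: "j \<in> ?T" for j
  proof -
    have mj: "m j = 1" "m 0 = c" "j \<noteq> 0" using j by (auto simp: m_def)
    have jN: "j \<in> {1..<?N}" using j rs by auto
    have "exps ?N (m(0 := c + 1)) = hook_exps q (c + 1) r s" using exm[of "m(0 := c + 1)"] by simp
    moreover have "m(0 := c + 1, j := 0) = m(j := 0, 0 := c + 1)" using mj by auto
    moreover have "exps ?N (m(0 := c + 1)) = {#1#} + exps ?N (m(0 := c + 1, j := 0))"
      using exps_update[of j ?N "m(0 := c + 1)"] mj jN by simp
    moreover have "s > 0" using j by auto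
    ultimately have "exps ?N (m(0 := c + 1, j := 0)) = hook_exps q (c + 1) r (s - 1)"
      by (cases s) (auto simp: hook_exps_def)
    then show ?thesis using mj unfolding G_def by (simp add: rect_coeff_exps)
  qed
  have O: "?t j = 0" if j: "j \<in> {r + s + 1..?n}" for j
    using j by (simp add: m_def)
  have S: "{1..<?N} = ?R \<union> (?T \<union> {r + s + 1..?n})" using rs by auto
  have "(\<Sum>j\<in>{1..<?N}. ?t j) = (\<Sum>j\<in>?R. ?t j) + ((\<Sum>j\<in>?T. ?t j) + (\<Sum>j\<in>{r + s + 1..?n}. ?t j))"
    unfolding S by (subst sum.union_disjoint; (subst sum.union_disjoint)?; auto)
  also have "\<dots> = real r * (real (q - c) * G m) + real s * (real (c + 1) * rect_coeff \<alpha> p q (hook_exps q (c + 1) r (s - 1)))"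
    using R T O by simp
  finally have "(real q - real (m 0)) * (\<alpha> * real (m 0) + real p) * G m = \<dots>"
    using rectangle_coefficient_equation[OF a p q, of m] unfolding G_def by simp
  then show ?thesis
    using aq rect_coeff_exps[OF em, of \<alpha>] unfolding G_def by (simp add: m_def of_nat_diff algebra_simps)
qed

text \<open>The boxes are placed one at a time, row after row, each with its hook factor. The
  process ends at the leading monomial of the rectangle, whose coefficient is 1.\<close>

lemma rect_coeff_ones:
  assumes a: "\<alpha> > 0" and p: "p > 0" and q: "q > 0"
  shows "(\<Prod>r<p. \<Prod>b<q. \<alpha> * real b + real p - real r) * rect_coeff \<alpha> p q (replicate_mset (p * q) 1) = fact (p * q)"
proof -
  let ?n = "p * q"
  \<comment> \<open>Division by the factorial of the number of unplaced boxes absorbs the factor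
    \<open>real s\<close> of each step.\<close>
  define Q where "Q r c = rect_coeff \<alpha> p q (hook_exps q c r (?n - q * r - c)) / fact (?n - q * r - c)" for r c
  have step: "real (q - c) * (\<alpha> * real c + real p - real r) * Q r c = real (c + 1) * Q r (c + 1)"
    if "c < q" "r < p" for r c
  proof -
    define s where "s = ?n - q * r - c"
    have "q * (r + 1) \<le> q * p" using that by (intro mult_le_mono) auto
    then have s: "s > 0" "q * r + c < ?n" using that by (auto simp: s_def algebra_simps)
    have "r \<le> q * r" using q by simp
    then have "r + s \<le> ?n" using s(2) unfolding s_def by linarith
    from rect_coeff_step[OF a p \<open>c < q\<close> this]
    have st: "real (q - c) * (\<alpha> * real c + real p - real r) * rect_coeff \<alpha> p q (hook_exps q c r s) =
       real s * real (c + 1) * rect_coeff \<alpha> p q (hook_exps q (c + 1) r (s - 1))" .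
    have f: "fact s = real s * fact (s - 1)" using s by (simp add: fact_reduce)
    have s': "?n - q * r - (c + 1) = s - 1" by (simp add: s_def)
    have "real (q - c) * (\<alpha> * real c + real p - real r) * Q r c = (real s * real (c + 1) * rect_coeff \<alpha> p q (hook_exps q (c + 1) r (s - 1))) / fact s"
      unfolding Q_def s_def[symmetric] st[symmetric] by simp
    also have "\<dots> = real (c + 1) * Q r (c + 1)"
      unfolding Q_def s' f using s by simp
    finally show ?thesis .
  qed
  have row: "Q r c = real (q choose c) * (\<Prod>b<c. \<alpha> * real b + real p - real r) * Q r 0" if "c \<le> q" "r < p" for r c
    using that
  proof (induction c)
    case (Suc c)
    have b: "real (Suc c) * real (q choose Suc c) = real (q - c) * real (q choose c)"
      using binomial_absorption[of c q] binomial_absorb_comp[of q c] unfolding of_nat_mult[symmetric] by simp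
    have "real (c + 1) * Q r (c + 1) = real (q - c) * (\<alpha> * real c + real p - real r) * Q r c"
      using step[of c r] Suc.prems by simp
    also have "\<dots> = (real (q - c) * real (q choose c)) * ((\<Prod>b<Suc c. \<alpha> * real b + real p - real r) * Q r 0)"
      using Suc by (simp add: mult_ac)
    also have "\<dots> = real (c + 1) * (real (q choose Suc c) * (\<Prod>b<Suc c. \<alpha> * real b + real p - real r) * Q r 0)"
      unfolding b[symmetric] by (simp add: mult_ac)
    finally have "Q r (c + 1) = real (q choose Suc c) * (\<Prod>b<Suc c. \<alpha> * real b + real p - real r) * Q r 0"
      by (subst (asm) mult_cancel_left) linarith
    then show ?case by simp
  qed simp
  have next_row: "Q (Suc r) 0 = (\<Prod>b<q. \<alpha> * real b + real p - real r) * Q r 0" if "r < p" for r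
  proof -
    \<comment> \<open>A row with \<open>q\<close> boxes is complete: it counts equally as the
      unfinished row and as one of the full rows.\<close>
    have "Q (Suc r) 0 = Q r q" using q by (simp add: Q_def hook_exps_def algebra_simps)
    then show ?thesis using row[of q r] that by simp
  qed
  define h where "h r = (\<Prod>b<q. \<alpha> * real b + real p - real r)" for r
  have rows: "Q R 0 = (\<Prod>r<R. h r) * Q 0 0" if "R \<le> p" for R
    using that
  proof (induction R)
    case (Suc R)
    have "Q (Suc R) 0 = h R * Q R 0" using next_row[of R] Suc.prems by (simp only: h_def Suc_le_eq)
    also have "\<dots> = h R * ((\<Prod>r<R. h r) * Q 0 0)" using Suc by simp
    finally show ?case by (simp add: mult.commute mult.left_commute)
  qed simp
  have "Q p 0 = (\<Prod>r<p. h r) * Q 0 0" by (rule rows) simp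
  moreover have "Q p 0 = 1"
  proof -
    have nu: "replicate_mset p q \<in> par ?n" using q by (auto simp: par_def)
    have "p \<le> p * q" using q by simp
    then have "size (replicate_mset p q) \<le> Suc ?n" unfolding size_replicate_mset by linarith
    then have "exps (Suc ?n) (part (replicate_mset p q)) = replicate_mset p q"
      using q by (intro exps_part) auto
    then have "rect_coeff \<alpha> p q (replicate_mset p q) = 1"
      unfolding rect_coeff_def by (rule jack_vector_leading(2)[OF a nu])
    then show ?thesis by (simp add: Q_def hook_exps_def mult.commute)
  qed
  moreover have "Q 0 0 = rect_coeff \<alpha> p q (replicate_mset ?n 1) / fact ?n"
    by (simp add: Q_def hook_exps_def)
  ultimately show ?thesis unfolding h_def[symmetric] by (simp add: field_simps)
qed

lemma pw_basis_ones:
  "exps N m = replicate_mset n 1 \<Longrightarrow> pw_basis N 0 (replicate_mset n 1) m = fact n"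
proof (induction n arbitrary: m)
  case 0
  then have "\<forall>i<N. m i = 0" by (auto simp: exps_def)
  then show ?case by (simp add: pw_basis_empty x_shift_def x_one_def)
next
  case (Suc n)
  have m1: "m i \<le> 1" if "i < N" for i
  proof (rule ccontr)
    assume "\<not> m i \<le> 1"
    then have "m i \<in># exps N m" using that by (auto simp: exps_def)
    then show False using Suc.prems \<open>\<not> m i \<le> 1\<close> by (auto split: if_splits)
  qed
  have summand: "x_shift i 1 (pw_basis N 0 (replicate_mset n 1)) m = real (m i) * fact n" if i: "i < N" for i
  proof (cases "m i = 1")
    case True
    then have "exps N (m(i := 0)) = replicate_mset n 1"
      using exps_update[OF i, of m] Suc.prems by simp
    then show ?thesis using True Suc.IH by (simp add: x_shift_def)
  next
    case False
    then have "m i = 0" using m1[OF i] by simp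
    then show ?thesis by (simp add: x_shift_def)
  qed
  have "(\<Sum>i<N. m i) = Suc n" using sum_mset_exps[of N m] Suc.prems by simp
  then have "(\<Sum>i<N. real (m i)) = real (Suc n)" by (metis of_nat_sum)
  then show ?case
    by (simp add: pw_basis_add p_times_def summand sum_distrib_right[symmetric] del: One_nat_def)
qed

lemma size_eq_sum_mset_imp_ones:
  "0 \<notin># \<rho> \<Longrightarrow> size \<rho> = sum_mset \<rho> \<Longrightarrow> \<rho> = replicate_mset (sum_mset \<rho>) 1"
proof (induction \<rho>)
  case (add x \<rho>)
  have "size \<rho> \<le> sum_mset \<rho>" using add.prems by (intro size_le_sum_mset) auto
  then have "x = 1" "size \<rho> = sum_mset \<rho>" using add.prems by (cases x; auto)+
  then show ?case using add by simp
qed simp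

lemma z_num_ones: "z_num (replicate_mset n 1) = fact n"
  by (induction n) (simp_all add: z_num_add, simp add: z_num_def)

text \<open>The squarefree monomial occurs only in the power of \<open>p_1\<close>, with coefficient
  \<open>fact (p * q)\<close>, and this cancels the factorial in \<open>pweight\<close>.\<close>

lemma rect_coeff_ones_eq:
  assumes a: "\<alpha> > 0"
  shows "rect_coeff \<alpha> p q (replicate_mset (p * q) 1) = jack_vector \<alpha> (replicate_mset p q) (replicate_mset (p * q) 1) / \<alpha> ^ (p * q)"
proof -
  let ?n = "p * q"
  let ?o = "replicate_mset ?n (1::nat)"
  let ?f = "jack_vector \<alpha> (replicate_mset p q)"
  have e: "exps (Suc ?n) (part ?o) = ?o" by (rule exps_part) auto
  have "rect_coeff \<alpha> p q ?o = (\<Sum>\<rho>\<in>{?o}. pweight \<alpha> \<rho> * ?f \<rho> * pw_basis (Suc ?n) 0 \<rho> (part ?o))"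
    unfolding rect_coeff_def xpoly_sym_emb
  proof (rule sum.mono_neutral_right[OF finite_par])
    show "{?o} \<subseteq> par ?n" by (auto simp: par_def)
    show "\<forall>\<rho>\<in>par ?n - {?o}. pweight \<alpha> \<rho> * ?f \<rho> * pw_basis (Suc ?n) 0 \<rho> (part ?o) = 0"
    proof
      fix \<rho> assume r: "\<rho> \<in> par ?n - {?o}"
      then have r': "0 \<notin># \<rho>" "sum_mset \<rho> = ?n" "\<rho> \<noteq> ?o" by (auto simp: par_def)
      have "size \<rho> \<noteq> ?n" using size_eq_sum_mset_imp_ones[of \<rho>] r' by auto
      then have "size \<rho> < ?n" using size_le_sum_mset[of \<rho>] r' by simp
      then have "pw_basis (Suc ?n) 0 \<rho> (part ?o) = 0"
        using pw_basis_triangular[OF r'(1), of "Suc ?n" "part ?o"] e by fastforce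
      then show "pweight \<alpha> \<rho> * ?f \<rho> * pw_basis (Suc ?n) 0 \<rho> (part ?o) = 0" by simp
    qed
  qed
  then show ?thesis using a by (simp add: pw_basis_ones[OF e] pweight_def z_num_ones del: One_nat_def)
qed

lemma rectangle_pos: "q > 0 \<Longrightarrow> rectangle p q = replicate_mset p q"
  by (simp add: rectangle_def filter_replicate_mset)

lemma rectangle_empty: "p * q = 0 \<Longrightarrow> rectangle p q = {#}"
  by (auto simp: rectangle_def)

lemma rectangle_par: "rectangle p q \<in> par (p * q)"
  by (cases "q = 0") (auto simp: par_def rectangle_pos rectangle_empty split: if_splits)

lemma sum_mset_rectangle: "sum_mset (rectangle p q) = p * q"
  using rectangle_par[of p q] by (simp add: par_def)

lemma part_rectangle:
  assumes "q > 0"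
  shows "part (rectangle p q) i = (if i < p then q else 0)"
proof -
  have "sorted_list_of_multiset (replicate_mset p q) = replicate p q"
    by (induction p) (auto simp: insort_is_Cons)
  then show ?thesis by (simp add: rectangle_pos[OF assms] part_def)
qed

lemma boxes_rectangle: "boxes (rectangle p q) = {..<p} \<times> {..<q}"
proof (cases "q = 0")
  case True
  then show ?thesis by (simp add: boxes_def rectangle_empty part_def)
next
  case False
  then show ?thesis by (auto simp: boxes_def part_rectangle split: if_splits)
qed

section \<open>Hook product and normalized characters of the rectangle\<close>

definition rect_hook :: "real \<Rightarrow> nat \<Rightarrow> nat \<Rightarrow> real" where
  "rect_hook \<alpha> p q = (\<Prod>s\<in>boxes (rectangle p q). \<alpha> * real (arm (rectangle p q) s) + real (leg (rectangle p q) s) + 1)"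

lemma rect_hook_eq: "rect_hook \<alpha> p q = (\<Prod>r<p. \<Prod>b<q. \<alpha> * real b + real p - real r)"
proof -
  have arm: "arm (rectangle p q) (i, j) = q - 1 - j" if "i < p" for i j
  proof -
    have "{j'. j < j' \<and> (i, j') \<in> {..<p} \<times> {..<q}} = {j<..<q}" using that by auto
    then show ?thesis by (simp add: arm_def boxes_rectangle)
  qed
  have leg: "leg (rectangle p q) (i, j) = p - 1 - i" if "j < q" for i j
  proof -
    have "{i'. i < i' \<and> (i', j) \<in> {..<p} \<times> {..<q}} = {i<..<p}" using that by auto
    then show ?thesis by (simp add: leg_def boxes_rectangle)
  qed
  have "rect_hook \<alpha> p q = (\<Prod>(i, j)\<in>{..<p} \<times> {..<q}. \<alpha> * real (q - 1 - j) + real p - real i)"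
    unfolding rect_hook_def boxes_rectangle
  proof (intro prod.cong refl)
    fix s assume "s \<in> {..<p} \<times> {..<q}"
    then obtain i j where s: "s = (i, j)" "i < p" "j < q" by auto
    then show "\<alpha> * real (arm (rectangle p q) s) + real (leg (rectangle p q) s) + 1 =
       (case s of (i, j) \<Rightarrow> \<alpha> * real (q - 1 - j) + real p - real i)"
      by (simp add: arm leg of_nat_diff)
  qed
  also have "\<dots> = (\<Prod>i<p. \<Prod>j<q. \<alpha> * real (q - 1 - j) + real p - real i)"
    by (rule prod.cartesian_product[symmetric])
  also have "\<dots> = (\<Prod>i<p. \<Prod>b<q. \<alpha> * real b + real p - real i)"
    by (intro prod.cong refl prod.reindex_bij_witness[of _ "\<lambda>b. q - 1 - b" "\<lambda>b. q - 1 - b"]) auto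
  finally show ?thesis .
qed

text \<open>Up to a power of \<open>\<alpha>\<close> this is the Jack character: it collects the derivatives of the Jack
  function along the parts of \<open>\<pi>\<close>, evaluated at \<open>p\<^sub>1 = 1\<close> and \<open>p\<^sub>i = 0\<close> for \<open>i > 1\<close>.\<close>

definition rect_U :: "real \<Rightarrow> nat \<Rightarrow> nat \<Rightarrow> nat multiset \<Rightarrow> real" where
  "rect_U \<alpha> p q \<pi> = (if sum_mset \<pi> \<le> p * q then
     rect_hook \<alpha> p q * jack_vector \<alpha> (rectangle p q) (\<pi> + replicate_mset (p * q - sum_mset \<pi>) 1)
       / (\<alpha> ^ (p * q - sum_mset \<pi>) * fact (p * q - sum_mset \<pi>)) else 0)"

text \<open>For \<open>\<pi>\<close> empty this quantity is the coefficient of the power of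
  \<open>p_1\<close> in \<open>J\<close>, which the hook product normalizes to 1. The empty
  rectangle needs its own argument, since the filling of boxes starts from positive sides.\<close>

lemma rect_U_empty:
  assumes a: "\<alpha> > 0"
  shows "rect_U \<alpha> p q {#} = 1"
proof (cases "p * q = 0")
  case True
  have "par 0 = {{#}}" by (auto simp: par_def) (metis multiset_nonemptyE)
  moreover have "exps (Suc 0) (\<lambda>_. 0) = {#}" by (simp add: exps_def)
  ultimately have "jack_vector \<alpha> {#} {#} = 1"
    using jack_vector_leading(2)[OF a, of "{#}" 0 "\<lambda>_. 0"]
    by (simp add: xpoly_sym_emb pweight_def z_num_def pw_basis_empty x_shift_def x_one_def)
  moreover have "rect_hook \<alpha> p q = 1" using True by (auto simp: rect_hook_eq)
  ultimately show ?thesis unfolding rect_U_def True rectangle_empty[OF True] by simp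
next
  case False
  then have pq: "p > 0" "q > 0" by auto
  have "rect_hook \<alpha> p q * (jack_vector \<alpha> (replicate_mset p q) (replicate_mset (p * q) 1) / \<alpha> ^ (p * q)) = fact (p * q)"
    using rect_coeff_ones[OF a pq] unfolding rect_coeff_ones_eq[OF a] rect_hook_eq .
  then show ?thesis
    unfolding rect_U_def rectangle_pos[OF pq(2)] using a by (simp del: One_nat_def add: field_simps)
qed

text \<open>As long as a box is left, both sides use the same entry of the Jack vector, since the
  new part is one of the ones adjoined on the right; only the power of \<open>\<alpha>\<close> and
  the factorial change.\<close>

lemma rect_U_one:
  assumes a: "\<alpha> > 0"
  shows "rect_U \<alpha> p q (add_mset 1 s) = \<alpha> * (real (p * q) - real (sum_mset s)) * rect_U \<alpha> p q s"
proof (cases "sum_mset s < p * q")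
  case True
  define r where "r = p * q - sum_mset s - 1"
  have r: "p * q - sum_mset s = Suc r" "p * q - sum_mset (add_mset 1 s) = r" "real (p * q) - real (sum_mset s) = real (Suc r)"
    using True by (auto simp: r_def)
  have "add_mset 1 s + replicate_mset r 1 = s + replicate_mset (Suc r) 1" by simp
  then show ?thesis
    unfolding rect_U_def r using True a by (simp del: One_nat_def of_nat_Suc add: field_simps)
next
  case False
  then show ?thesis by (cases "sum_mset s = p * q") (auto simp: rect_U_def)
qed

text \<open>The vector recursion for \<open>s\<close> completed by \<open>r\<close> ones. These ones
  are parts too: absorbing one of them into \<open>k\<close> gives the term with
  \<open>k + 1\<close>, for which the equation is solved. When the size exceeds
  \<open>p * q\<close>, all terms are 0.\<close>

lemma rect_U_rec:
  assumes a: "\<alpha> > 0" and s: "0 \<notin># s" and k: "k > 0"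
  shows "rect_U \<alpha> p q (add_mset (k + 1) s) =
    - (\<Sum>i=1..<k. rect_U \<alpha> p q (add_mset (k - i) (add_mset i s)))
    + (\<alpha> * real q - real p - (\<alpha> - 1) * real k) * rect_U \<alpha> p q (add_mset k s)
    - \<alpha> * (\<Sum>t\<in>#s. real t * rect_U \<alpha> p q (add_mset (k + t) (s - {#t#})))"
proof -
  have sz: "sum_mset (add_mset (k + t) (s - {#t#})) = sum_mset s + k" if t: "t \<in># s" for t
  proof -
    obtain s' where "s = add_mset t s'" using t by (meson mset_add)
    then show ?thesis by simp
  qed
  have sz': "sum_mset (add_mset (k - i) (add_mset i s)) = sum_mset s + k" if "i \<in> {1..<k}" for i
    using that by simp
  show ?thesis
  proof (cases "sum_mset s + k \<le> p * q")
    case False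
    have U0: "rect_U \<alpha> p q \<pi> = 0" if "sum_mset \<pi> = sum_mset s + k" for \<pi>
      using False that by (simp add: rect_U_def)
    have "(\<Sum>i=1..<k. rect_U \<alpha> p q (add_mset (k - i) (add_mset i s))) = 0"
      using U0[OF sz'] by (intro sum.neutral ballI)
    moreover have "(\<Sum>t\<in>#s. real t * rect_U \<alpha> p q (add_mset (k + t) (s - {#t#}))) = (\<Sum>t\<in>#s. 0)"
      using U0[OF sz] by (intro arg_cong[of _ _ sum_mset] image_mset_cong) (simp only: mult_zero_right)
    ultimately show ?thesis using False by (simp add: rect_U_def)
  next
    case True
    define r where "r = p * q - (sum_mset s + k)"
    define C where "C = rect_hook \<alpha> p q / (\<alpha> ^ r * fact r)"
    define f where "f = jack_vector \<alpha> (replicate_mset p q)"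
    have q: "q > 0" using True k by (auto intro: Nat.gr0I)
    let ?o = "replicate_mset r (1::nat)"
    have U: "rect_U \<alpha> p q \<pi> = C * f (\<pi> + ?o)" if "sum_mset \<pi> = sum_mset s + k" for \<pi>
      unfolding rect_U_def that using True by (simp add: C_def f_def r_def rectangle_pos[OF q])
    have "0 \<notin># s + ?o" "k + sum_mset (s + ?o) = p * q" using s True by (auto simp: r_def)
    from rectangle_vector_recursion[OF a this(2,1) k]
    have rec: "(\<Sum>x\<in>#s + ?o. \<alpha> * real x * f (add_mset (k + x) (s + ?o - {#x#}))) + (\<Sum>i=1..<k. f (add_mset (k - i) (add_mset i (s + ?o))))
      = (\<alpha> * real q - real p - (\<alpha> - 1) * real k) * f (add_mset k (s + ?o))"
      unfolding f_def .
    have S: "(\<Sum>x\<in>#s. \<alpha> * real x * f (add_mset (k + x) (s + ?o - {#x#}))) * C = \<alpha> * (\<Sum>t\<in>#s. real t * rect_U \<alpha> p q (add_mset (k + t) (s - {#t#})))"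
      unfolding sum_mset_distrib_left sum_mset_distrib_right
    proof (intro arg_cong[of _ _ sum_mset] image_mset_cong)
      fix x assume x: "x \<in># s"
      then have "s + ?o - {#x#} = (s - {#x#}) + ?o" by simp
      then show "\<alpha> * real x * f (add_mset (k + x) (s + ?o - {#x#})) * C = \<alpha> * (real x * rect_U \<alpha> p q (add_mset (k + x) (s - {#x#})))"
        unfolding U[OF sz[OF x]] by simp
    qed
    have O: "(\<Sum>x\<in>#?o. \<alpha> * real x * f (add_mset (k + x) (s + ?o - {#x#}))) * C = rect_U \<alpha> p q (add_mset (k + 1) s)"
    proof (cases r)
      case 0
      \<comment> \<open>Without ones the partition on the right is larger than the rectangle, and
        \<open>rect_U\<close> is 0 by definition.\<close>
      then show ?thesis using True by (simp add: rect_U_def r_def)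
    next
      case (Suc r')
      have e: "s + ?o - {#1#} = s + replicate_mset r' 1" by (simp add: Suc)
      have n: "p * q - sum_mset (add_mset (k + 1) s) = r'" "sum_mset (add_mset (k + 1) s) \<le> p * q" using Suc by (auto simp: r_def)
      have "(\<Sum>x\<in>#?o. \<alpha> * real x * f (add_mset (k + x) (s + ?o - {#x#}))) = (\<Sum>x\<in>#?o. \<alpha> * f (add_mset (k + 1) (s + replicate_mset r' 1)))"
        by (intro arg_cong[of _ _ sum_mset] image_mset_cong) (use e in \<open>auto split: if_splits\<close>)
      also have "\<dots> = real r * (\<alpha> * f (add_mset (k + 1) (s + replicate_mset r' 1)))" by simp
      finally show ?thesis
        unfolding rect_U_def n C_def rectangle_pos[OF q] f_def[symmetric]
        using a n(2) by (simp add: Suc field_simps del: of_nat_Suc One_nat_def)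
    qed
    have I: "(\<Sum>i=1..<k. f (add_mset (k - i) (add_mset i (s + ?o)))) * C = (\<Sum>i=1..<k. rect_U \<alpha> p q (add_mset (k - i) (add_mset i s)))"
      unfolding sum_distrib_right by (intro sum.cong refl, subst U) (auto simp: mult.commute)
    have K: "f (add_mset k (s + ?o)) * C = rect_U \<alpha> p q (add_mset k s)"
      by (subst U) (auto simp: mult.commute)
    have "(\<Sum>x\<in>#s + ?o. \<alpha> * real x * f (add_mset (k + x) (s + ?o - {#x#}))) * C = \<alpha> * (\<Sum>t\<in>#s. real t * rect_U \<alpha> p q (add_mset (k + t) (s - {#t#}))) + rect_U \<alpha> p q (add_mset (k + 1) s)"
      using S O by (simp only: image_mset_union sum_mset.union distrib_right)
    moreover have "((\<Sum>x\<in>#s + ?o. \<alpha> * real x * f (add_mset (k + x) (s + ?o - {#x#}))) + (\<Sum>i=1..<k. f (add_mset (k - i) (add_mset i (s + ?o))))) * C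
      = (\<alpha> * real q - real p - (\<alpha> - 1) * real k) * (f (add_mset k (s + ?o)) * C)"
      unfolding rec by (simp only: mult.assoc)
    ultimately show ?thesis
      unfolding K distrib_right[of _ _ C] I by linarith
  qed
qed

text \<open>The sign and the power of \<open>1 / sqrt \<alpha>\<close> are chosen so that splitting
  and joining terms have the coefficients 1 and \<open>t\<close> of the map recursion.\<close>

definition rect_g :: "real \<Rightarrow> nat \<Rightarrow> nat \<Rightarrow> nat multiset \<Rightarrow> real" where
  "rect_g \<alpha> p q \<pi> = (- 1) ^ size \<pi> * (1 / sqrt \<alpha>) ^ (sum_mset \<pi> + size \<pi>) * rect_U \<alpha> p q \<pi>"

lemma rect_g_empty: "\<alpha> > 0 \<Longrightarrow> rect_g \<alpha> p q {#} = 1"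
  by (simp add: rect_g_def rect_U_empty)

lemma rect_g_one:
  assumes a: "\<alpha> > 0"
  shows "rect_g \<alpha> p q (add_mset 1 s) = (real (sum_mset s) - real p * real q) * rect_g \<alpha> p q s"
proof -
  define x where "x = 1 / sqrt \<alpha>"
  have x2: "x * x * \<alpha> = 1" using a by (simp add: x_def)
  have "rect_g \<alpha> p q (add_mset 1 s) = - ((- 1) ^ size s * (x * x * \<alpha>) * x ^ (sum_mset s + size s) * (real (p * q) - real (sum_mset s)) * rect_U \<alpha> p q s)"
    unfolding rect_g_def rect_U_one[OF a] x_def[symmetric] by (simp add: mult_ac)
  then show ?thesis
    unfolding x2 by (simp add: rect_g_def x_def[symmetric] algebra_simps)
qed

lemma rect_g_rec:
  assumes a: "\<alpha> > 0" and s: "0 \<notin># s" and k: "k > 0"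
  shows "rect_g \<alpha> p q (add_mset (k + 1) s) =
    (\<Sum>i=1..<k. rect_g \<alpha> p q (add_mset (k - i) (add_mset i s)))
    + (sqrt \<alpha> * real q - real p / sqrt \<alpha> + gamma_par \<alpha> * real k) * rect_g \<alpha> p q (add_mset k s)
    + (\<Sum>t\<in>#s. real t * rect_g \<alpha> p q (add_mset (k + t) (s - {#t#})))"
proof -
  define x where "x = 1 / sqrt \<alpha>"
  define N where "N = sum_mset s + k + size s"
  define \<epsilon> where "\<epsilon> = (- 1 :: real) ^ size s"
  have x2: "x * x * \<alpha> = 1" using a by (simp add: x_def)
  have sq: "x * \<alpha> = sqrt \<alpha>" using a by (simp add: x_def real_div_sqrt)
  have I: "rect_g \<alpha> p q (add_mset (k - i) (add_mset i s)) = \<epsilon> * x ^ (N + 2) * rect_U \<alpha> p q (add_mset (k - i) (add_mset i s))" if "i \<in> {1..<k}" for i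
  proof -
    have "sum_mset (add_mset (k - i) (add_mset i s)) + size (add_mset (k - i) (add_mset i s)) = N + 2"
      using that by (auto simp: N_def)
    then show ?thesis unfolding rect_g_def x_def[symmetric] by (simp add: \<epsilon>_def)
  qed
  have K: "rect_g \<alpha> p q (add_mset k s) = - \<epsilon> * x ^ (N + 1) * rect_U \<alpha> p q (add_mset k s)"
  proof -
    have "sum_mset (add_mset k s) + size (add_mset k s) = N + 1" by (simp add: N_def)
    then show ?thesis unfolding rect_g_def x_def[symmetric] by (simp add: \<epsilon>_def)
  qed
  have T: "rect_g \<alpha> p q (add_mset (k + t) (s - {#t#})) = \<epsilon> * x ^ N * rect_U \<alpha> p q (add_mset (k + t) (s - {#t#}))" if t: "t \<in># s" for t
  proof -
    obtain s' where s': "s = add_mset t s'" using t by (meson mset_add)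
    have "sum_mset (add_mset (k + t) s') + size (add_mset (k + t) s') = N" by (simp add: N_def s')
    then show ?thesis unfolding rect_g_def x_def[symmetric] by (simp add: \<epsilon>_def s')
  qed
  have L: "rect_g \<alpha> p q (add_mset (k + 1) s) = - \<epsilon> * x ^ (N + 2) * rect_U \<alpha> p q (add_mset (k + 1) s)"
  proof -
    have "sum_mset (add_mset (k + 1) s) + size (add_mset (k + 1) s) = N + 2" by (simp add: N_def)
    then show ?thesis unfolding rect_g_def x_def[symmetric] by (simp add: \<epsilon>_def)
  qed
  have c: "x * (\<alpha> * real q - real p - (\<alpha> - 1) * real k) = sqrt \<alpha> * real q - real p / sqrt \<alpha> + gamma_par \<alpha> * real k"
  proof -
    have g: "gamma_par \<alpha> = x - x * \<alpha>" by (simp add: gamma_par_def x_def diff_divide_distrib)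
    have p: "real p / sqrt \<alpha> = x * real p" by (simp add: x_def)
    show ?thesis unfolding g p unfolding sq[symmetric] by (simp add: algebra_simps)
  qed
  have "rect_g \<alpha> p q (add_mset (k + 1) s) =
     \<epsilon> * x ^ (N + 2) * (\<Sum>i=1..<k. rect_U \<alpha> p q (add_mset (k - i) (add_mset i s)))
     + (x * (\<alpha> * real q - real p - (\<alpha> - 1) * real k)) * (- \<epsilon> * x ^ (N + 1) * rect_U \<alpha> p q (add_mset k s))
     + (x * x * \<alpha>) * (\<epsilon> * x ^ N * (\<Sum>t\<in>#s. real t * rect_U \<alpha> p q (add_mset (k + t) (s - {#t#}))))"
    unfolding L rect_U_rec[OF a s k] by (simp add: algebra_simps)
  moreover have "\<epsilon> * x ^ (N + 2) * (\<Sum>i=1..<k. rect_U \<alpha> p q (add_mset (k - i) (add_mset i s))) = (\<Sum>i=1..<k. rect_g \<alpha> p q (add_mset (k - i) (add_mset i s)))"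
    unfolding sum_distrib_left by (intro sum.cong refl) (simp only: I)
  moreover have "\<epsilon> * x ^ N * (\<Sum>t\<in>#s. real t * rect_U \<alpha> p q (add_mset (k + t) (s - {#t#}))) = (\<Sum>t\<in>#s. real t * rect_g \<alpha> p q (add_mset (k + t) (s - {#t#})))"
    unfolding sum_mset_distrib_left by (intro arg_cong[of _ _ sum_mset] image_mset_cong) (simp add: T)
  ultimately show ?thesis unfolding x2 c K by simp
qed

lemma z_num_add_ones: "z_num (\<pi> + replicate_mset r 1) * fact (count \<pi> 1) = z_num \<pi> * fact (count \<pi> 1 + r)"
  by (induction r) (simp_all add: z_num_add algebra_simps)

text \<open>Adjoining \<open>r\<close> ones turns the binomial times \<open>z_\<pi>\<close> into
  \<open>z_\<rho>\<close> divided by \<open>fact r\<close>; then \<open>z_\<rho>\<close> cancels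
  against the \<open>pweight\<close> in the Jack coefficient.\<close>

lemma jack_Ch_rectangle:
  assumes a: "\<alpha> > 0" and pi: "is_partition \<pi>"
  shows "jack_Ch \<alpha> \<pi> (rectangle p q) = (- 1) ^ size \<pi> * rect_g \<alpha> p q \<pi>"
proof (cases "sum_mset \<pi> \<le> p * q")
  case False
  then show ?thesis by (simp add: jack_Ch_def sum_mset_rectangle rect_g_def rect_U_def)
next
  case True
  define r where "r = p * q - sum_mset \<pi>"
  define m1 where "m1 = count \<pi> 1"
  define \<rho> where "\<rho> = \<pi> + replicate_mset r 1"
  let ?f = "jack_vector \<alpha> (rectangle p q)"
  have r: "\<rho> \<in> par (p * q)" using pi True by (auto simp: \<rho>_def par_def r_def is_partition_def split: if_splits)
  have z: "real (z_num \<rho>) > 0" using z_num_pos[of \<rho>] r by (simp add: par_def)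
  have theta: "jack_theta \<alpha> \<rho> (rectangle p q) = rect_hook \<alpha> p q * (pweight \<alpha> \<rho> * ?f \<rho>)"
    using jack_theta_eq[OF a rectangle_par r] by (simp add: rect_hook_def)
  have bin: "real ((r + m1) choose m1) * real (z_num \<pi>) = real (z_num \<rho>) / fact r"
  proof -
    have "real (z_num \<rho>) * fact m1 = real (z_num \<pi>) * fact (r + m1)"
      using arg_cong[OF z_num_add_ones[of \<pi> r], of real] by (simp add: \<rho>_def m1_def add.commute)
    moreover have "real ((r + m1) choose m1) = fact (r + m1) / (fact m1 * fact r)"
      by (simp add: binomial_fact)
    ultimately have "real (z_num \<rho>) * fact m1 = (real ((r + m1) choose m1) * real (z_num \<pi>) * fact r) * fact m1"
      by simp
    then have "real (z_num \<rho>) = real ((r + m1) choose m1) * real (z_num \<pi>) * fact r"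
      by (subst (asm) mult_right_cancel) auto
    then show ?thesis by simp
  qed
  have pw: "\<alpha> powr (- (real (sum_mset \<pi>) - real (size \<pi>)) / 2) = (1 / sqrt \<alpha>) ^ (sum_mset \<pi> + size \<pi>) * \<alpha> ^ size \<pi>"
  proof -
    have "(1 / sqrt \<alpha>) = \<alpha> powr (- 1 / 2)" using a by (simp add: powr_half_sqrt powr_minus_divide)
    then have "(1 / sqrt \<alpha>) ^ (sum_mset \<pi> + size \<pi>) = \<alpha> powr ((- 1 / 2) * real (sum_mset \<pi> + size \<pi>))"
      using a by (simp add: powr_powr flip: powr_realpow)
    moreover have "\<alpha> ^ size \<pi> = \<alpha> powr real (size \<pi>)" using a by (simp add: powr_realpow)
    ultimately show ?thesis by (simp add: powr_add[symmetric] field_simps)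
  qed
  have "jack_Ch \<alpha> \<pi> (rectangle p q) = \<alpha> powr (- (real (sum_mset \<pi>) - real (size \<pi>)) / 2) *
     (real ((r + m1) choose m1) * real (z_num \<pi>)) * (rect_hook \<alpha> p q * (pweight \<alpha> \<rho> * ?f \<rho>))"
    using True theta by (simp add: jack_Ch_def sum_mset_rectangle r_def[symmetric] m1_def \<rho>_def)
  also have "\<dots> = (1 / sqrt \<alpha>) ^ (sum_mset \<pi> + size \<pi>) * (rect_hook \<alpha> p q * ?f \<rho> / (\<alpha> ^ r * fact r))"
    unfolding pw bin using z a by (simp add: pweight_def \<rho>_def power_add field_simps)
  also have "\<dots> = (1 / sqrt \<alpha>) ^ (sum_mset \<pi> + size \<pi>) * rect_U \<alpha> p q \<pi>"
    using True by (simp add: rect_U_def r_def \<rho>_def)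
  also have "\<dots> = (- 1) ^ size \<pi> * rect_g \<alpha> p q \<pi>"
    by (simp add: rect_g_def power_mult_distrib[symmetric] mult.assoc[symmetric])
  finally show ?thesis .
qed

section \<open>Polygons of a couple of pairings\<close>

lemma partition_onI':
  "\<Union>P = A \<Longrightarrow> (\<And>p. p \<in> P \<Longrightarrow> p \<noteq> {}) \<Longrightarrow> (\<And>p q. p \<in> P \<Longrightarrow> q \<in> P \<Longrightarrow> p \<noteq> q \<Longrightarrow> disjnt p q) \<Longrightarrow> partition_on A P"
  by (rule partition_onI) auto

lemma partition_on_Un:
  assumes "partition_on A P" "partition_on A' P'" "A \<inter> A' = {}"
  shows "partition_on (A \<union> A') (P \<union> P')"
proof (rule partition_onI')
  show "\<Union>(P \<union> P') = A \<union> A'" using assms by (auto simp: partition_on_def)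
  show "p \<noteq> {}" if "p \<in> P \<union> P'" for p using assms that by (auto simp: partition_on_def)
  fix p q assume pq: "p \<in> P \<union> P'" "q \<in> P \<union> P'" "p \<noteq> q"
  have A: "p \<subseteq> A" if "p \<in> P" for p using assms(1) that by (auto simp: partition_on_def)
  have A': "p \<subseteq> A'" if "p \<in> P'" for p using assms(2) that by (auto simp: partition_on_def)
  have d: "disjoint P" "disjoint P'" using assms by (auto simp: partition_on_def)
  consider "p \<in> P" "q \<in> P" | "p \<in> P'" "q \<in> P'" | "p \<in> P" "q \<in> P'" | "p \<in> P'" "q \<in> P" using pq by auto
  then show "disjnt p q"
  proof cases
    case 1
    then show ?thesis using pairwiseD[OF d(1)] pq(3) by simp
  next
    case 2
    then show ?thesis using pairwiseD[OF d(2)] pq(3) by simp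
  next
    case 3
    then show ?thesis using A[of p] A'[of q] assms(3) unfolding disjnt_def by blast
  next
    case 4
    then show ?thesis using A[of q] A'[of p] assms(3) unfolding disjnt_def by blast
  qed
qed

lemma pairing_Union: "pairing S P \<Longrightarrow> \<Union>P = S"
  by (auto simp: pairing_def partition_on_def)

lemma pairing_card: "pairing S P \<Longrightarrow> e \<in> P \<Longrightarrow> card e = 2"
  by (simp add: pairing_def)

lemma pairing_subset: "pairing S P \<Longrightarrow> e \<in> P \<Longrightarrow> e \<subseteq> S"
  using pairing_Union by blast

lemma pairing_disjoint: "pairing S P \<Longrightarrow> e \<in> P \<Longrightarrow> e' \<in> P \<Longrightarrow> x \<in> e \<Longrightarrow> x \<in> e' \<Longrightarrow> e = e'"
  unfolding pairing_def partition_on_def disjoint_def by blast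

lemma pairing_partner:
  assumes "pairing S P" "x \<in> S"
  obtains y where "{x, y} \<in> P" "y \<noteq> x" "y \<in> S"
proof -
  obtain e where e: "e \<in> P" "x \<in> e" using assms pairing_Union by blast
  then have "card e = 2" using assms pairing_card by blast
  then obtain u v where uv: "e = {u, v}" "u \<noteq> v" by (auto simp: card_2_iff)
  have "e \<subseteq> S" using e assms pairing_subset by blast
  show thesis
  proof (cases "x = u")
    case True
    then show ?thesis using that[of v] e uv \<open>e \<subseteq> S\<close> by auto
  next
    case False
    then have "x = v" using e uv by auto
    then show ?thesis using that[of u] e uv \<open>e \<subseteq> S\<close> by (auto simp: insert_commute)
  qed
qed

lemma pairing_partner_unique:
  assumes "pairing S P" "{x, y} \<in> P" "{x, z} \<in> P"
  shows "y = z"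
  using pairing_disjoint[OF assms, of x] by (auto simp: doubleton_eq_iff)

lemma pairing_neq: "pairing S P \<Longrightarrow> {x, y} \<in> P \<Longrightarrow> x \<noteq> y"
  using pairing_card[of S P "{x, y}"] by auto

lemma finite_pairing: "finite S \<Longrightarrow> pairing S P \<Longrightarrow> finite P"
  using pairing_Union finite_UnionD by metis

section \<open>Alternating paths and cycles\<close>

fun apath :: "'a set set \<Rightarrow> 'a set set \<Rightarrow> 'a list \<Rightarrow> bool" where
  "apath P Q [] \<longleftrightarrow> True"
| "apath P Q [x] \<longleftrightarrow> True"
| "apath P Q (x # y # zs) \<longleftrightarrow> {x, y} \<in> P \<and> apath Q P (y # zs)"

lemma apath_Cons: "zs \<noteq> [] \<Longrightarrow> apath P Q (x # zs) \<longleftrightarrow> {x, hd zs} \<in> P \<and> apath Q P zs"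
  by (cases zs) auto

lemma apath_append:
  assumes "xs \<noteq> []" "ys \<noteq> []"
  shows "apath P Q (xs @ ys) \<longleftrightarrow> apath P Q xs \<and>
    (if even (length xs) then {last xs, hd ys} \<in> Q \<and> apath P Q ys else {last xs, hd ys} \<in> P \<and> apath Q P ys)"
  using assms(1)
proof (induction P Q xs rule: apath.induct)
  case (2 P Q x)
  then show ?case using assms(2) by (simp add: apath_Cons)
next
  case (3 P Q x y zs)
  then show ?case by auto
qed simp

lemma apath_rev: "apath P Q (rev xs) \<longleftrightarrow> (if even (length xs) then apath P Q xs else apath Q P xs)"
proof (induction xs arbitrary: P Q)
  case (Cons x xs)
  show ?case
  proof (cases "xs = []")
    case False
    then show ?thesis
      using apath_append[of "rev xs" "[x]" P Q] Cons.IH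
      by (auto simp: apath_Cons last_rev insert_commute)
  qed simp
qed simp

lemma apath_nth:
  "apath P Q xs \<Longrightarrow> Suc i < length xs \<Longrightarrow> {xs ! i, xs ! Suc i} \<in> (if even i then P else Q)"
proof (induction P Q xs arbitrary: i rule: apath.induct)
  case (3 P Q x y zs)
  show ?case
  proof (cases i)
    case (Suc j)
    then show ?thesis using "3.IH"[of j] "3.prems" by (auto split: if_splits)
  qed (use "3.prems" in simp)
qed auto

lemma apath_mono:
  "apath P Q xs \<Longrightarrow> (\<And>x y. x \<in> set xs \<Longrightarrow> y \<in> set xs \<Longrightarrow> {x, y} \<in> P \<Longrightarrow> {x, y} \<in> P') \<Longrightarrow>
   (\<And>x y. x \<in> set xs \<Longrightarrow> y \<in> set xs \<Longrightarrow> {x, y} \<in> Q \<Longrightarrow> {x, y} \<in> Q') \<Longrightarrow> apath P' Q' xs"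
  by (induction P Q xs arbitrary: P' Q' rule: apath.induct) auto

text \<open>A polygon as the list of its edge-sides. The first two form a pair of \<open>B\<close>,
  the closing pair is in \<open>W\<close>, so the parity of the position tells which pairing comes
  next. A pair common to \<open>B\<close> and \<open>W\<close> is a cycle of length 2.\<close>

definition cyc :: "'a set set \<Rightarrow> 'a set set \<Rightarrow> 'a list \<Rightarrow> bool" where
  "cyc B W xs \<longleftrightarrow> xs \<noteq> [] \<and> even (length xs) \<and> distinct xs \<and> apath B W xs \<and> {last xs, hd xs} \<in> W"

lemma cyc_nth:
  assumes "cyc B W xs" "i < length xs"
  shows "{xs ! i, xs ! (Suc i mod length xs)} \<in> (if even i then B else W)"
proof (cases "Suc i < length xs")
  case True
  then show ?thesis using assms apath_nth[of B W xs i] by (simp add: cyc_def)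
next
  case False
  then have l: "length xs = Suc i" using assms by simp
  have "odd i" using assms(1) l by (simp add: cyc_def)
  moreover have "xs ! i = last xs" "xs ! (Suc i mod length xs) = hd xs"
    using assms l by (auto simp: cyc_def last_conv_nth hd_conv_nth)
  ultimately show ?thesis using assms by (simp add: cyc_def)
qed

lemma cyc_partner_B:
  assumes "cyc B W xs" "i < length xs"
  obtains j where "j < length xs" "{xs ! i, xs ! j} \<in> B" "odd (i + j)"
proof (cases "even i")
  case True
  then have "Suc i < length xs" using assms by (metis Suc_lessI cyc_def even_Suc)
  then show ?thesis using that[of "Suc i"] cyc_nth[OF assms] True by simp
next
  case False
  then obtain j where j: "i = Suc j" by (cases i) auto
  then show ?thesis using that[of j] cyc_nth[OF assms(1), of j] False assms by (simp add: insert_commute)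
qed

lemma cyc_partner_W:
  assumes "cyc B W xs" "i < length xs"
  obtains j where "j < length xs" "{xs ! i, xs ! j} \<in> W" "odd (i + j)"
proof (cases "even i")
  case False
  have "Suc i mod length xs < length xs" using assms by (metis mod_less_divisor length_greater_0_conv cyc_def)
  moreover have "odd (i + Suc i mod length xs)"
    using assms False by (metis cyc_def dvd_mod_iff even_Suc even_add)
  ultimately show ?thesis using that[of "Suc i mod length xs"] cyc_nth[OF assms] False by simp
next
  case True
  show ?thesis
  proof (cases i)
    case 0
    have l: "length xs > 0" "even (length xs)" using assms by (auto simp: cyc_def)
    then have "odd (length xs - 1)" by simp
    then show ?thesis
      using that[of "length xs - 1"] cyc_nth[OF assms(1), of "length xs - 1"] l 0 by (simp add: insert_commute)
  next
    case (Suc j)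
    then show ?thesis using that[of j] cyc_nth[OF assms(1), of j] True assms by (simp add: insert_commute)
  qed
qed

text \<open>A cycle already contains the \<open>B\<close> and the \<open>W\<close> partner of each
  of its elements, at positions of the other parity; partners are unique, so adjacency cannot leave
  the cycle.\<close>

lemma cyc_adjacent:
  assumes B: "pairing S B" and W: "pairing S W" and c: "cyc B W xs" and i: "i < length xs"
    and adj: "adjacent B W (xs ! i) t" and ne: "t \<noteq> xs ! i"
  obtains j where "j < length xs" "t = xs ! j" "odd (i + j)"
proof -
  obtain e where e: "e \<in> B \<union> W" "xs ! i \<in> e" "t \<in> e" using adj by (auto simp: adjacent_def)
  then have "card e = 2" using B W pairing_card by blast
  then have "e = {xs ! i, t}" using e ne by (auto simp: card_2_iff)
  then consider "{xs ! i, t} \<in> B" | "{xs ! i, t} \<in> W" using e by auto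
  then show thesis
  proof cases
    case 1
    obtain j where j: "j < length xs" "{xs ! i, xs ! j} \<in> B" "odd (i + j)" by (rule cyc_partner_B[OF c i])
    then show ?thesis using that[of j] pairing_partner_unique[OF B 1 j(2)] by blast
  next
    case 2
    obtain j where j: "j < length xs" "{xs ! i, xs ! j} \<in> W" "odd (i + j)" by (rule cyc_partner_W[OF c i])
    then show ?thesis using that[of j] pairing_partner_unique[OF W 2 j(2)] by blast
  qed
qed

lemma adjacent_sym: "adjacent B W s t \<Longrightarrow> adjacent B W t s"
  by (auto simp: adjacent_def)

lemma cyc_class:
  assumes B: "pairing S B" and W: "pairing S W" and c: "cyc B W xs" and s: "s \<in> set xs"
  shows "{(s, t). adjacent B W s t}\<^sup>+ `` {s} = set xs"
proof -
  let ?R = "{(s, t). adjacent B W s t}"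
  have "t \<in> set xs" if "(s, t) \<in> ?R\<^sup>+" for t
    using that
  proof (induction rule: trancl_induct)
    case (base y)
    then show ?case using s cyc_adjacent[OF B W c] by (metis in_set_conv_nth mem_Collect_eq case_prod_conv)
  next
    case (step y z)
    then show ?case using cyc_adjacent[OF B W c] by (metis in_set_conv_nth mem_Collect_eq case_prod_conv)
  qed
  moreover have sym: "sym (?R\<^sup>+)" by (rule sym_trancl) (auto simp: sym_def intro: adjacent_sym)
  have reach: "(xs ! 0, xs ! i) \<in> ?R\<^sup>+" if "i < length xs" for i
    using that
  proof (induction i)
    case 0
    \<comment> \<open>\<open>adjacent\<close> relates each element of the ground set to itself, so
      the transitive closure contains the starting point.\<close>
    have "{xs ! 0, xs ! (Suc 0 mod length xs)} \<in> B" using cyc_nth[OF c 0] by simp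
    then have "(xs ! 0, xs ! 0) \<in> ?R" by (auto simp: adjacent_def)
    then show ?case by blast
  next
    case (Suc i)
    have "{xs ! i, xs ! Suc i} \<in> (if even i then B else W)" using cyc_nth[OF c, of i] Suc.prems by simp
    then have "(xs ! i, xs ! Suc i) \<in> ?R" by (auto simp: adjacent_def split: if_splits)
    then show ?case using Suc by (meson Suc_lessD trancl.trancl_into_trancl)
  qed
  have "(s, t) \<in> ?R\<^sup>+" if "t \<in> set xs" for t
  proof -
    have "(xs ! 0, s) \<in> ?R\<^sup>+" "(xs ! 0, t) \<in> ?R\<^sup>+" using reach s that by (auto simp: in_set_conv_nth)
    then show ?thesis using sym by (meson symE trancl_trans)
  qed
  ultimately show ?thesis by blast
qed

lemma cyc_class':
  assumes B: "pairing S B" and W: "pairing S W" and c: "cyc B W xs \<or> cyc W B xs" and s: "s \<in> set xs"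
  shows "{(s, t). adjacent B W s t}\<^sup>+ `` {s} = set xs"
proof -
  have "adjacent W B = adjacent B W" by (auto simp: adjacent_def fun_eq_iff)
  then show ?thesis using cyc_class[OF B W _ s] cyc_class[OF W B _ s] c by auto
qed

lemma polygons_eqI:
  assumes B: "pairing S B" and W: "pairing S W" and P: "partition_on S \<P>"
    and c: "\<And>C. C \<in> \<P> \<Longrightarrow> \<exists>xs. (cyc B W xs \<or> cyc W B xs) \<and> set xs = C"
  shows "polygons B W = \<P>"
proof -
  let ?R = "{(s, t). adjacent B W s t}\<^sup>+"
  have cl: "?R `` {s} = C" if "C \<in> \<P>" "s \<in> C" for s C
    using c[OF that(1)] cyc_class'[OF B W] that(2) by blast
  have "polygons B W = (\<lambda>s. ?R `` {s}) ` S"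
    unfolding polygons_def quotient_def pairing_Union[OF B] by auto
  also have "\<dots> = \<P>"
  proof
    show "(\<lambda>s. ?R `` {s}) ` S \<subseteq> \<P>"
    proof
      fix C assume "C \<in> (\<lambda>s. ?R `` {s}) ` S"
      then obtain s where s: "s \<in> S" "C = ?R `` {s}" by auto
      then obtain D where "D \<in> \<P>" "s \<in> D" using P by (auto simp: partition_on_def)
      then show "C \<in> \<P>" using cl s by simp
    qed
    show "\<P> \<subseteq> (\<lambda>s. ?R `` {s}) ` S"
    proof
      fix C assume C: "C \<in> \<P>"
      then have "C \<noteq> {}" using P by (auto simp: partition_on_def)
      then obtain s where s: "s \<in> C" by auto
      then have "s \<in> S" using P C by (auto simp: partition_on_def)
      then show "C \<in> (\<lambda>s. ?R `` {s}) ` S" using cl[OF C s] by auto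
    qed
  qed
  finally show ?thesis .
qed

text \<open>A longest alternating path can only be continued by closing it up.\<close>

lemma cyc_exists:
  assumes fin: "finite S" and B: "pairing S B" and W: "pairing S W" and s: "s \<in> S"
  obtains xs where "cyc B W xs" "hd xs = s" "set xs \<subseteq> S"
proof -
  define good where "good xs \<longleftrightarrow> xs \<noteq> [] \<and> distinct xs \<and> hd xs = s \<and> set xs \<subseteq> S \<and> apath B W xs" for xs
  have "good [s]" using s by (simp add: good_def)
  moreover have bound: "length xs < Suc (card S)" if "good xs" for xs
    using that fin by (metis card_mono distinct_card good_def less_Suc_eq_le)
  ultimately obtain xs where xs: "good xs" and max: "\<And>ys. good ys \<Longrightarrow> length ys \<le> length xs"
    using ex_has_greatest_nat[of good "[s]" length "Suc (card S)"] by blast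
  define l where "l = length xs"
  have l: "l > 0" using xs by (simp add: good_def l_def)
  have nth: "{xs ! i, xs ! Suc i} \<in> (if even i then B else W)" if "Suc i < l" for i
    using apath_nth[of B W xs i] xs that by (simp add: good_def l_def)
  have last: "last xs = xs ! (l - 1)" using xs by (simp add: good_def l_def last_conv_nth)
  have lastS: "last xs \<in> S" using xs by (metis good_def last_in_set subsetD)
  have dist: "i = j" if "xs ! i = xs ! j" "i < l" "j < l" for i j
    using xs that by (simp add: good_def l_def nth_eq_iff_index_eq)
  have ext: "y \<in> set xs" if "{last xs, y} \<in> (if odd l then B else W)" "y \<in> S" for y
  proof (rule ccontr)
    assume y: "y \<notin> set xs"
    have "apath B W (xs @ [y])"
      using apath_append[of xs "[y]" B W] xs that by (auto simp: good_def l_def split: if_splits)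
    then have "good (xs @ [y])" using xs y that by (auto simp: good_def)
    then show False using max[of "xs @ [y]"] by simp
  qed
  have even: "even l"
  proof (rule ccontr)
    assume odd: "odd l"
    obtain y where y: "{last xs, y} \<in> B" "y \<noteq> last xs" "y \<in> S" by (rule pairing_partner[OF B lastS])
    then have "y \<in> set xs" using ext odd by simp
    then obtain j where j: "j < l" "y = xs ! j" by (auto simp: in_set_conv_nth l_def)
    have j1: "j < l - 1" using j y last l by (cases "j = l - 1") auto
    \<comment> \<open>The path already contains the \<open>B\<close> partner of position
      \<open>j\<close>, at \<open>j'\<close>; uniqueness would make it the last element.\<close>
    define j' where "j' = (if even j then Suc j else j - 1)"
    have j': "j' < l - 1 \<and> {xs ! j, xs ! j'} \<in> B"
    proof (cases "even j")
      case True
      then have "Suc j \<noteq> l - 1" using odd l by (metis Suc_pred' even_Suc)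
      then show ?thesis using nth[of j] True j1 by (auto simp: j'_def)
    next
      case False
      then obtain i where "j = Suc i" by (cases j) auto
      then show ?thesis using nth[of i] False j1 by (auto simp: j'_def insert_commute)
    qed
    have "{xs ! j, last xs} \<in> B" using y j by (simp add: insert_commute)
    then have "xs ! j' = last xs" using pairing_partner_unique[OF B, of "xs ! j" "xs ! j'" "last xs"] j' by simp
    then show False using dist[of j' "l - 1"] j' last l by auto
  qed
  obtain y where y: "{last xs, y} \<in> W" "y \<noteq> last xs" "y \<in> S" by (rule pairing_partner[OF W lastS])
  then have "y \<in> set xs" using ext even by simp
  then obtain j where j: "j < l" "y = xs ! j" by (auto simp: in_set_conv_nth l_def)
  have j1: "j < l - 1" using j y last l by (cases "j = l - 1") auto
  have "j = 0"
  proof (rule ccontr)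
    assume j0: "j \<noteq> 0"
    define j' where "j' = (if odd j then Suc j else j - 1)"
    have j': "j' < l - 1 \<and> {xs ! j, xs ! j'} \<in> W"
    proof (cases "even j")
      case False
      then have "Suc j \<noteq> l - 1" using even l by (metis Suc_pred' even_Suc)
      then show ?thesis using nth[of j] False j1 by (auto simp: j'_def)
    next
      case True
      then obtain i where "j = Suc i" using j0 by (cases j) auto
      then show ?thesis using nth[of i] True j1 by (auto simp: j'_def insert_commute)
    qed
    have "{xs ! j, last xs} \<in> W" using y j by (simp add: insert_commute)
    then have "xs ! j' = last xs" using pairing_partner_unique[OF W, of "xs ! j" "xs ! j'" "last xs"] j' by simp
    then show False using dist[of j' "l - 1"] j' last l by auto
  qed
  then have "y = hd xs" using j xs by (metis good_def hd_conv_nth)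
  then have "cyc B W xs" using xs even y by (simp add: cyc_def good_def l_def)
  then show thesis using that xs by (simp add: good_def)
qed

lemma polygon_cyc:
  assumes fin: "finite S" and B: "pairing S B" and W: "pairing S W" and C: "C \<in> polygons B W" and s: "s \<in> C"
  obtains xs where "cyc B W xs" "hd xs = s" "set xs = C"
proof -
  let ?R = "{(s, t). adjacent B W s t}\<^sup>+"
  obtain u where u: "u \<in> S" "C = ?R `` {u}"
    using C unfolding polygons_def quotient_def pairing_Union[OF B] by auto
  obtain us where us: "cyc B W us" "hd us = u" "set us \<subseteq> S" by (rule cyc_exists[OF fin B W u(1)])
  have "u \<in> set us" using us by (metis cyc_def hd_in_set)
  then have Cus: "C = set us" using cyc_class[OF B W us(1)] u by simp
  then have sS: "s \<in> S" using s us by auto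
  obtain xs where xs: "cyc B W xs" "hd xs = s" "set xs \<subseteq> S" by (rule cyc_exists[OF fin B W sS])
  have "s \<in> set xs" using xs by (metis cyc_def hd_in_set)
  then have "set xs = ?R `` {s}" using cyc_class[OF B W xs(1)] by simp
  also have "\<dots> = C" using cyc_class[OF B W us(1)] s Cus by simp
  finally show thesis using that xs by blast
qed

lemma polygons_partition:
  assumes fin: "finite S" and B: "pairing S B" and W: "pairing S W"
  shows "partition_on S (polygons B W)"
proof -
  let ?R = "{(s, t). adjacent B W s t}\<^sup>+"
  have cl: "s \<in> ?R `` {s} \<and> ?R `` {s} \<subseteq> S \<and> (\<forall>t\<in>?R `` {s}. ?R `` {t} = ?R `` {s})" if sS: "s \<in> S" for s
  proof -
    obtain xs where xs: "cyc B W xs" "hd xs = s" "set xs \<subseteq> S" by (rule cyc_exists[OF fin B W sS])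
    have "s \<in> set xs" using xs by (metis cyc_def hd_in_set)
    then show ?thesis using cyc_class[OF B W xs(1)] xs by auto
  qed
  have P: "polygons B W = (\<lambda>s. ?R `` {s}) ` S"
    unfolding polygons_def quotient_def pairing_Union[OF B] by auto
  show ?thesis
    unfolding P
  proof (rule partition_onI')
    show "\<Union>((\<lambda>s. ?R `` {s}) ` S) = S" using cl by blast
    show "p \<noteq> {}" if "p \<in> (\<lambda>s. ?R `` {s}) ` S" for p using that cl by blast
    show "disjnt p p'" if pp: "p \<in> (\<lambda>s. ?R `` {s}) ` S" "p' \<in> (\<lambda>s. ?R `` {s}) ` S" "p \<noteq> p'" for p p'
    proof (rule ccontr)
      assume "\<not> disjnt p p'"
      then obtain t where t: "t \<in> p" "t \<in> p'" by (auto simp: disjnt_def)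
      obtain u u' where "u \<in> S" "p = ?R `` {u}" "u' \<in> S" "p' = ?R `` {u'}" using pp(1,2) by blast
      then show False using cl[of u] cl[of u'] t pp(3) by metis
    qed
  qed
qed

lemma polygons_even:
  assumes fin: "finite S" and B: "pairing S B" and W: "pairing S W" and C: "C \<in> polygons B W"
  shows "finite C" "even (card C)" "card C \<ge> 2"
proof -
  have "C \<noteq> {}" using polygons_partition[OF fin B W] C by (auto simp: partition_on_def)
  then obtain s where "s \<in> C" by auto
  then obtain xs where xs: "cyc B W xs" "set xs = C" by (rule polygon_cyc[OF fin B W C])
  then have "card C = length xs" by (metis cyc_def distinct_card)
  moreover have "length xs \<noteq> 0" "even (length xs)" using xs by (auto simp: cyc_def)
  moreover have "length xs \<noteq> 1" using xs by (auto simp: cyc_def)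
  ultimately show "card C \<ge> 2" by linarith
  show "even (card C)" using \<open>card C = length xs\<close> \<open>even (length xs)\<close> by simp
  show "finite C" using xs by auto
qed

section \<open>Removal of an edge from pairings and cycles\<close>

lemma pairing_remove_keep: "z \<in> P \<Longrightarrow> z \<inter> e = {} \<Longrightarrow> e \<noteq> {} \<Longrightarrow> z \<in> pairing_remove e P"
  by (auto simp: pairing_remove_def)

lemma pairing_remove_join:
  assumes P: "pairing S P" and xy: "x \<noteq> y" and x': "{x, x'} \<in> P" and y': "{y, y'} \<in> P" and n: "{x, y} \<notin> P"
  shows "pairing_remove {x, y} P = {z \<in> P. z \<inter> {x, y} = {}} \<union> {{x', y'}}"
    and "x' \<noteq> y'" "x' \<notin> {x, y}" "y' \<notin> {x, y}"
proof -
  have ne: "x \<noteq> x'" "y \<noteq> y'" using x' y' pairing_neq[OF P] by metis+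
  show "x' \<noteq> y'"
  proof
    assume e: "x' = y'"
    then have "{x, x'} = {y, y'}" using pairing_disjoint[OF P x' y', of x'] by blast
    then show False using e ne xy by (auto simp: doubleton_eq_iff)
  qed
  show x'n: "x' \<notin> {x, y}" using ne n x' by auto
  show y'n: "y' \<notin> {x, y}" using ne n y' by (auto simp: insert_commute)
  have "{z \<in> P. z \<inter> {x, y} \<noteq> {}} = {{x, x'}, {y, y'}}"
  proof
    show "{z \<in> P. z \<inter> {x, y} \<noteq> {}} \<subseteq> {{x, x'}, {y, y'}}"
    proof
      fix z assume "z \<in> {z \<in> P. z \<inter> {x, y} \<noteq> {}}"
      then have z: "z \<in> P" "x \<in> z \<or> y \<in> z" by auto
      then show "z \<in> {{x, x'}, {y, y'}}"
        using pairing_disjoint[OF P z(1) x', of x] pairing_disjoint[OF P z(1) y', of y] by blast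
    qed
  qed (use x' y' in auto)
  then have "\<Union>{z \<in> P. z \<inter> {x, y} \<noteq> {}} - {x, y} = {x', y'}" using x'n y'n by auto
  then show "pairing_remove {x, y} P = {z \<in> P. z \<inter> {x, y} = {}} \<union> {{x', y'}}"
    using n unfolding pairing_remove_def by simp
qed

lemma pairing_pairing_remove:
  assumes P: "pairing S P" and e: "e \<subseteq> S" "card e = 2"
  shows "pairing (S - e) (pairing_remove e P)"
proof (cases "e \<in> P")
  case True
  have d: "z \<inter> e = {}" if "z \<in> P" "z \<noteq> e" for z
    using pairing_disjoint[OF P that(1) True] that(2) by blast
  have "partition_on (S - e) (P - {e})"
  proof (rule partition_onI')
    show "\<Union>(P - {e}) = S - e" using d pairing_Union[OF P] by blast
    show "p \<noteq> {}" if "p \<in> P - {e}" for p using that pairing_card[OF P, of p] by auto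
    show "disjnt p p'" if "p \<in> P - {e}" "p' \<in> P - {e}" "p \<noteq> p'" for p p'
      using that pairing_disjoint[OF P, of p p'] by (auto simp: disjnt_def)
  qed
  then show ?thesis using True P by (simp add: pairing_remove_def pairing_def)
next
  case False
  obtain x y where xy: "e = {x, y}" "x \<noteq> y" using e by (auto simp: card_2_iff)
  obtain x' where x': "{x, x'} \<in> P" "x' \<noteq> x" "x' \<in> S" using pairing_partner[OF P, of x] e xy by auto
  obtain y' where y': "{y, y'} \<in> P" "y' \<noteq> y" "y' \<in> S" using pairing_partner[OF P, of y] e xy by auto
  note J = pairing_remove_join[OF P xy(2) x'(1) y'(1) False[unfolded xy]]
  let ?K = "{z \<in> P. z \<inter> {x, y} = {}}"
  have out: "z \<in> ?K \<or> z = {x, x'} \<or> z = {y, y'}" if "z \<in> P" for z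
    using that pairing_disjoint[OF P that x'(1), of x] pairing_disjoint[OF P that y'(1), of y] by auto
  have K: "z \<inter> {x', y'} = {}" if "z \<in> ?K" for z
    using that pairing_disjoint[OF P _ x'(1), of z x'] pairing_disjoint[OF P _ y'(1), of z y'] by auto
  have "partition_on (S - e) (?K \<union> {{x', y'}})"
  proof (rule partition_onI')
    have "\<Union>(?K \<union> {{x', y'}}) \<subseteq> S - e" using pairing_Union[OF P] x' y' J xy by blast
    moreover have "S - e \<subseteq> \<Union>(?K \<union> {{x', y'}})"
    proof
      fix s assume s: "s \<in> S - e"
      then obtain z where "z \<in> P" "s \<in> z" using pairing_Union[OF P] by blast
      then show "s \<in> \<Union>(?K \<union> {{x', y'}})" using out[of z] s xy by blast
    qed
    ultimately show "\<Union>(?K \<union> {{x', y'}}) = S - e" by blast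
    show "p \<noteq> {}" if "p \<in> ?K \<union> {{x', y'}}" for p using that pairing_card[OF P, of p] by auto
    show "disjnt p p'" if "p \<in> ?K \<union> {{x', y'}}" "p' \<in> ?K \<union> {{x', y'}}" "p \<noteq> p'" for p p'
      using that pairing_disjoint[OF P, of p p'] K[of p] K[of p'] unfolding disjnt_def by blast
  qed
  moreover have "card p = 2" if "p \<in> ?K \<union> {{x', y'}}" for p
    using that pairing_card[OF P, of p] J(2) by auto
  ultimately show ?thesis unfolding pairing_def xy(1) J(1) by blast
qed

lemma pairing_remove_joinI:
  assumes P: "pairing S P" and xy: "x \<noteq> y" and "{x, x'} \<in> P" "{y, y'} \<in> P" "{x, y} \<notin> P"
  shows "{x', y'} \<in> pairing_remove {x, y} P"
  using pairing_remove_join(1)[OF assms] by simp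

lemma apath_remove:
  assumes "apath B W xs" "set xs \<inter> e = {}" "e \<noteq> {}"
  shows "apath (pairing_remove e B) (pairing_remove e W) xs"
proof (rule apath_mono[OF assms(1)])
  show "{x, y} \<in> pairing_remove e B" if "x \<in> set xs" "y \<in> set xs" "{x, y} \<in> B" for x y
    using that assms by (intro pairing_remove_keep) auto
  show "{x, y} \<in> pairing_remove e W" if "x \<in> set xs" "y \<in> set xs" "{x, y} \<in> W" for x y
    using that assms by (intro pairing_remove_keep) auto
qed

lemma cyc_remove:
  assumes "cyc B W xs" "set xs \<inter> e = {}" "e \<noteq> {}"
  shows "cyc (pairing_remove e B) (pairing_remove e W) xs"
proof -
  have "last xs \<in> set xs" "hd xs \<in> set xs" using assms by (auto simp: cyc_def)
  then have "{last xs, hd xs} \<inter> e = {}" using assms(2) by blast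
  then have "{last xs, hd xs} \<in> pairing_remove e W"
    using assms by (intro pairing_remove_keep) (auto simp: cyc_def)
  then show ?thesis using assms apath_remove[of B W xs e] by (simp add: cyc_def)
qed

text \<open>Polygons disjoint from \<open>e\<close> keep all their pairs, so only the arcs of the
  polygons meeting \<open>e\<close> have to be reassembled.\<close>

lemma polygons_remove:
  assumes fin: "finite S" and B: "pairing S B" and W: "pairing S W" and e: "e \<subseteq> S" "card e = 2"
    and N: "partition_on (\<Union>{C \<in> polygons B W. C \<inter> e \<noteq> {}} - e) \<N>"
    and c: "\<And>C. C \<in> \<N> \<Longrightarrow> \<exists>xs. (cyc (pairing_remove e B) (pairing_remove e W) xs \<or> cyc (pairing_remove e W) (pairing_remove e B) xs) \<and> set xs = C"
  shows "polygons (pairing_remove e B) (pairing_remove e W) = {C \<in> polygons B W. C \<inter> e = {}} \<union> \<N>"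
proof (rule polygons_eqI[OF pairing_pairing_remove[OF B e] pairing_pairing_remove[OF W e]])
  note part = polygons_partition[OF fin B W]
  let ?K = "{C \<in> polygons B W. C \<inter> e = {}}" and ?D = "{C \<in> polygons B W. C \<inter> e \<noteq> {}}"
  have U: "\<Union>(polygons B W) = S" using part by (simp add: partition_on_def)
  have dis: "C \<inter> D = {}" if "C \<in> polygons B W" "D \<in> polygons B W" "C \<noteq> D" for C D
    using part that by (auto simp: partition_on_def disjoint_def)
  have KD: "\<Union>?K \<inter> \<Union>?D = {}" using dis by blast
  have "partition_on (\<Union>?K) ?K"
  proof (rule partition_onI')
    show "p \<noteq> {}" if "p \<in> ?K" for p using that part by (auto simp: partition_on_def)
    show "disjnt p p'" if "p \<in> ?K" "p' \<in> ?K" "p \<noteq> p'" for p p' using that dis by (auto simp: disjnt_def)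
  qed simp
  moreover have "\<Union>?K \<inter> (\<Union>?D - e) = {}" using KD by blast
  ultimately have "partition_on (\<Union>?K \<union> (\<Union>?D - e)) (?K \<union> \<N>)"
    using N by (intro partition_on_Un)
  moreover have "\<Union>?K \<union> (\<Union>?D - e) = S - e" using U by blast
  ultimately show "partition_on (S - e) (?K \<union> \<N>)" by simp
  fix C assume "C \<in> ?K \<union> \<N>"
  then show "\<exists>xs. (cyc (pairing_remove e B) (pairing_remove e W) xs \<or> cyc (pairing_remove e W) (pairing_remove e B) xs) \<and> set xs = C"
  proof
    assume C: "C \<in> ?K"
    then have "C \<noteq> {}" using part by (auto simp: partition_on_def)
    then obtain s where s: "s \<in> C" by auto
    have CP: "C \<in> polygons B W" "C \<inter> e = {}" using C by auto
    obtain xs where xs: "cyc B W xs" "set xs = C" by (rule polygon_cyc[OF fin B W CP(1) s])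
    have "e \<noteq> {}" using e by auto
    then have "cyc (pairing_remove e B) (pairing_remove e W) xs" using xs CP by (intro cyc_remove) auto
    then show ?thesis using xs by blast
  qed (rule c)
qed

lemma cyc_Cons_facts:
  assumes "cyc B W (x # X)"
  shows "X \<noteq> []" "odd (length X)" "distinct X" "x \<notin> set X" "{x, hd X} \<in> B" "apath W B X" "{x, last X} \<in> W"
proof -
  show X: "X \<noteq> []" "odd (length X)" using assms by (auto simp: cyc_def)
  show "distinct X" "x \<notin> set X" using assms by (auto simp: cyc_def)
  show "{x, hd X} \<in> B" "apath W B X" "{x, last X} \<in> W"
    using assms X by (auto simp: cyc_def apath_Cons insert_commute)
qed

text \<open>The parity of \<open>P\<close> decides which pairing joins \<open>y\<close> to which
  arc; this is the combinatorial content of straight and twisted edges.\<close>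

lemma cyc_split_facts:
  assumes c: "cyc B W (x # P @ y # Q)"
  shows "P \<noteq> [] \<Longrightarrow> {x, hd P} \<in> B" "P = [] \<Longrightarrow> {x, y} \<in> B" "Q \<noteq> [] \<Longrightarrow> {x, last Q} \<in> W" "Q = [] \<Longrightarrow> {x, y} \<in> W"
    "apath W B P"
    "P \<noteq> [] \<Longrightarrow> {y, last P} \<in> (if even (length P) then B else W)"
    "Q \<noteq> [] \<Longrightarrow> {y, hd Q} \<in> (if even (length P) then W else B)"
    "apath (if even (length P) then B else W) (if even (length P) then W else B) Q"
    "even (length P) = even (length Q)"
    "distinct P" "distinct Q" "set P \<inter> set Q = {}" "x \<notin> set P" "x \<notin> set Q" "y \<notin> set P" "y \<notin> set Q" "x \<noteq> y"
proof -
  note F = cyc_Cons_facts[OF c]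
  show "even (length P) = even (length Q)" using F(2) by simp
  show "distinct P" "distinct Q" "set P \<inter> set Q = {}" "x \<notin> set P" "x \<notin> set Q" "y \<notin> set P" "y \<notin> set Q" "x \<noteq> y"
    using F(3,4) by auto
  show "P \<noteq> [] \<Longrightarrow> {x, hd P} \<in> B" "P = [] \<Longrightarrow> {x, y} \<in> B" "Q \<noteq> [] \<Longrightarrow> {x, last Q} \<in> W" "Q = [] \<Longrightarrow> {x, y} \<in> W"
    using F(5,7) by (auto simp: hd_append)
  have "apath W B (P @ y # Q)" using F(6) .
  then show "apath W B P" "P \<noteq> [] \<Longrightarrow> {y, last P} \<in> (if even (length P) then B else W)"
    "Q \<noteq> [] \<Longrightarrow> {y, hd Q} \<in> (if even (length P) then W else B)"
    "apath (if even (length P) then B else W) (if even (length P) then W else B) Q"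
    using apath_append[of P "y # Q" W B] by (cases "P = []"; cases "Q = []"; auto simp: apath_Cons insert_commute split: if_splits)+
qed

text \<open>For even \<open>P\<close>, both ends of \<open>P\<close> are joined by \<open>B\<close>
  to \<open>x\<close> and \<open>y\<close>, hence to each other after the removal; the ends of
  \<open>Q\<close> are joined through \<open>W\<close> in the same way. The face splits.\<close>

lemma cyc_remove_straight:
  assumes B: "pairing S B" and W: "pairing S W" and c: "cyc B W (x # P @ y # Q)" and ev: "even (length P)"
  shows "P \<noteq> [] \<Longrightarrow> cyc (pairing_remove {x, y} W) (pairing_remove {x, y} B) P"
    and "Q \<noteq> [] \<Longrightarrow> cyc (pairing_remove {x, y} B) (pairing_remove {x, y} W) Q"
proof -
  note F = cyc_split_facts[OF c]
  assume P: "P \<noteq> []"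
  have "hd P \<noteq> y" using F P by (metis hd_in_set)
  then have "{x, y} \<notin> B" using pairing_partner_unique[OF B F(1)[OF P]] by blast
  then have "{hd P, last P} \<in> pairing_remove {x, y} B"
    using F P ev by (intro pairing_remove_joinI[OF B]) auto
  moreover have "apath (pairing_remove {x, y} W) (pairing_remove {x, y} B) P"
    using F by (intro apath_remove) auto
  ultimately show "cyc (pairing_remove {x, y} W) (pairing_remove {x, y} B) P"
    using F P ev by (simp add: cyc_def insert_commute)
next
  note F = cyc_split_facts[OF c]
  assume Q: "Q \<noteq> []"
  have "last Q \<noteq> y" using F Q by (metis last_in_set)
  then have "{x, y} \<notin> W" using pairing_partner_unique[OF W F(3)[OF Q]] by blast
  then have "{last Q, hd Q} \<in> pairing_remove {x, y} W"
    using F Q ev by (intro pairing_remove_joinI[OF W]) auto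
  moreover have "apath (pairing_remove {x, y} B) (pairing_remove {x, y} W) Q"
    using F ev by (intro apath_remove) auto
  ultimately show "cyc (pairing_remove {x, y} B) (pairing_remove {x, y} W) Q"
    using F Q ev by (simp add: cyc_def)
qed

text \<open>The new pairs join the two heads and the two last elements, so \<open>P\<close> followed
  by \<open>Q\<close> reversed is one cycle. The alternatives in the last assumption are an
  interface edge, with \<open>P\<close> and \<open>Q\<close> from two faces, and a twisted edge,
  with two arcs of one face.\<close>

lemma cyc_remove_merge:
  assumes B: "pairing S B" and W: "pairing S W" and xy: "x \<noteq> y" and nB: "{x, y} \<notin> B" and nW: "{x, y} \<notin> W"
    and P: "apath W B P" "odd (length P)" "{x, hd P} \<in> B" and Q: "apath W B Q" "odd (length Q)" "{y, hd Q} \<in> B"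
    and d: "distinct (P @ Q)" "x \<notin> set (P @ Q)" "y \<notin> set (P @ Q)"
    and l: "{x, last P} \<in> W \<and> {y, last Q} \<in> W \<or> {x, last Q} \<in> W \<and> {y, last P} \<in> W"
  shows "cyc (pairing_remove {x, y} W) (pairing_remove {x, y} B) (P @ rev Q)"
proof -
  let ?B = "pairing_remove {x, y} B" and ?W = "pairing_remove {x, y} W"
  have ne: "P \<noteq> []" "Q \<noteq> []" using P Q by auto
  have "{last P, last Q} \<in> ?W"
    using l
  proof
    assume "{x, last P} \<in> W \<and> {y, last Q} \<in> W"
    then show ?thesis using nW by (intro pairing_remove_joinI[OF W xy]) auto
  next
    assume "{x, last Q} \<in> W \<and> {y, last P} \<in> W"
    then have "{last Q, last P} \<in> ?W" using nW by (intro pairing_remove_joinI[OF W xy]) auto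
    then show ?thesis by (simp add: insert_commute)
  qed
  moreover have "{hd Q, hd P} \<in> ?B"
    using pairing_remove_joinI[OF B xy P(3) Q(3) nB] by (simp add: insert_commute)
  moreover have "apath ?W ?B P" "apath ?W ?B Q" using P Q d by (auto intro!: apath_remove)
  ultimately show ?thesis
    using ne P Q d by (simp add: cyc_def apath_append apath_rev hd_rev last_rev)
qed

section \<open>Removal of an edge\<close>

lemma couple_type_split:
  assumes "finite K" "finite L" "K \<inter> L = {}" "polygons B W = K \<union> L"
  shows "couple_type B W = image_mset (\<lambda>C. card C div 2) (mset_set K) + image_mset (\<lambda>C. card C div 2) (mset_set L)"
  unfolding couple_type_def assms(4) using mset_set_Union[OF assms(1-3)] by simp

lemma finite_polygons:
  assumes "finite S" "pairing S B" "pairing S W"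
  shows "finite (polygons B W)"
  using finite_elements[OF assms(1) polygons_partition[OF assms]] .

lemma polygons_disjoint:
  assumes "finite S" "pairing S B" "pairing S W" "C \<in> polygons B W" "D \<in> polygons B W" "x \<in> C" "x \<in> D"
  shows "C = D"
  using pairwiseD[OF partition_onD2[OF polygons_partition[OF assms(1-3)]] assms(4,5)] assms(6,7)
  by (auto simp: disjnt_def)

lemma polygons_meeting:
  assumes "finite S" "pairing S B" "pairing S W" "C \<in> polygons B W" "e \<subseteq> C" "e \<noteq> {}"
  shows "{D \<in> polygons B W. D \<inter> e \<noteq> {}} = {C}"
proof
  show "{D \<in> polygons B W. D \<inter> e \<noteq> {}} \<subseteq> {C}"
  proof
    fix D assume "D \<in> {D \<in> polygons B W. D \<inter> e \<noteq> {}}"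
    then obtain z where z: "D \<in> polygons B W" "z \<in> D" "z \<in> e" by blast
    then have "D = C" using polygons_disjoint[OF assms(1-3) z(1) assms(4) z(2)] assms(5) by blast
    then show "D \<in> {C}" by simp
  qed
qed (use assms in blast)

lemma polygons_subset:
  assumes "finite S" "pairing S B" "pairing S W" "C \<in> polygons B W"
  shows "C \<subseteq> S"
  using partition_onD1[OF polygons_partition[OF assms(1-3)]] assms(4) by blast

definition rest_type :: "'a set set \<Rightarrow> 'a set set \<Rightarrow> 'a set set \<Rightarrow> nat multiset" where
  "rest_type B W D = image_mset (\<lambda>C. card C div 2) (mset_set (polygons B W - D))"

lemma couple_type_rest:
  assumes "finite S" "pairing S B" "pairing S W" "C \<in> polygons B W"
  shows "couple_type B W = add_mset (card C div 2) (rest_type B W {C})"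
proof -
  have "mset_set (polygons B W) = add_mset C (mset_set (polygons B W - {C}))"
    using mset_set.remove[OF finite_polygons[OF assms(1-3)] assms(4)] .
  then show ?thesis by (simp add: couple_type_def rest_type_def)
qed

lemma polygons_remove_type:
  assumes fin: "finite S" and B: "pairing S B" and W: "pairing S W" and e: "e \<subseteq> S" "card e = 2"
    and D: "{C \<in> polygons B W. C \<inter> e \<noteq> {}} = D" and DU: "\<Union>D - e = \<Union>\<N>" and fN: "finite \<N>"
    and ne: "\<And>C. C \<in> \<N> \<Longrightarrow> C \<noteq> {}" and dis: "disjoint \<N>"
    and c: "\<And>C. C \<in> \<N> \<Longrightarrow> \<exists>xs. (cyc (pairing_remove e B) (pairing_remove e W) xs \<or> cyc (pairing_remove e W) (pairing_remove e B) xs) \<and> set xs = C"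
  shows "polygons (pairing_remove e B) (pairing_remove e W) = (polygons B W - D) \<union> \<N>"
    and "(polygons B W - D) \<inter> \<N> = {}"
    and "couple_type (pairing_remove e B) (pairing_remove e W) = rest_type B W D + image_mset (\<lambda>C. card C div 2) (mset_set \<N>)"
proof -
  have K: "{C \<in> polygons B W. C \<inter> e = {}} = polygons B W - D" using D by blast
  have N: "partition_on (\<Union>{C \<in> polygons B W. C \<inter> e \<noteq> {}} - e) \<N>"
    unfolding D DU using ne dis by (auto simp: partition_on_def)
  show P: "polygons (pairing_remove e B) (pairing_remove e W) = (polygons B W - D) \<union> \<N>"
    using polygons_remove[OF fin B W e N c] unfolding K .
  show I: "(polygons B W - D) \<inter> \<N> = {}"
  proof (rule ccontr)
    assume "(polygons B W - D) \<inter> \<N> \<noteq> {}"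
    then obtain C where C: "C \<in> polygons B W" "C \<notin> D" "C \<in> \<N>" by auto
    then obtain s where s: "s \<in> C" using ne by blast
    then have "s \<in> \<Union>D" using C DU by blast
    then obtain C' where C': "C' \<in> D" "s \<in> C'" by auto
    then have "C' \<in> polygons B W" using D by blast
    then have "C = C'" using polygons_disjoint[OF fin B W C(1) _ s C'(2)] by blast
    then show False using C C' by simp
  qed
  show "couple_type (pairing_remove e B) (pairing_remove e W) = rest_type B W D + image_mset (\<lambda>C. card C div 2) (mset_set \<N>)"
    unfolding rest_type_def using finite_polygons[OF fin B W] fN I P by (intro couple_type_split) auto
qed

lemma cyc_length: "cyc B W xs \<Longrightarrow> card (set xs) = length xs"
  by (simp add: cyc_def distinct_card)

text \<open>An arc is empty exactly when \<open>{x, y}\<close> is a pair of \<open>B\<close>,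
  respectively of \<open>W\<close>; it then leaves no polygon, which is why \<open>[]\<close> is
  excluded from \<open>N\<close>.\<close>

lemma remove_straight:
  assumes fin: "finite S" and B: "pairing S B" and W: "pairing S W" and c: "cyc B W (x # P @ y # Q)"
    and C: "set (x # P @ y # Q) \<in> polygons B W" and ev: "even (length P)"
  defines "N \<equiv> set ` ({P, Q} - {[]})"
  shows "polygons (pairing_remove {x, y} B) (pairing_remove {x, y} W) = (polygons B W - {set (x # P @ y # Q)}) \<union> N"
    "(polygons B W - {set (x # P @ y # Q)}) \<inter> N = {}"
    "couple_type (pairing_remove {x, y} B) (pairing_remove {x, y} W) = rest_type B W {set (x # P @ y # Q)} +
       (if P = [] then {#} else {#length P div 2#}) + (if Q = [] then {#} else {#length Q div 2#})"
proof -
  let ?C = "set (x # P @ y # Q)" and ?e = "{x, y}"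
  note F = cyc_split_facts[OF c]
  have e: "?e \<subseteq> S" "card ?e = 2" using polygons_subset[OF fin B W C] F(17) by auto
  have D: "{C \<in> polygons B W. C \<inter> ?e \<noteq> {}} = {?C}"
    by (rule polygons_meeting[OF fin B W C]) auto
  have UN: "\<Union>N = set P \<union> set Q"
    unfolding N_def by (cases "P = []"; cases "Q = []") (simp_all add: insert_Diff_if)
  have DU: "\<Union>{?C} - ?e = \<Union>N" unfolding UN using F(13-16) by auto
  have ne: "C \<noteq> {}" if "C \<in> N" for C using that by (auto simp: N_def)
  have dis: "disjoint N" using F(12) by (auto simp: N_def pairwise_def disjnt_def)
  have cc: "\<exists>xs. (cyc (pairing_remove ?e B) (pairing_remove ?e W) xs \<or> cyc (pairing_remove ?e W) (pairing_remove ?e B) xs) \<and> set xs = D" if "D \<in> N" for D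
    using that cyc_remove_straight[OF B W c ev] by (auto simp: N_def)
  have fN: "finite N" by (simp add: N_def)
  note R = polygons_remove_type[OF fin B W e D DU fN ne dis cc]
  show "polygons (pairing_remove ?e B) (pairing_remove ?e W) = (polygons B W - {?C}) \<union> N" by (rule R(1))
  show "(polygons B W - {?C}) \<inter> N = {}" by (rule R(2))
  have "image_mset (\<lambda>C. card C div 2) (mset_set N) = (if P = [] then {#} else {#length P div 2#}) + (if Q = [] then {#} else {#length Q div 2#})"
  proof (cases "P = [] \<or> Q = []")
    case True
    then show ?thesis using F(10,11) by (auto simp: N_def distinct_card insert_Diff_if)
  next
    case False
    then have "set P \<noteq> set Q" using F(12) by auto
    moreover have "N = {set P, set Q}" using False by (auto simp: N_def)
    ultimately show ?thesis using False F(10,11) by (simp add: distinct_card)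
  qed
  then show "couple_type (pairing_remove ?e B) (pairing_remove ?e W) = rest_type B W {?C} +
       (if P = [] then {#} else {#length P div 2#}) + (if Q = [] then {#} else {#length Q div 2#})"
    using R(3) by (simp add: add.assoc)
qed

lemma remove_twisted:
  assumes fin: "finite S" and B: "pairing S B" and W: "pairing S W" and c: "cyc B W (x # P @ y # Q)"
    and C: "set (x # P @ y # Q) \<in> polygons B W" and od: "odd (length P)"
  shows "couple_type (pairing_remove {x, y} B) (pairing_remove {x, y} W) =
      add_mset ((length P + length Q) div 2) (rest_type B W {set (x # P @ y # Q)})"
    and "{x, y} \<notin> B" "{x, y} \<notin> W"
proof -
  let ?C = "set (x # P @ y # Q)" and ?e = "{x, y}"
  note F = cyc_split_facts[OF c]
  have ne: "P \<noteq> []" "Q \<noteq> []" using od F(9) by auto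
  have e: "?e \<subseteq> S" "card ?e = 2" using polygons_subset[OF fin B W C] F(17) by auto
  have "hd P \<noteq> y" using F(15) ne by (metis hd_in_set)
  then show nB: "{x, y} \<notin> B" using pairing_partner_unique[OF B F(1)[OF ne(1)]] by blast
  have "last Q \<noteq> y" using F(16) ne by (metis last_in_set)
  then show nW: "{x, y} \<notin> W" using pairing_partner_unique[OF W F(3)[OF ne(2)]] by blast
  have D: "{C \<in> polygons B W. C \<inter> ?e \<noteq> {}} = {?C}"
    by (rule polygons_meeting[OF fin B W C]) auto
  have m: "cyc (pairing_remove ?e W) (pairing_remove ?e B) (P @ rev Q)"
    using F ne od by (intro cyc_remove_merge[OF B W F(17) nB nW]) auto
  have DU: "\<Union>{?C} - ?e = \<Union>{set (P @ rev Q)}" using F(13-17) by auto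
  have "couple_type (pairing_remove ?e B) (pairing_remove ?e W) = rest_type B W {?C} + image_mset (\<lambda>C. card C div 2) (mset_set {set (P @ rev Q)})"
    by (rule polygons_remove_type(3)[OF fin B W e D DU]) (use ne m in auto)
  then show "couple_type (pairing_remove ?e B) (pairing_remove ?e W) = add_mset ((length P + length Q) div 2) (rest_type B W {?C})"
    using cyc_length[OF m] by simp
qed

lemma remove_interface:
  assumes fin: "finite S" and B: "pairing S B" and W: "pairing S W" and C: "C \<in> polygons B W" and C': "C' \<in> polygons B W"
    and ne: "C \<noteq> C'" and x: "x \<in> C" and y: "y \<in> C'"
  shows "couple_type (pairing_remove {x, y} B) (pairing_remove {x, y} W) =
      add_mset ((card C div 2 - 1) + card C' div 2) (rest_type B W {C} - {#card C' div 2#})"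
    and "{x, y} \<notin> B" "{x, y} \<notin> W"
proof -
  let ?e = "{x, y}"
  obtain xs where "cyc B W xs" "hd xs = x" "set xs = C" by (rule polygon_cyc[OF fin B W C x])
  then obtain X where c: "cyc B W (x # X)" "set (x # X) = C" by (cases xs) (auto simp: cyc_def)
  obtain ys where "cyc B W ys" "hd ys = y" "set ys = C'" by (rule polygon_cyc[OF fin B W C' y])
  then obtain Y where c': "cyc B W (y # Y)" "set (y # Y) = C'" by (cases ys) (auto simp: cyc_def)
  note F = cyc_Cons_facts[OF c(1)] and F' = cyc_Cons_facts[OF c'(1)]
  have dis: "C \<inter> C' = {}" using polygons_disjoint[OF fin B W C C'] ne by blast
  have xy: "x \<noteq> y" using dis x y by auto
  have yX: "y \<notin> set X" "x \<notin> set Y" "set X \<inter> set Y = {}" using dis c c' by auto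
  have e: "?e \<subseteq> S" "card ?e = 2" using polygons_subset[OF fin B W C] polygons_subset[OF fin B W C'] x y xy by auto
  have "hd X \<noteq> y" using F(1) yX by (metis hd_in_set)
  then show nB: "{x, y} \<notin> B" using pairing_partner_unique[OF B F(5)] by blast
  have "last X \<noteq> y" using F(1) yX by (metis last_in_set)
  then show nW: "{x, y} \<notin> W" using pairing_partner_unique[OF W F(7)] by blast
  have D: "{D \<in> polygons B W. D \<inter> ?e \<noteq> {}} = {C, C'}"
  proof
    show "{D \<in> polygons B W. D \<inter> ?e \<noteq> {}} \<subseteq> {C, C'}"
    proof
      fix D assume "D \<in> {D \<in> polygons B W. D \<inter> ?e \<noteq> {}}"
      then have d: "D \<in> polygons B W" "x \<in> D \<or> y \<in> D" by auto
      from d(2) show "D \<in> {C, C'}"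
      proof
        assume "x \<in> D"
        then show ?thesis using polygons_disjoint[OF fin B W d(1) C _ x] by simp
      next
        assume "y \<in> D"
        then show ?thesis using polygons_disjoint[OF fin B W d(1) C' _ y] by simp
      qed
    qed
  qed (use C C' x y in auto)
  have m: "cyc (pairing_remove ?e W) (pairing_remove ?e B) (X @ rev Y)"
    using F F' yX by (intro cyc_remove_merge[OF B W xy nB nW]) auto
  have DU: "\<Union>{C, C'} - ?e = \<Union>{set (X @ rev Y)}" using c c' F F' yX by auto
  have ct: "couple_type (pairing_remove ?e B) (pairing_remove ?e W) = rest_type B W {C, C'} + image_mset (\<lambda>C. card C div 2) (mset_set {set (X @ rev Y)})"
    by (rule polygons_remove_type(3)[OF fin B W e D DU]) (use F m in auto)
  have "card C = length X + 1" "card C' = length Y + 1"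
    using cyc_length[OF c(1)] cyc_length[OF c'(1)] c c' by auto
  \<comment> \<open>\<open>X\<close> and \<open>Y\<close> have odd length, one less than their
    faces, so half of the total is the sum of the half lengths minus 1.\<close>
  then have len: "length (X @ rev Y) div 2 = (card C div 2 - 1) + card C' div 2"
    using F(2) F'(2) by (auto elim!: oddE)
  have "mset_set (polygons B W - {C}) = add_mset C' (mset_set (polygons B W - {C} - {C'}))"
    using mset_set.remove[of "polygons B W - {C}" C'] finite_polygons[OF fin B W] C' ne by auto
  moreover have "polygons B W - {C} - {C'} = polygons B W - {C, C'}" by auto
  ultimately have "rest_type B W {C} - {#card C' div 2#} = rest_type B W {C, C'}"
    by (simp add: rest_type_def)
  then show "couple_type (pairing_remove ?e B) (pairing_remove ?e W) = add_mset ((card C div 2 - 1) + card C' div 2) (rest_type B W {C} - {#card C' div 2#})"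
    using ct cyc_length[OF m] len by simp
qed

text \<open>Each step of a path changes the parity of the position, also when it passes the closing
  pair, because the cycle has even length.\<close>

lemma path_parity:
  assumes B: "pairing S B" and W: "pairing S W" and c: "cyc B W xs"
  shows "successively (adjacent B W) zs \<Longrightarrow> distinct zs \<Longrightarrow> zs \<noteq> [] \<Longrightarrow> hd zs = xs ! i \<Longrightarrow> i < length xs \<Longrightarrow>
    \<exists>j<length xs. last zs = xs ! j \<and> (even (i + j) \<longleftrightarrow> odd (length zs))"
proof (induction zs arbitrary: i)
  case (Cons z zs)
  show ?case
  proof (cases "zs = []")
    case True
    then show ?thesis using Cons.prems by (intro exI[of _ i]) auto
  next
    case False
    then have adj: "adjacent B W (xs ! i) (hd zs)" and s: "successively (adjacent B W) zs"
      using Cons.prems by (auto simp: successively_Cons)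
    have "hd zs \<noteq> xs ! i" using Cons.prems False by (metis distinct.simps(2) hd_in_set list.sel(1))
    then obtain i' where i': "i' < length xs" "hd zs = xs ! i'" "odd (i + i')"
      by (rule cyc_adjacent[OF B W c Cons.prems(5) adj])
    obtain j where j: "j < length xs" "last zs = xs ! j" "even (i' + j) \<longleftrightarrow> odd (length zs)"
      using Cons.IH[OF s _ False i'(2,1)] Cons.prems by auto
    then show ?thesis using False i'(3) by (intro exI[of _ j]) auto
  qed
qed simp

lemma apath_successively: "apath P Q xs \<Longrightarrow> successively (adjacent P Q) xs \<and> successively (adjacent Q P) xs"
  by (induction P Q xs rule: apath.induct) (auto simp: adjacent_def)

lemma edge_weight_same_face:
  assumes fin: "finite S" and B: "pairing S B" and W: "pairing S W" and c: "cyc B W (x # P @ y # Q)"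
    and C: "set (x # P @ y # Q) \<in> polygons B W"
  shows "edge_weight \<alpha> (B, W, E) {x, y} = (if even (length P) then 1 else gamma_par \<alpha>)"
proof -
  let ?xs = "x # P @ y # Q" and ?M = "(B, W, E)"
  have d: "distinct ?xs" using c by (simp add: cyc_def)
  have sf: "same_face ?M {x, y}" using C by (auto simp: same_face_def)
  have "apath B W ?xs" using c by (simp add: cyc_def)
  then have "successively (adjacent B W) ((x # P @ [y]) @ Q)" using apath_successively[of B W ?xs] by simp
  then have "successively (adjacent B W) (x # P @ [y])" unfolding successively_append_iff by blast
  then have fd: "face_distance ?M x y (length P)" using d by (auto intro!: exI[of _ P])
  have ix: "?xs ! 0 = x" "?xs ! Suc (length P) = y" "Suc (length P) < length ?xs" by (auto simp: nth_append)
  have uniq: "i = j" if "?xs ! i = ?xs ! j" "i < length ?xs" "j < length ?xs" for i j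
    using d that nth_eq_iff_index_eq by blast
  \<comment> \<open>\<open>straight\<close> and \<open>twisted\<close> only ask for some path of
    given parity; that all paths between the two sides agree makes them exclusive.\<close>
  have par: "even k \<longleftrightarrow> even (length P)" if fdk: "face_distance ?M s t k" "{x, y} = {s, t}" for s t k
  proof -
    obtain zs where zs: "length zs = k" "distinct (s # zs @ [t])" "successively (adjacent B W) (s # zs @ [t])"
      using fdk(1) by auto
    have "s = x \<and> t = y \<or> s = y \<and> t = x" using fdk(2) by (auto simp: doubleton_eq_iff)
    then obtain i j where ij: "i < length ?xs" "j < length ?xs" "s = ?xs ! i" "t = ?xs ! j" "i + j = Suc (length P)"
    proof
      assume "s = x \<and> t = y"
      then show thesis using that[of 0 "Suc (length P)"] ix by simp
    next
      assume "s = y \<and> t = x"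
      then show thesis using that[of "Suc (length P)" 0] ix by simp
    qed
    obtain j' where j': "j' < length ?xs" "t = ?xs ! j'" "even (i + j') \<longleftrightarrow> odd (length (s # zs @ [t]))"
      using path_parity[OF B W c zs(3,2) _ _ ij(1)] ij(3) by auto
    have "j' = j" using uniq[of j' j] j' ij by simp
    then show ?thesis using j' ij zs by auto
  qed
  have st: "straight ?M {x, y} \<longleftrightarrow> even (length P)"
  proof
    assume "straight ?M {x, y}"
    then show "even (length P)" unfolding straight_def using par by blast
  next
    assume "even (length P)"
    then show "straight ?M {x, y}" unfolding straight_def using sf fd by blast
  qed
  have "twisted ?M {x, y}" if "odd (length P)"
    unfolding twisted_def using sf fd that by blast
  then show ?thesis using st by (simp add: edge_weight_def)
qed

lemma edge_weight_interface:
  assumes fin: "finite S" and B: "pairing S B" and W: "pairing S W" and C: "C \<in> polygons B W" and C': "C' \<in> polygons B W"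
    and ne: "C \<noteq> C'" and x: "x \<in> C" and y: "y \<in> C'"
  shows "edge_weight \<alpha> (B, W, E) {x, y} = 1 / 2"
proof -
  have "\<not> same_face (B, W, E) {x, y}"
  proof
    assume "same_face (B, W, E) {x, y}"
    then obtain F where F: "F \<in> polygons B W" "x \<in> F" "y \<in> F" by (auto simp: same_face_def)
    then show False
      using polygons_disjoint[OF fin B W F(1) C F(2) x] polygons_disjoint[OF fin B W F(1) C' F(3) y] ne by simp
  qed
  then show ?thesis by (simp add: edge_weight_def straight_def twisted_def)
qed

text \<open>Weights depend on the faces only. Fixing the third component lets the weight be taken
  out of sums over pairings.\<close>

lemma edge_weight_cong: "edge_weight \<alpha> (B, W, E) e = edge_weight \<alpha> (B, W, {}) e"
proof -
  have "face_distance (B, W, E) = face_distance (B, W, {})" by (simp add: fun_eq_iff)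
  moreover have "same_face (B, W, E) = same_face (B, W, {})" by (simp add: fun_eq_iff same_face_def)
  ultimately show ?thesis unfolding edge_weight_def straight_def twisted_def by (simp only:)
qed

section \<open>Sums over maps\<close>

lemma pairing_edge_polygon:
  assumes fin: "finite S" and B: "pairing S B" and E: "pairing S E" and e: "e \<in> E"
  shows "\<exists>!v. v \<in> polygons B E \<and> e \<subseteq> v"
proof -
  obtain x y where xy: "e = {x, y}" "x \<noteq> y" using pairing_card[OF E e] by (auto simp: card_2_iff)
  have xS: "x \<in> S" using pairing_subset[OF E e] xy by auto
  then obtain C where C: "C \<in> polygons B E" "x \<in> C" using partition_onD1[OF polygons_partition[OF fin B E]] by blast
  obtain xs where xs: "cyc B E xs" "hd xs = x" "set xs = C" by (rule polygon_cyc[OF fin B E C])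
  obtain i where i: "i < length xs" "xs ! i = x" using C xs by (metis in_set_conv_nth)
  obtain j where j: "j < length xs" "{xs ! i, xs ! j} \<in> E" by (rule cyc_partner_W[OF xs(1) i(1)])
  have "xs ! j = y" using pairing_partner_unique[OF E, of x "xs ! j" y] j e i xy by simp
  then have "e \<subseteq> C" using xs j C xy by auto
  then show ?thesis
    using C polygons_disjoint[OF fin B E _ C(1)] xy by (intro ex1I[of _ C]) auto
qed

text \<open>In a rectangle every row meets every column, so any choice of rows and columns for the
  vertices extends to the edges in exactly one way. The condition on \<open>p\<close> and
  \<open>q\<close> reflects that an empty diagram has neither rows nor columns.\<close>

lemma N_map_rectangle:
  assumes fin: "finite S" and B: "pairing S B" and W: "pairing S W" and E: "pairing S E"
    and boxes: "boxes \<nu> = {..<p} \<times> {..<q}" and pq: "p = 0 \<longleftrightarrow> q = 0"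
  shows "N_map (B, W, E) \<nu> = p ^ card (polygons B E) * q ^ card (polygons W E)"
proof -
  let ?V = "polygons B E" and ?U = "polygons W E"
  have rows: "rows \<nu> = {..<p}" "columns \<nu> = {..<q}" using pq by (auto simp: rows_def columns_def boxes)
  define v where "v e = (THE v. v \<in> ?V \<and> e \<subseteq> v)" for e
  define u where "u e = (THE u. u \<in> ?U \<and> e \<subseteq> u)" for e
  have v: "v e \<in> ?V" "e \<subseteq> v e" if "e \<in> E" for e
    using theI'[OF pairing_edge_polygon[OF fin B E that]] by (auto simp: v_def)
  have u: "u e \<in> ?U" "e \<subseteq> u e" if "e \<in> E" for e
    using theI'[OF pairing_edge_polygon[OF fin W E that]] by (auto simp: u_def)
  have vu: "w = v e" if "e \<in> E" "w \<in> ?V" "e \<subseteq> w" for e w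
    using pairing_edge_polygon[OF fin B E that(1)] v[OF that(1)] that by blast
  have uu: "w = u e" if "e \<in> E" "w \<in> ?U" "e \<subseteq> w" for e w
    using pairing_edge_polygon[OF fin W E that(1)] u[OF that(1)] that by blast
  define G where "G = graph_embeddings (underlying_graph (B, W, E)) \<nu>"
  have G: "G = {(r, c, b). r \<in> ?V \<rightarrow>\<^sub>E {..<p} \<and> c \<in> ?U \<rightarrow>\<^sub>E {..<q} \<and> b \<in> E \<rightarrow>\<^sub>E {..<p} \<times> {..<q} \<and>
        (\<forall>e\<in>E. (\<forall>w\<in>?V. e \<subseteq> w \<longrightarrow> fst (b e) = r w) \<and> (\<forall>w\<in>?U. e \<subseteq> w \<longrightarrow> snd (b e) = c w))}"
    by (simp add: G_def graph_embeddings_def underlying_graph_def rows boxes)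
  have "bij_betw (\<lambda>(r, c, b). (r, c)) G ((?V \<rightarrow>\<^sub>E {..<p}) \<times> (?U \<rightarrow>\<^sub>E {..<q}))"
  proof (rule bij_betw_byWitness[of _ "\<lambda>(r, c). (r, c, \<lambda>e\<in>E. (r (v e), c (u e)))"])
    show "\<forall>a\<in>G. (\<lambda>(r, c). (r, c, \<lambda>e\<in>E. (r (v e), c (u e)))) ((\<lambda>(r, c, b). (r, c)) a) = a"
    proof
      fix a assume aG: "a \<in> G"
      obtain r c b where a: "a = (r, c, b)" by (cases a)
      have b: "b \<in> E \<rightarrow>\<^sub>E {..<p} \<times> {..<q}"
        and inc: "\<forall>e\<in>E. (\<forall>w\<in>?V. e \<subseteq> w \<longrightarrow> fst (b e) = r w) \<and> (\<forall>w\<in>?U. e \<subseteq> w \<longrightarrow> snd (b e) = c w)"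
        using aG unfolding G a mem_Collect_eq prod.case by simp_all
      have "(\<lambda>e\<in>E. (r (v e), c (u e))) = b"
      proof (rule ext)
        fix e
        show "(\<lambda>e\<in>E. (r (v e), c (u e))) e = b e"
        proof (cases "e \<in> E")
          case True
          then have "fst (b e) = r (v e)" "snd (b e) = c (u e)"
            using bspec[OF conjunct1[OF bspec[OF inc True]] v(1)[OF True]] bspec[OF conjunct2[OF bspec[OF inc True]] u(1)[OF True]]
              v(2)[OF True] u(2)[OF True] by simp_all
          then show ?thesis using True by (simp add: prod_eq_iff)
        next
          case False
          then show ?thesis using b by (simp add: PiE_arb[OF b])
        qed
      qed
      then show "(\<lambda>(r, c). (r, c, \<lambda>e\<in>E. (r (v e), c (u e)))) ((\<lambda>(r, c, b). (r, c)) a) = a" by (simp add: a)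
    qed
    show "\<forall>a'\<in>(?V \<rightarrow>\<^sub>E {..<p}) \<times> (?U \<rightarrow>\<^sub>E {..<q}). (\<lambda>(r, c, b). (r, c)) ((\<lambda>(r, c). (r, c, \<lambda>e\<in>E. (r (v e), c (u e)))) a') = a'"
      by auto
    show "(\<lambda>(r, c, b). (r, c)) ` G \<subseteq> (?V \<rightarrow>\<^sub>E {..<p}) \<times> (?U \<rightarrow>\<^sub>E {..<q})"
      unfolding G by (auto simp del: PiE_iff)
    show "(\<lambda>(r, c). (r, c, \<lambda>e\<in>E. (r (v e), c (u e)))) ` ((?V \<rightarrow>\<^sub>E {..<p}) \<times> (?U \<rightarrow>\<^sub>E {..<q})) \<subseteq> G"
    proof
      fix a assume "a \<in> (\<lambda>(r, c). (r, c, \<lambda>e\<in>E. (r (v e), c (u e)))) ` ((?V \<rightarrow>\<^sub>E {..<p}) \<times> (?U \<rightarrow>\<^sub>E {..<q}))"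
      then obtain rc where rc: "rc \<in> (?V \<rightarrow>\<^sub>E {..<p}) \<times> (?U \<rightarrow>\<^sub>E {..<q})" "a = (\<lambda>(r, c). (r, c, \<lambda>e\<in>E. (r (v e), c (u e)))) rc"
        by (rule imageE)
      obtain r c where "rc = (r, c)" by (cases rc)
      then have a: "a = (r, c, \<lambda>e\<in>E. (r (v e), c (u e)))" and r: "r \<in> ?V \<rightarrow>\<^sub>E {..<p}" and c: "c \<in> ?U \<rightarrow>\<^sub>E {..<q}"
        using rc by auto
      let ?b = "\<lambda>e\<in>E. (r (v e), c (u e))"
      have "?b \<in> E \<rightarrow>\<^sub>E {..<p} \<times> {..<q}"
        using PiE_mem[OF r v(1)] PiE_mem[OF c u(1)] by (intro restrict_PiE_iff[THEN iffD2]) simp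
      moreover have "fst (?b e) = r w" if "e \<in> E" "w \<in> ?V" "e \<subseteq> w" for e w
        using vu[OF that] that by simp
      moreover have "snd (?b e) = c w" if "e \<in> E" "w \<in> ?U" "e \<subseteq> w" for e w
        using uu[OF that] that by simp
      ultimately show "a \<in> G" unfolding G a mem_Collect_eq prod.case using r c by simp
    qed
  qed
  then have "card G = card ((?V \<rightarrow>\<^sub>E {..<p}) \<times> (?U \<rightarrow>\<^sub>E {..<q}))" by (rule bij_betw_same_card)
  also have "\<dots> = p ^ card ?V * q ^ card ?U"
    using finite_polygons[OF fin B E] finite_polygons[OF fin W E] by (simp add: card_cartesian_product card_PiE)
  finally show ?thesis by (simp add: N_map_def N_graph_def G_def)
qed

text \<open>Since \<open>e\<close> is a pair of \<open>E\<close>, its vertex loses two consecutive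
  elements, a straight removal with empty second arc. The vertex disappears exactly when it consists
  of \<open>e\<close> alone, that is, when \<open>e\<close> is in \<open>B\<close>.\<close>

lemma card_polygons_remove_edge:
  assumes fin: "finite S" and B: "pairing S B" and E: "pairing S E" and e: "e \<in> E"
  shows "card (polygons B E) = card (polygons (pairing_remove e B) (E - {e})) + (if e \<in> B then 1 else 0)"
proof -
  obtain x y where xy: "e = {x, y}" "x \<noteq> y" using pairing_card[OF E e] by (auto simp: card_2_iff)
  have xS: "x \<in> S" using pairing_subset[OF E e] xy by auto
  then obtain C where C: "C \<in> polygons B E" "x \<in> C" using partition_onD1[OF polygons_partition[OF fin B E]] by blast
  obtain xs where "cyc B E xs" "hd xs = x" "set xs = C" by (rule polygon_cyc[OF fin B E C])
  then obtain X where X: "cyc B E (x # X)" "set (x # X) = C" by (cases xs) (auto simp: cyc_def)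
  note F = cyc_Cons_facts[OF X(1)]
  have "last X = y" using pairing_partner_unique[OF E F(7), of y] e xy by simp
  then obtain P where P: "X = P @ [y]" using F(1) by (metis append_butlast_last_id)
  have c: "cyc B E (x # P @ y # [])" "set (x # P @ y # []) \<in> polygons B E" using X C P by auto
  have ev: "even (length P)" using F(2) P by simp
  have eB: "e \<in> B \<longleftrightarrow> P = []"
  proof
    assume "e \<in> B"
    then have "hd X = y" using pairing_partner_unique[OF B F(5), of y] xy by simp
    then show "P = []" using F(3) P by (cases P) auto
  qed (use cyc_split_facts(2)[OF c(1)] xy in auto)
  have rE: "pairing_remove e E = E - {e}" using e by (simp add: pairing_remove_def)
  have pol: "polygons (pairing_remove e B) (E - {e}) = (polygons B E - {C}) \<union> (set ` ({P, []} - {[]}))"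
    "(polygons B E - {C}) \<inter> (set ` ({P, []} - {[]})) = {}"
    using remove_straight(1,2)[OF fin B E c ev] X(2) P rE xy by simp_all
  have f: "finite (polygons B E)" by (rule finite_polygons[OF fin B E])
  have "card (polygons (pairing_remove e B) (E - {e})) = card (polygons B E - {C}) + card (set ` ({P, []} - {[]}))"
    unfolding pol(1) using f pol(2) by (intro card_Un_disjoint) auto
  moreover have "card (polygons B E) = card (polygons B E - {C}) + 1"
    using card.remove[OF f C(1)] by simp
  moreover have "card (set ` ({P, []} - {[]})) = (if P = [] then 0 else 1)"
    by (cases "P = []") (auto simp: insert_Diff_if)
  ultimately show ?thesis using eB by simp
qed

text \<open>Histories are grouped by their first edge; the rest of the list is a history of the map
  without it, and the factorials differ by \<open>card E\<close>.\<close>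

lemma map_weight_remove:
  assumes fin: "finite E" and ne: "E \<noteq> {}"
  shows "real (card E) * map_weight \<alpha> (B, W, E) =
    (\<Sum>e\<in>E. edge_weight \<alpha> (B, W, {}) e * map_weight \<alpha> (pairing_remove e B, pairing_remove e W, E - {e}))"
proof -
  have "(\<Sum>es\<in>permutations_of_set E. history_weight \<alpha> (B, W, E) es) =
     (\<Sum>es\<in>(\<Union>e\<in>E. (#) e ` permutations_of_set (E - {e})). history_weight \<alpha> (B, W, E) es)"
    using permutations_of_set_nonempty[OF ne] by simp
  also have "\<dots> = (\<Sum>e\<in>E. \<Sum>es\<in>(#) e ` permutations_of_set (E - {e}). history_weight \<alpha> (B, W, E) es)"
    by (rule sum.UNION_disjoint) (use fin in auto)
  also have "\<dots> = (\<Sum>e\<in>E. edge_weight \<alpha> (B, W, {}) e * (\<Sum>es\<in>permutations_of_set (E - {e}). history_weight \<alpha> (pairing_remove e B, pairing_remove e W, E - {e}) es))"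
  proof (intro sum.cong refl)
    fix e assume e: "e \<in> E"
    have "pairing_remove e E = E - {e}" using e by (simp add: pairing_remove_def)
    then show "(\<Sum>es\<in>(#) e ` permutations_of_set (E - {e}). history_weight \<alpha> (B, W, E) es) =
      edge_weight \<alpha> (B, W, {}) e * (\<Sum>es\<in>permutations_of_set (E - {e}). history_weight \<alpha> (pairing_remove e B, pairing_remove e W, E - {e}) es)"
      by (subst sum.reindex) (simp_all add: sum_distrib_left edge_weight_cong[of \<alpha> B W E])
  qed
  also have "\<dots> = fact (card E - 1) * (\<Sum>e\<in>E. edge_weight \<alpha> (B, W, {}) e * map_weight \<alpha> (pairing_remove e B, pairing_remove e W, E - {e}))"
    by (subst sum_distrib_left, intro sum.cong refl) (use fin in \<open>simp add: map_weight_def\<close>)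
  finally have "(\<Sum>es\<in>permutations_of_set E. history_weight \<alpha> (B, W, E) es) = \<dots>" .
  moreover have "fact (card E) = real (card E) * fact (card E - 1)"
    using fin ne by (intro fact_reduce) (simp add: card_gt_0_iff)
  moreover have "card E > 0" using fin ne by (simp add: card_gt_0_iff)
  ultimately show ?thesis by (simp add: map_weight_def)
qed

section \<open>Weighted sums over maps and their recursion\<close>

definition map_sum :: "real \<Rightarrow> real \<Rightarrow> real \<Rightarrow> 'a set set \<Rightarrow> 'a set set \<Rightarrow> real" where
  "map_sum \<alpha> a b B W = (\<Sum>E | pairing (\<Union>B) E.
     a ^ card (polygons B E) * b ^ card (polygons W E) * map_weight \<alpha> (B, W, E))"

definition pairs :: "'a set \<Rightarrow> 'a set set" where
  "pairs S = {e. e \<subseteq> S \<and> card e = 2}"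

lemma pairing_insert:
  assumes "pairing (S - e) E'" "e \<in> pairs S"
  shows "pairing S (insert e E')" "e \<notin> E'"
proof -
  have e: "e \<subseteq> S" "card e = 2" using assms by (auto simp: pairs_def)
  show "e \<notin> E'"
  proof
    assume "e \<in> E'"
    then have "e = {}" using pairing_subset[OF assms(1), of e] by blast
    then show False using e by simp
  qed
  have "partition_on ((S - e) \<union> e) (E' \<union> {e})"
    using assms(1) e by (intro partition_on_Un) (auto simp: pairing_def partition_on_def)
  moreover have "(S - e) \<union> e = S" "E' \<union> {e} = insert e E'" using e by auto
  ultimately show "pairing S (insert e E')" using assms(1) e by (simp add: pairing_def)
qed

lemma finite_pairings: "finite S \<Longrightarrow> finite {E. pairing S E}"
  by (rule finite_subset[of _ "Pow (Pow S)"]) (auto dest: pairing_subset)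

lemma card_pairing:
  assumes "finite S" "pairing S E"
  shows "card S = 2 * card E"
proof -
  have "card S = (\<Sum>e\<in>E. card e)"
    using assms pairing_card by (intro product_partition) (auto simp: pairing_def card_2_iff intro: finite_subset)
  also have "\<dots> = (\<Sum>e\<in>E. 2)" using assms pairing_card by (intro sum.cong) auto
  finally show ?thesis by simp
qed

text \<open>All pairings have \<open>card S / 2\<close> edges, so the sums over the pairing and over
  its first removed edge can be exchanged. The factors \<open>a\<close> and \<open>b\<close> account
  for the vertices that vanish with \<open>e\<close>.\<close>

lemma map_sum_remove:
  assumes fin: "finite S" and B: "pairing S B" and W: "pairing S W" and ne: "S \<noteq> {}"
  shows "real (card S) / 2 * map_sum \<alpha> a b B W = (\<Sum>e\<in>pairs S. edge_weight \<alpha> (B, W, {}) e *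
     ((if e \<in> B then a else 1) * (if e \<in> W then b else 1)) * map_sum \<alpha> a b (pairing_remove e B) (pairing_remove e W))"
proof -
  let ?E = "{E. pairing S E}"
  have fE: "finite ?E" by (rule finite_pairings[OF fin])
  have fp: "finite (pairs S)" using fin by (simp add: pairs_def)
  define t where "t E e = edge_weight \<alpha> (B, W, {}) e * ((if e \<in> B then a else 1) * (if e \<in> W then b else 1)) *
      (a ^ card (polygons (pairing_remove e B) (E - {e})) * b ^ card (polygons (pairing_remove e W) (E - {e})) *
        map_weight \<alpha> (pairing_remove e B, pairing_remove e W, E - {e}))" for E e
  have "real (card S) / 2 * map_sum \<alpha> a b B W =
     (\<Sum>E\<in>?E. a ^ card (polygons B E) * b ^ card (polygons W E) * (real (card E) * map_weight \<alpha> (B, W, E)))"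
    unfolding map_sum_def pairing_Union[OF B] sum_distrib_left
    using card_pairing[OF fin] by (intro sum.cong refl) (simp add: mult_ac)
  also have "\<dots> = (\<Sum>E\<in>?E. \<Sum>e\<in>E. t E e)"
  proof (intro sum.cong refl)
    fix E assume "E \<in> ?E"
    then have E: "pairing S E" by simp
    have "E \<noteq> {}" using pairing_Union[OF E] ne by auto
    from map_weight_remove[OF finite_pairing[OF fin E] this, of \<alpha> B W]
    have "a ^ card (polygons B E) * b ^ card (polygons W E) * (real (card E) * map_weight \<alpha> (B, W, E)) =
      (\<Sum>e\<in>E. a ^ card (polygons B E) * b ^ card (polygons W E) * (edge_weight \<alpha> (B, W, {}) e * map_weight \<alpha> (pairing_remove e B, pairing_remove e W, E - {e})))"
      by (simp only: sum_distrib_left)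
    also have "\<dots> = (\<Sum>e\<in>E. t E e)"
    proof (intro sum.cong refl)
      fix e assume e: "e \<in> E"
      show "a ^ card (polygons B E) * b ^ card (polygons W E) * (edge_weight \<alpha> (B, W, {}) e * map_weight \<alpha> (pairing_remove e B, pairing_remove e W, E - {e})) = t E e"
        unfolding card_polygons_remove_edge[OF fin B E e] card_polygons_remove_edge[OF fin W E e] t_def by simp
    qed
    finally show "a ^ card (polygons B E) * b ^ card (polygons W E) * (real (card E) * map_weight \<alpha> (B, W, E)) = (\<Sum>e\<in>E. t E e)" .
  qed
  also have "\<dots> = (\<Sum>E\<in>?E. \<Sum>e\<in>{e \<in> pairs S. e \<in> E}. t E e)"
  proof (intro sum.cong refl)
    fix E assume "E \<in> ?E"
    then show "E = {e \<in> pairs S. e \<in> E}" using pairing_subset[of S E] pairing_card[of S E] by (auto simp: pairs_def)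
  qed
  also have "\<dots> = (\<Sum>e\<in>pairs S. \<Sum>E\<in>{E \<in> ?E. e \<in> E}. t E e)"
    by (rule sum.swap_restrict[OF fE fp])
  also have "\<dots> = (\<Sum>e\<in>pairs S. edge_weight \<alpha> (B, W, {}) e *
     ((if e \<in> B then a else 1) * (if e \<in> W then b else 1)) * map_sum \<alpha> a b (pairing_remove e B) (pairing_remove e W))"
  proof (intro sum.cong refl)
    fix e assume e: "e \<in> pairs S"
    then have e': "e \<subseteq> S" "card e = 2" by (auto simp: pairs_def)
    have U: "\<Union>(pairing_remove e B) = S - e" by (rule pairing_Union[OF pairing_pairing_remove[OF B e']])
    have "(\<Sum>E\<in>{E \<in> ?E. e \<in> E}. t E e) = (\<Sum>E'\<in>{E'. pairing (S - e) E'}. edge_weight \<alpha> (B, W, {}) e * ((if e \<in> B then a else 1) * (if e \<in> W then b else 1)) *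
      (a ^ card (polygons (pairing_remove e B) E') * b ^ card (polygons (pairing_remove e W) E') *
        map_weight \<alpha> (pairing_remove e B, pairing_remove e W, E')))"
    proof (rule sum.reindex_bij_witness[of _ "insert e" "\<lambda>E. E - {e}"], goal_cases)
      case (1 E)
      then show ?case by auto
    next
      case (2 E)
      then have E: "pairing S E" "e \<in> E" by auto
      have "pairing_remove e E = E - {e}" using E by (simp add: pairing_remove_def)
      then show ?case using pairing_pairing_remove[OF E(1) e'] by simp
    next
      case (3 E')
      then show ?case using pairing_insert(2)[OF _ e] by auto
    next
      case (4 E')
      then show ?case using pairing_insert(1)[OF _ e] by auto
    next
      case (5 E)
      then show ?case by (simp add: t_def)
    qed
    then show "(\<Sum>E\<in>{E \<in> ?E. e \<in> E}. t E e) = edge_weight \<alpha> (B, W, {}) e *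
     ((if e \<in> B then a else 1) * (if e \<in> W then b else 1)) * map_sum \<alpha> a b (pairing_remove e B) (pairing_remove e W)"
      unfolding map_sum_def U sum_distrib_left .
  qed
  finally show ?thesis .
qed

lemma sum_pairs:
  fixes \<phi> :: "'a set \<Rightarrow> real"
  assumes fin: "finite S"
  shows "(\<Sum>x\<in>S. \<Sum>y\<in>S - {x}. \<phi> {x, y}) = 2 * (\<Sum>e\<in>pairs S. \<phi> e)"
proof -
  have fp: "finite (pairs S)" using fin by (simp add: pairs_def)
  have "(\<Sum>y\<in>S - {x}. \<phi> {x, y}) = (\<Sum>e\<in>{e \<in> pairs S. x \<in> e}. \<phi> e)" if x: "x \<in> S" for x
  proof (rule sum.reindex_bij_witness[of _ "\<lambda>e. the_elem (e - {x})" "\<lambda>y. {x, y}"], goal_cases)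
    case (1 y)
    then have "{x, y} - {x} = {y}" by auto
    then show ?case by simp
  next
    case (2 y)
    then show ?case using x by (auto simp: pairs_def)
  next
    case (3 e)
    then obtain y where "e = {x, y}" "y \<noteq> x" by (auto simp: pairs_def card_2_iff)
    moreover from this have "e - {x} = {y}" by auto
    ultimately show ?case by simp
  next
    case (4 e)
    then obtain y where "e = {x, y}" "y \<noteq> x" "e \<subseteq> S" by (auto simp: pairs_def card_2_iff)
    moreover from this have "e - {x} = {y}" by auto
    ultimately show ?case by simp
  next
    case (5 e)
    show ?case ..
  qed
  then have "(\<Sum>x\<in>S. \<Sum>y\<in>S - {x}. \<phi> {x, y}) = (\<Sum>x\<in>S. \<Sum>e\<in>{e \<in> pairs S. x \<in> e}. \<phi> e)" by simp
  also have "\<dots> = (\<Sum>e\<in>pairs S. \<Sum>x\<in>{x \<in> S. x \<in> e}. \<phi> e)"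
    by (rule sum.swap_restrict[OF fin fp])
  also have "\<dots> = (\<Sum>e\<in>pairs S. 2 * \<phi> e)"
  proof (intro sum.cong refl)
    fix e assume "e \<in> pairs S"
    then have "{x \<in> S. x \<in> e} = e" "card e = 2" by (auto simp: pairs_def)
    then show "(\<Sum>x\<in>{x \<in> S. x \<in> e}. \<phi> e) = 2 * \<phi> e" by simp
  qed
  finally show ?thesis by (simp add: sum_distrib_left)
qed

lemma sum_even_odd:
  fixes F :: "nat \<Rightarrow> real"
  shows "(\<Sum>j<2 * k + 1. F j) = (\<Sum>i\<le>k. F (2 * i)) + (\<Sum>i<k. F (2 * i + 1))"
  by (induction k) simp_all

text \<open>\<open>k + 1\<close> is half the length of the face through a chosen edge-side. The face
  is split, kept with weight \<open>gamma_par\<close>, or joined to a face of half length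
  \<open>t\<close>. The terms with \<open>a\<close> and \<open>b\<close> are splits with an empty
  arc, in which a vertex of degree 1 vanishes; for \<open>k = 0\<close> both arcs are empty.\<close>

definition map_recursion :: "real \<Rightarrow> real \<Rightarrow> real \<Rightarrow> (nat multiset \<Rightarrow> real) \<Rightarrow> bool" where
  "map_recursion \<alpha> a b g \<longleftrightarrow> g {#} = 1 \<and>
     (\<forall>s. g (add_mset 1 s) = (a * b + real (sum_mset s)) * g s) \<and>
     (\<forall>k s. k > 0 \<longrightarrow> 0 \<notin># s \<longrightarrow> g (add_mset (k + 1) s) =
        (\<Sum>i=1..<k. g (add_mset (k - i) (add_mset i s))) + (a + b + gamma_par \<alpha> * real k) * g (add_mset k s)
        + (\<Sum>t\<in>#s. real t * g (add_mset (k + t) (s - {#t#}))))"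

text \<open>A uniform form in the position \<open>i\<close> of the split, with empty arcs at
  \<open>i = 0\<close> and \<open>i = k\<close>. For \<open>k = 0\<close> joining leaves the type
  \<open>s\<close> unchanged, so the joining terms add up to the size of \<open>s\<close>.\<close>

lemma map_recursion_sum:
  assumes g: "map_recursion \<alpha> a b g" and s: "0 \<notin># s"
  shows "g (add_mset (k + 1) s) =
    (\<Sum>i\<le>k. (if i = 0 then a else 1) * (if i = k then b else 1) *
        g (s + (if i = 0 then {#} else {#i#}) + (if i = k then {#} else {#k - i#})))
    + real k * (gamma_par \<alpha> * g (add_mset k s))
    + (\<Sum>t\<in>#s. real t * g (add_mset (k + t) (s - {#t#})))"
proof (cases "k = 0")
  case True
  have "(\<Sum>t\<in>#s. real t * g (add_mset t (s - {#t#}))) = (\<Sum>t\<in>#s. real t * g s)"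
    by (intro arg_cong[of _ _ sum_mset] image_mset_cong) simp
  also have "\<dots> = (\<Sum>t\<in>#s. real t) * g s" by (simp add: sum_mset_distrib_right)
  also have "(\<Sum>t\<in>#s. real t) = real (sum_mset s)" by (induction s) auto
  finally show ?thesis using True g by (simp add: map_recursion_def algebra_simps)
next
  case False
  let ?\<psi> = "\<lambda>i. (if i = 0 then a else 1) * (if i = k then b else 1) *
        g (s + (if i = 0 then {#} else {#i#}) + (if i = k then {#} else {#k - i#}))"
  have S: "{..k} = insert 0 (insert k {1..<k})" using False by auto
  have "(\<Sum>i\<le>k. ?\<psi> i) = ?\<psi> 0 + (?\<psi> k + (\<Sum>i\<in>{1..<k}. ?\<psi> i))"
    unfolding S using False by (subst sum.insert, simp, simp, subst sum.insert) auto
  also have "?\<psi> 0 = a * g (add_mset k s)" using False by simp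
  also have "?\<psi> k = b * g (add_mset k s)" using False by simp
  also have "(\<Sum>i\<in>{1..<k}. ?\<psi> i) = (\<Sum>i=1..<k. g (add_mset (k - i) (add_mset i s)))"
    by (intro sum.cong refl) auto
  finally show ?thesis using g False s unfolding map_recursion_def by (simp add: algebra_simps)
qed

text \<open>The other ends \<open>y\<close> of an edge at \<open>x\<close> are enumerated along the
  face of \<open>x\<close>: position \<open>2 * i\<close> is straight and leaves arcs of half
  lengths \<open>i\<close> and \<open>k - i\<close>, odd positions are twisted. The remaining
  \<open>y\<close> lie in other faces.\<close>

lemma vertex_sum:
  assumes fin: "finite S" and B: "pairing S B" and W: "pairing S W" and x: "x \<in> S" and g: "map_recursion \<alpha> a b g"
  shows "(\<Sum>y\<in>S - {x}. edge_weight \<alpha> (B, W, {}) {x, y} * ((if {x, y} \<in> B then a else 1) * (if {x, y} \<in> W then b else 1)) *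
      g (couple_type (pairing_remove {x, y} B) (pairing_remove {x, y} W))) = g (couple_type B W)"
proof -
  define \<phi> where "\<phi> y = edge_weight \<alpha> (B, W, {}) {x, y} * ((if {x, y} \<in> B then a else 1) * (if {x, y} \<in> W then b else 1)) *
      g (couple_type (pairing_remove {x, y} B) (pairing_remove {x, y} W))" for y
  note part = polygons_partition[OF fin B W]
  obtain C where C: "C \<in> polygons B W" "x \<in> C" using partition_onD1[OF part] x by blast
  obtain xs where "cyc B W xs" "hd xs = x" "set xs = C" by (rule polygon_cyc[OF fin B W C])
  then obtain X where X: "cyc B W (x # X)" "set (x # X) = C" by (cases xs) (auto simp: cyc_def)
  note F = cyc_Cons_facts[OF X(1)]
  obtain k where k: "length X = 2 * k + 1" using F(2) by (elim oddE)
  define s where "s = rest_type B W {C}"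
  have cardC: "card C = 2 * k + 2" using cyc_length[OF X(1)] X(2) k by simp
  have ct: "couple_type B W = add_mset (k + 1) s"
    using couple_type_rest[OF fin B W C(1)] cardC by (simp add: s_def)
  have s0: "0 \<notin># s"
    using polygons_even[OF fin B W] by (fastforce simp: s_def rest_type_def finite_polygons[OF fin B W])
  let ?\<psi> = "\<lambda>i. (if i = 0 then a else 1) * (if i = k then b else 1) *
        g (s + (if i = 0 then {#} else {#i#}) + (if i = k then {#} else {#k - i#}))"
  have split: "cyc B W (x # take j X @ X ! j # drop (Suc j) X)" "set (x # take j X @ X ! j # drop (Suc j) X) = C"
    if "j < 2 * k + 1" for j
    using id_take_nth_drop[of j X] X that k by auto
  have odd: "\<phi> (X ! (2 * i + 1)) = gamma_par \<alpha> * g (add_mset k s)" if i: "i < k" for i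
  proof -
    let ?j = "2 * i + 1"
    have j: "?j < 2 * k + 1" using i by simp
    note c = split[OF j]
    have CP: "set (x # take ?j X @ X ! ?j # drop (Suc ?j) X) \<in> polygons B W" using C(1) c(2) by simp
    have l: "length (take ?j X) = ?j" "length (drop (Suc ?j) X) = 2 * k - ?j" using j k by auto
    have o: "odd (length (take ?j X))" unfolding l by simp
    have "(length (take ?j X) + length (drop (Suc ?j) X)) div 2 = k" unfolding l using i by simp
    then show ?thesis
      unfolding \<phi>_def using remove_twisted[OF fin B W c(1) CP o] edge_weight_same_face[OF fin B W c(1) CP] o c(2)
      by (simp add: s_def)
  qed
  have even: "\<phi> (X ! (2 * i)) = ?\<psi> i" if i: "i \<le> k" for i
  proof -
    let ?j = "2 * i" and ?y = "X ! (2 * i)"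
    let ?P = "take ?j X" and ?Q = "drop (Suc ?j) X"
    have j: "?j < 2 * k + 1" using i by simp
    note c = split[OF j]
    note G = cyc_split_facts[OF c(1)]
    have CP: "set (x # ?P @ ?y # ?Q) \<in> polygons B W" using C(1) c(2) by simp
    have l: "length ?P = ?j" "length ?Q = 2 * (k - i)" using j k by auto
    have e: "even (length ?P)" unfolding l by simp
    have P: "?P = [] \<longleftrightarrow> i = 0" using l(1) by (metis length_0_conv mult_eq_0_iff zero_neq_numeral)
    have Q: "?Q = [] \<longleftrightarrow> i = k" using l(2) i by (metis length_0_conv mult_eq_0_iff zero_neq_numeral diff_is_0_eq le_antisym)
    have eB: "{x, ?y} \<in> B \<longleftrightarrow> i = 0"
    proof
      assume yB: "{x, ?y} \<in> B"
      show "i = 0"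
      proof (rule ccontr)
        assume "i \<noteq> 0"
        then have "?P \<noteq> []" using P by simp
        then have "hd ?P = ?y" using pairing_partner_unique[OF B G(1) yB] by simp
        then show False using G(15) \<open>?P \<noteq> []\<close> by (metis hd_in_set)
      qed
    qed (use G(2) P in simp)
    have eW: "{x, ?y} \<in> W \<longleftrightarrow> i = k"
    proof
      assume yW: "{x, ?y} \<in> W"
      show "i = k"
      proof (rule ccontr)
        assume "i \<noteq> k"
        then have "?Q \<noteq> []" using Q by simp
        then have "last ?Q = ?y" using pairing_partner_unique[OF W G(3) yW] by simp
        then show False using G(16) \<open>?Q \<noteq> []\<close> by (metis last_in_set)
      qed
    qed (use G(4) Q in simp)
    have w: "edge_weight \<alpha> (B, W, {}) {x, ?y} = 1" using edge_weight_same_face[OF fin B W c(1) CP] e by simp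
    have t: "couple_type (pairing_remove {x, ?y} B) (pairing_remove {x, ?y} W) =
       s + (if i = 0 then {#} else {#i#}) + (if i = k then {#} else {#k - i#})"
      unfolding remove_straight(3)[OF fin B W c(1) CP e] P Q l c(2) s_def by simp
    show ?thesis unfolding \<phi>_def w eB eW t by simp
  qed
  have "(\<Sum>y\<in>set X. \<phi> y) = (\<Sum>j<2 * k + 1. \<phi> (X ! j))"
    using sum.reindex_bij_betw[OF bij_betw_nth[OF F(3) refl refl], of \<phi>] k by simp
  also have "\<dots> = (\<Sum>i\<le>k. ?\<psi> i) + real k * (gamma_par \<alpha> * g (add_mset k s))"
    unfolding sum_even_odd using even odd by simp
  finally have same: "(\<Sum>y\<in>set X. \<phi> y) = (\<Sum>i\<le>k. ?\<psi> i) + real k * (gamma_par \<alpha> * g (add_mset k s))" .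
  have face: "(\<Sum>y\<in>D. \<phi> y) = real (card D div 2) * g (add_mset (k + card D div 2) (s - {#card D div 2#}))"
    if D: "D \<in> polygons B W - {C}" for D
  proof -
    have D': "D \<in> polygons B W" "C \<noteq> D" using D by auto
    have "\<phi> y = 1 / 2 * g (add_mset (k + card D div 2) (s - {#card D div 2#}))" if y: "y \<in> D" for y
      unfolding \<phi>_def
      using remove_interface[OF fin B W C(1) D' C(2) y] edge_weight_interface[OF fin B W C(1) D' C(2) y] cardC
      by (simp add: s_def)
    \<comment> \<open>All sides of \<open>D\<close> lead to the same type, each with weight 1/2, so
      together they count the half length of \<open>D\<close>.\<close>
    then have "(\<Sum>y\<in>D. \<phi> y) = (\<Sum>y\<in>D. 1 / 2 * g (add_mset (k + card D div 2) (s - {#card D div 2#})))"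
      by (intro sum.cong refl)
    moreover have "real (card D) = 2 * real (card D div 2)" using polygons_even(2)[OF fin B W D'(1)] by (auto elim!: evenE)
    ultimately show ?thesis by simp
  qed
  have "(\<Sum>y\<in>\<Union>(polygons B W - {C}). \<phi> y) = (\<Sum>D\<in>polygons B W - {C}. \<Sum>y\<in>D. \<phi> y)"
    using polygons_even(1)[OF fin B W] polygons_disjoint[OF fin B W]
    by (intro sum.Union_disjoint[unfolded comp_def]) blast+
  also have "\<dots> = (\<Sum>D\<in>polygons B W - {C}. real (card D div 2) * g (add_mset (k + card D div 2) (s - {#card D div 2#})))"
    using face by (intro sum.cong refl)
  also have "\<dots> = (\<Sum>t\<in>#s. real t * g (add_mset (k + t) (s - {#t#})))"
    by (simp add: sum_unfold_sum_mset rest_type_def s_def image_mset.compositionality comp_def)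
  finally have other: "(\<Sum>y\<in>\<Union>(polygons B W - {C}). \<phi> y) = (\<Sum>t\<in>#s. real t * g (add_mset (k + t) (s - {#t#})))" .
  have dis: "C \<inter> \<Union>(polygons B W - {C}) = {}" using polygons_disjoint[OF fin B W C(1)] by blast
  have "S = C \<union> \<Union>(polygons B W - {C})" using partition_onD1[OF part] C(1) by blast
  moreover have "C - {x} = set X" using X(2) F(4) by auto
  ultimately have S: "S - {x} = set X \<union> \<Union>(polygons B W - {C})" using dis C(2) by blast
  have "finite (\<Union>(polygons B W - {C}))" using partition_onD1[OF part] fin by (meson Diff_subset Union_mono finite_subset)
  then have "(\<Sum>y\<in>S - {x}. \<phi> y) = (\<Sum>y\<in>set X. \<phi> y) + (\<Sum>y\<in>\<Union>(polygons B W - {C}). \<phi> y)"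
    unfolding S using dis X(2) by (intro sum.union_disjoint) auto
  then have "(\<Sum>y\<in>S - {x}. \<phi> y) = g (couple_type B W)"
    unfolding same other ct map_recursion_sum[OF g s0] .
  then show ?thesis unfolding \<phi>_def .
qed

text \<open>Every edge-side contributes the same by \<open>vertex_sum\<close>, and each edge is
  counted from both of its sides. The factor \<open>card S / 2\<close> from the average over the
  first edge therefore cancels, and induction on the ground set applies.\<close>

lemma map_sum_eq:
  assumes "finite S" "pairing S B" "pairing S W" "map_recursion \<alpha> a b g"
  shows "map_sum \<alpha> a b B W = g (couple_type B W)"
  using assms(1-3)
proof (induction "card S" arbitrary: S B W rule: less_induct)
  case less
  note fin = less.prems(1) and B = less.prems(2) and W = less.prems(3)
  show ?case
  proof (cases "S = {}")
    case True
    have emp: "E = {}" if "pairing S E" for E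
      using that pairing_card[OF that] pairing_subset[OF that] True by (metis card.empty equals0I subset_empty zero_neq_numeral)
    then have BW: "B = {}" "W = {}" using B W by auto
    have "Collect (pairing S) = {{}}"
      using emp True by (auto simp: pairing_def partition_on_def)
    then have "map_sum \<alpha> a b B W = 1"
      unfolding map_sum_def pairing_Union[OF B] by (simp add: BW polygons_def map_weight_def)
    then show ?thesis
      using assms(4) unfolding BW by (simp add: polygons_def couple_type_def map_recursion_def)
  next
    case False
    define \<phi> where "\<phi> e = edge_weight \<alpha> (B, W, {}) e * ((if e \<in> B then a else 1) * (if e \<in> W then b else 1)) *
      g (couple_type (pairing_remove e B) (pairing_remove e W))" for e
    have "real (card S) / 2 * map_sum \<alpha> a b B W = (\<Sum>e\<in>pairs S. \<phi> e)"
      unfolding map_sum_remove[OF fin B W False]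
    proof (intro sum.cong refl)
      fix e assume "e \<in> pairs S"
      then have e: "e \<subseteq> S" "card e = 2" by (auto simp: pairs_def)
      then have "e \<noteq> {}" by auto
      then have "S - e \<subset> S" using e by blast
      then have "card (S - e) < card S" using fin by (rule psubset_card_mono[rotated])
      from less.hyps[OF this _ pairing_pairing_remove[OF B e] pairing_pairing_remove[OF W e]] fin
      show "edge_weight \<alpha> (B, W, {}) e * ((if e \<in> B then a else 1) * (if e \<in> W then b else 1)) *
         map_sum \<alpha> a b (pairing_remove e B) (pairing_remove e W) = \<phi> e"
        by (simp add: \<phi>_def)
    qed
    also have "\<dots> = 1 / 2 * (\<Sum>x\<in>S. \<Sum>y\<in>S - {x}. \<phi> {x, y})"
      using sum_pairs[OF fin, of \<phi>] by simp
    also have "(\<Sum>x\<in>S. \<Sum>y\<in>S - {x}. \<phi> {x, y}) = (\<Sum>x\<in>S. g (couple_type B W))"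
      unfolding \<phi>_def by (intro sum.cong refl vertex_sum[OF fin B W _ assms(4)])
    finally have "real (card S) / 2 * map_sum \<alpha> a b B W = real (card S) / 2 * g (couple_type B W)" by simp
    moreover have "real (card S) / 2 \<noteq> 0" using False fin by simp
    ultimately show ?thesis by (metis mult_left_cancel)
  qed
qed

lemma rect_g_map_recursion:
  assumes a: "\<alpha> > 0"
  shows "map_recursion \<alpha> (- real p / sqrt \<alpha>) (sqrt \<alpha> * real q) (rect_g \<alpha> p q)"
  unfolding map_recursion_def
proof (intro conjI allI impI)
  show "rect_g \<alpha> p q {#} = 1" by (rule rect_g_empty[OF a])
  have ab: "- real p / sqrt \<alpha> * (sqrt \<alpha> * real q) = - (real p * real q)" using a by simp
  show "rect_g \<alpha> p q (add_mset 1 s) = (- real p / sqrt \<alpha> * (sqrt \<alpha> * real q) + real (sum_mset s)) * rect_g \<alpha> p q s" for s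
    unfolding ab rect_g_one[OF a] by simp
  show "rect_g \<alpha> p q (add_mset (k + 1) s) =
        (\<Sum>i=1..<k. rect_g \<alpha> p q (add_mset (k - i) (add_mset i s)))
        + (- real p / sqrt \<alpha> + sqrt \<alpha> * real q + gamma_par \<alpha> * real k) * rect_g \<alpha> p q (add_mset k s)
        + (\<Sum>t\<in>#s. real t * rect_g \<alpha> p q (add_mset (k + t) (s - {#t#})))" if "0 < k" "0 \<notin># s" for k s
    unfolding rect_g_rec[OF a that(2,1)] by (simp add: algebra_simps)
qed

lemma Ch_hat_rectangle:
  assumes fin: "finite S" and B: "pairing S B" and W: "pairing S W" and pq: "p = 0 \<longleftrightarrow> q = 0"
  shows "Ch_hat B W \<alpha> \<pi> (rectangle p q) = (- 1) ^ size \<pi> * map_sum \<alpha> (- real p / sqrt \<alpha>) (sqrt \<alpha> * real q) B W"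
proof -
  have "(- 1 / sqrt \<alpha>) ^ card (polygons B E) * sqrt \<alpha> ^ card (polygons W E) * map_weight \<alpha> (B, W, E) *
      real (N_map (B, W, E) (rectangle p q)) =
      (- real p / sqrt \<alpha>) ^ card (polygons B E) * (sqrt \<alpha> * real q) ^ card (polygons W E) * map_weight \<alpha> (B, W, E)"
    if E: "pairing S E" for E
  proof -
    have "- real p / sqrt \<alpha> = (- 1 / sqrt \<alpha>) * real p" by simp
    then show ?thesis
      unfolding N_map_rectangle[OF fin B W E boxes_rectangle pq] by (simp only: power_mult_distrib of_nat_mult of_nat_power mult_ac)
  qed
  then show ?thesis
    unfolding Ch_hat_def map_sum_def pairing_Union[OF B] black_vertices.simps white_vertices.simps
    by (intro arg_cong[of _ _ "(*) _"] sum.cong refl) (simp only: mem_Collect_eq)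
qed

theorem theorem4p1:
  fixes p q :: nat and \<pi> :: "nat multiset" and \<alpha> :: real and B W :: "'a set set"
  assumes "is_partition \<pi>" and "\<alpha> > 0" and "is_couple B W \<pi>"
  shows "jack_Ch \<alpha> \<pi> (rectangle p q) = Ch_hat B W \<alpha> \<pi> (rectangle p q)"
proof -
  obtain S where S: "finite S" "pairing S B" "pairing S W" and type: "couple_type B W = \<pi>"
    using assms(3) by (auto simp: is_couple_def)
  have main: "jack_Ch \<alpha> \<pi> (rectangle p q) = Ch_hat B W \<alpha> \<pi> (rectangle p q)" if "p = 0 \<longleftrightarrow> q = 0" for p q
    unfolding jack_Ch_rectangle[OF assms(2,1)] Ch_hat_rectangle[OF S that]
      map_sum_eq[OF S rect_g_map_recursion[OF assms(2)]] type ..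
  show ?thesis
  proof (cases "p * q = 0")
    case True
    \<comment> \<open>If only one side is 0, the diagram is still empty; viewing it as the rectangle
      with both sides 0 meets the condition of \<open>main\<close>.\<close>
    then have "rectangle p q = rectangle 0 0" by (simp only: rectangle_empty mult_zero_left)
    then show ?thesis using main[of 0 0] by simp
  next
    case False
    then show ?thesis using main[of p q] by simp
  qed
qed

end
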